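(* Let $\hat{\mathbf r}:[T_-,T_+]\to\mathbb R^3$ be a trajectory and let solutions $\psi_n$ of the KG equation concentrate at $\hat{\mathbf r}$ (in the sense defined in the context), with $t_0$ the time in condition (iv). Then there is a real constant $\bar\rho_\infty$, independent of $t$ (obtained as a uniform limit on $[T_-,T_+]$ of the restricted charges $\bar\rho_n(t)$ along a subsequence), such that the restricted energies $\bar{\mathcal E}_n(t)$ converge to a limit restricted energy $\bar{\mathcal E}_\infty(t)$ satisfying $$\bar{\mathcal E}_\infty(t)=\bar{\mathcal E}_\infty(t_0)-\bar\rho_\infty\int_{t_0}^{t}\partial_t\hat{\mathbf r}(t')\cdot\nabla\varphi_\infty(t')\,dt',$$ and the limit energy and the trajectory satisfy $$\partial_t\Big(\frac{1}{c^2}\bar{\mathcal E}_\infty(t)\,\partial_t\hat{\mathbf r}(t)\Big)=\mathbf f_\infty(t),\qquad \mathbf f_\infty(t)=-\bar\rho_\infty\nabla\varphi_\infty(t).$$ Moreover, if one defines $M(t)=\bar{\mathcal E}_\infty(t)/c^2$, then $M(t)=\gamma(t)M_0$ with $\gamma=(1-|\partial_t\hat{\mathbf r}|^2/c^2)^{-1/2}$ and $M_0$ a constant.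
   Context: Fix constants $c>0$, $m>0$ and a real charge $q$. For parameters $\chi>0$, $a>0$ and a real electric potential $\varphi(t,\mathbf x)$, $\mathbf x\in\mathbb R^3$, the KG equation for complex $\psi$ is $-c^{-2}\tilde\partial_t^2\psi+\Delta\psi-G_a'(|\psi|^2)\psi-\kappa_0^2\psi=0$, where $\tilde\partial_t=\partial_t+\mathrm i q\varphi/\chi$, $\kappa_0=mc/\chi$. Here $G_a(s)=a^{-5}G_1(a^3s)$, where $G_1(0)=0$, $G_1'\in C^1((0,\infty))$, the map $\psi\mapsto G_1'(|\psi|^2)\psi$ extends to a $C^\alpha(\mathbb C)$ function and $\psi\mapsto G_1(|\psi|^2)$ is $C^{1+\alpha}(\mathbb C)$ for every $\alpha\in(0,1)$, and for every $C_1$ there is $C$ with $|G_1(|\psi|^2)|\le C|\psi|^{1+\alpha}$, $|G_1'(|\psi|^2)||\psi|\le C|\psi|^\alpha$ for $|\psi|\le C_1$. Put $a_C=\chi/(mc)$. Charge density: $\rho=-\frac{\chi q}{mc^2}\operatorname{Im}(\psi^*\tilde\partial_t\psi)$. Energy density: $\mathcal E=\frac{\chi^2}{2m}\big[c^{-2}|\tilde\partial_t\psi|^2+|\nabla\psi|^2+G_a(|\psi|^2)+\kappa_0^2|\psi|^2\big]$. Write $\nabla_{0,\mathbf x}=(c^{-1}\partial_t,\partial_1,\partial_2,\partial_3)$ and $|\nabla_{0,\mathbf x}f|^2$ for the sum of squared moduli of its components. Trajectory: $\hat{\mathbf r}\in C^2([T_-,T_+];\mathbb R^3)$ with $|\partial_t\hat{\mathbf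 r}|,|\partial_t^2\hat{\mathbf r}|\le C$. For $R_n>0$, $R_n\to0$, let $\Omega_n(t)=\{\mathbf x:|\mathbf x-\hat{\mathbf r}(t)|\le R_n\}$ and $\hat\Omega_n=\{(t,\mathbf x):T_-\le t\le T_+,\ \mathbf x\in\Omega_n(t)\}$. Localized KG equations: sequences $a_n\to0$, $\chi_n\to0$ with $a_{C,n}/a_n\le C$ and $R_n/a_n\to\infty$, and potentials $\varphi_n\in C^2(\hat\Omega_n)$ with $\sup_{\hat\Omega_n}(|\varphi_n|+|\nabla_{0,\mathbf x}\varphi_n|)\le C$ uniformly in $n$, and a limit potential $\varphi_\infty(t,\mathbf x)=\varphi_\infty(t,\hat{\mathbf r}(t))+(\mathbf x-\hat{\mathbf r}(t))\cdot\nabla\varphi_\infty(t)$ (with $\nabla\varphi_\infty(t)$ a vector depending only on $t$) such that $\sup_{\hat\Omega_n}(|\varphi_n-\varphi_\infty|+|\nabla_{0,\mathbf x}\varphi_n-\nabla_{0,\mathbf x}\varphi_\infty|)\to0$ and $|\varphi_\infty(t,\hat{\mathbf r}(t))|,|\nabla\varphi_\infty(t)|,|\partial_t\nabla\varphi_\infty(t)|\le C$ on $[T_-,T_+]$. Concentrating solutions: for such a localized sequence, functions $\psi_n\in C^2(\hat\Omega_n)$ solving the KG equation with parameters $(\chi_n,a_n,\varphi_n)$ in $\hat\Omega_n$ such that: (i) $\max_t\int_{\Omega_n(t)}[a_C^2|\nabla_{0,\mathbf x}\psi_n|^2+a_C^2|G_a(|\psi_n|^2)|+|\psi_n|^2]\,d^3x\le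 C$; (ii) $\max_t\int_{\partial\Omega_n(t)}[a_C^2|\nabla_{0,\mathbf x}\psi_n|^2+a_C^2|G_a(|\psi_n|^2)|+|\psi_n|^2]\,d^2\sigma\to0$; (iii) the restricted energy $\bar{\mathcal E}_n(t)=\int_{\Omega_n(t)}\mathcal E_n\,d^3x$ satisfies $\bar{\mathcal E}_n(t)\ge c_0>0$ for $n\ge n_0$, $t\in[T_-,T_+]$; (iv) there is $t_0\in[T_-,T_+]$ with $\bar{\mathcal E}_n(t_0)\to\bar{\mathcal E}_\infty(t_0)$. Restricted charge: $\bar\rho_n(t)=\int_{\Omega_n(t)}\rho_n\,d^3x$. *)

theory Defs
  imports "HOL-Analysis.Analysis"
begin

definition C1_on :: "('a::real_normed_vector) set \<Rightarrow> ('a \<Rightarrow> 'b::real_normed_vector)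
    \<Rightarrow> ('a \<Rightarrow> 'a \<Rightarrow>\<^sub>L 'b) \<Rightarrow> bool" where
  "C1_on S f f' \<longleftrightarrow> (\<forall>z\<in>S. (f has_derivative blinfun_apply (f' z)) (at z within S))
      \<and> continuous_on S f'"

definition C2_on :: "('a::real_normed_vector) set \<Rightarrow> ('a \<Rightarrow> 'b::real_normed_vector)
    \<Rightarrow> ('a \<Rightarrow> 'a \<Rightarrow>\<^sub>L 'b) \<Rightarrow> ('a \<Rightarrow> 'a \<Rightarrow>\<^sub>L 'a \<Rightarrow>\<^sub>L 'b) \<Rightarrow> bool" where
  "C2_on S f f' f'' \<longleftrightarrow> C1_on S f f' \<and> C1_on S f' f''"

definition dt :: "(real \<times> (real^3) \<Rightarrow> (real \<times> (real^3)) \<Rightarrow>\<^sub>L 'b::real_normed_vector)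
    \<Rightarrow> real \<times> (real^3) \<Rightarrow> 'b" where
  "dt D z = blinfun_apply (D z) (1, 0)"

definition dx :: "(real \<times> (real^3) \<Rightarrow> (real \<times> (real^3)) \<Rightarrow>\<^sub>L 'b::real_normed_vector)
    \<Rightarrow> real \<times> (real^3) \<Rightarrow> 3 \<Rightarrow> 'b" where
  "dx D z i = blinfun_apply (D z) (0, axis i 1)"

definition dtt :: "(real \<times> (real^3) \<Rightarrow> (real \<times> (real^3)) \<Rightarrow>\<^sub>L (real \<times> (real^3)) \<Rightarrow>\<^sub>L 'b::real_normed_vector)
    \<Rightarrow> real \<times> (real^3) \<Rightarrow> 'b" where
  "dtt D2 z = blinfun_apply (blinfun_apply (D2 z) (1, 0)) (1, 0)"

definition lap :: "(real \<times> (real^3) \<Rightarrow> (real \<times> (real^3)) \<Rightarrow>\<^sub>L (real \<times> (real^3)) \<Rightarrow>\<^sub>L 'b::real_normed_vector)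
    \<Rightarrow> real \<times> (real^3) \<Rightarrow> 'b" where
  "lap D2 z = (\<Sum>i\<in>UNIV. blinfun_apply (blinfun_apply (D2 z) (0, axis i 1)) (0, axis i 1))"

definition gradx :: "(real \<times> (real^3) \<Rightarrow> (real \<times> (real^3)) \<Rightarrow>\<^sub>L real) \<Rightarrow> real \<times> (real^3) \<Rightarrow> real^3" where
  "gradx D z = (\<chi> i. dx D z i)"

definition nabla0_norm :: "real \<Rightarrow> real \<Rightarrow> real^3 \<Rightarrow> real" where
  "nabla0_norm c ft fx = sqrt ((ft / c)\<^sup>2 + (norm fx)\<^sup>2)"

definition nabla0_sq :: "real \<Rightarrow> (real \<times> (real^3) \<Rightarrow> (real \<times> (real^3)) \<Rightarrow>\<^sub>L complex)
    \<Rightarrow> real \<times> (real^3) \<Rightarrow> real" where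
  "nabla0_sq c D z = (cmod (dt D z))\<^sup>2 / c\<^sup>2 + (\<Sum>i\<in>UNIV. (cmod (dx D z i))\<^sup>2)"

definition loc_holder :: "real \<Rightarrow> ('a::metric_space \<Rightarrow> 'b::metric_space) \<Rightarrow> bool" where
  "loc_holder al f \<longleftrightarrow> (\<forall>K. bounded K \<longrightarrow>
      (\<exists>L. \<forall>x\<in>K. \<forall>y\<in>K. dist (f x) (f y) \<le> L * (dist x y) powr al))"

definition admissible_G1 :: "(real \<Rightarrow> real) \<Rightarrow> (real \<Rightarrow> real) \<Rightarrow> bool" where
  "admissible_G1 G1 G1' \<longleftrightarrow>
     G1 0 = 0 \<and>
     (\<forall>s>0. (G1 has_real_derivative G1' s) (at s)) \<and>
     (\<exists>G1''. (\<forall>s>0. (G1' has_real_derivative G1'' s) (at s)) \<and> continuous_on {0<..} G1'') \<and>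
     (\<forall>al. 0 < al \<and> al < 1 \<longrightarrow>
        loc_holder al (\<lambda>w::complex. if w = 0 then 0 else complex_of_real (G1' ((cmod w)\<^sup>2)) * w) \<and>
        (\<exists>DG :: complex \<Rightarrow> complex \<Rightarrow>\<^sub>L real.
            (\<forall>w. ((\<lambda>w. G1 ((cmod w)\<^sup>2)) has_derivative blinfun_apply (DG w)) (at w))
            \<and> loc_holder al DG) \<and>
        (\<forall>C1. \<exists>C. \<forall>w::complex. cmod w \<le> C1 \<longrightarrow>
            \<bar>G1 ((cmod w)\<^sup>2)\<bar> \<le> C * (cmod w) powr (1 + al) \<and>
            \<bar>G1' ((cmod w)\<^sup>2)\<bar> * cmod w \<le> C * (cmod w) powr al))"

definition Ga :: "(real \<Rightarrow> real) \<Rightarrow> real \<Rightarrow> real \<Rightarrow> real" where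
  "Ga G1 a s = G1 (a ^ 3 * s) / a ^ 5"

text \<open>G_a'(|psi|^2) psi = a^{-2} G_1'(a^3 |psi|^2) psi, continuously extended by 0 at psi = 0\<close>
definition NL :: "(real \<Rightarrow> real) \<Rightarrow> real \<Rightarrow> complex \<Rightarrow> complex" where
  "NL G1' a w = (if w = 0 then 0 else complex_of_real (G1' (a ^ 3 * (cmod w)\<^sup>2) / a\<^sup>2) * w)"

definition cov_dt :: "real \<Rightarrow> real \<Rightarrow> real \<Rightarrow> complex \<Rightarrow> complex \<Rightarrow> complex" where
  "cov_dt q chi phiv psit psiv = psit + \<i> * complex_of_real (q * phiv / chi) * psiv"

text \<open>KG equation at z; the second covariant time derivative is expanded by the product rule:
  tilde d_t (tilde d_t psi) = d_t (d_t psi + i theta psi) + i theta (d_t psi + i theta psi),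
  theta = q phi / chi.\<close>
definition KG_at :: "real \<Rightarrow> real \<Rightarrow> real \<Rightarrow> (real \<Rightarrow> real) \<Rightarrow> real \<Rightarrow> real
    \<Rightarrow> (real \<times> (real^3) \<Rightarrow> real) \<Rightarrow> (real \<times> (real^3) \<Rightarrow> (real \<times> (real^3)) \<Rightarrow>\<^sub>L real)
    \<Rightarrow> (real \<times> (real^3) \<Rightarrow> complex) \<Rightarrow> (real \<times> (real^3) \<Rightarrow> (real \<times> (real^3)) \<Rightarrow>\<^sub>L complex)
    \<Rightarrow> (real \<times> (real^3) \<Rightarrow> (real \<times> (real^3)) \<Rightarrow>\<^sub>L (real \<times> (real^3)) \<Rightarrow>\<^sub>L complex)
    \<Rightarrow> real \<times> (real^3) \<Rightarrow> bool" where
  "KG_at c m q G1' chi a phi Dphi psi Dpsi D2psi z \<longleftrightarrow>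
     (let th = complex_of_real (q * phi z / chi);
          tht = complex_of_real (q * dt Dphi z / chi);
          psit = dt Dpsi z;
          cov2 = dtt D2psi z + \<i> * tht * psi z + \<i> * th * psit + \<i> * th * (psit + \<i> * th * psi z)
      in - cov2 / complex_of_real (c\<^sup>2) + lap D2psi z - NL G1' a (psi z)
           - complex_of_real ((m * c / chi)\<^sup>2) * psi z = 0)"

definition rho_dens :: "real \<Rightarrow> real \<Rightarrow> real \<Rightarrow> real
    \<Rightarrow> (real \<times> (real^3) \<Rightarrow> real) \<Rightarrow> (real \<times> (real^3) \<Rightarrow> complex)
    \<Rightarrow> (real \<times> (real^3) \<Rightarrow> (real \<times> (real^3)) \<Rightarrow>\<^sub>L complex) \<Rightarrow> real \<times> (real^3) \<Rightarrow> real" where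
  "rho_dens c m q chi phi psi Dpsi z =
     - (chi * q / (m * c\<^sup>2)) * Im (cnj (psi z) * cov_dt q chi (phi z) (dt Dpsi z) (psi z))"

definition energy_dens :: "real \<Rightarrow> real \<Rightarrow> real \<Rightarrow> (real \<Rightarrow> real) \<Rightarrow> real \<Rightarrow> real
    \<Rightarrow> (real \<times> (real^3) \<Rightarrow> real) \<Rightarrow> (real \<times> (real^3) \<Rightarrow> complex)
    \<Rightarrow> (real \<times> (real^3) \<Rightarrow> (real \<times> (real^3)) \<Rightarrow>\<^sub>L complex) \<Rightarrow> real \<times> (real^3) \<Rightarrow> real" where
  "energy_dens c m q G1 chi a phi psi Dpsi z =
     chi\<^sup>2 / (2 * m) *
       ((cmod (cov_dt q chi (phi z) (dt Dpsi z) (psi z)))\<^sup>2 / c\<^sup>2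
        + (\<Sum>i\<in>UNIV. (cmod (dx Dpsi z i))\<^sup>2)
        + Ga G1 a ((cmod (psi z))\<^sup>2)
        + (m * c / chi)\<^sup>2 * (cmod (psi z))\<^sup>2)"

definition Omega_hat :: "real \<Rightarrow> real \<Rightarrow> (real \<Rightarrow> real^3) \<Rightarrow> real \<Rightarrow> (real \<times> (real^3)) set" where
  "Omega_hat Tm Tp r R = {(t, x). Tm \<le> t \<and> t \<le> Tp \<and> x \<in> cball (r t) R}"

definition sphere_integral :: "real^3 \<Rightarrow> real \<Rightarrow> (real^3 \<Rightarrow> real) \<Rightarrow> real" where
  "sphere_integral p R h = integral ({0..pi} \<times> {0..2 * pi})
     (\<lambda>(th, ph). h (p + R *\<^sub>R vector [sin th * cos ph, sin th * sin ph, cos th]) * R\<^sup>2 * sin th)"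

definition oint :: "real \<Rightarrow> real \<Rightarrow> (real \<Rightarrow> real) \<Rightarrow> real" where
  "oint a b f = (if a \<le> b then integral {a..b} f else - integral {b..a} f)"

definition trajectory :: "real \<Rightarrow> real \<Rightarrow> (real \<Rightarrow> real^3) \<Rightarrow> (real \<Rightarrow> real^3) \<Rightarrow> (real \<Rightarrow> real^3) \<Rightarrow> bool" where
  "trajectory Tm Tp r r' r'' \<longleftrightarrow>
     (\<forall>t\<in>{Tm..Tp}. (r has_vector_derivative r' t) (at t within {Tm..Tp})
                 \<and> (r' has_vector_derivative r'' t) (at t within {Tm..Tp}))
     \<and> continuous_on {Tm..Tp} r''
     \<and> (\<exists>C. \<forall>t\<in>{Tm..Tp}. norm (r' t) \<le> C \<and> norm (r'' t) \<le> C)"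

text \<open>The limit potential phi_inf(t,x) = phi0(t) + (x - r(t)) . g(t), g(t) = grad phi_inf(t).\<close>
definition phi_inf :: "(real \<Rightarrow> real^3) \<Rightarrow> (real \<Rightarrow> real) \<Rightarrow> (real \<Rightarrow> real^3) \<Rightarrow> real \<times> (real^3) \<Rightarrow> real" where
  "phi_inf r phi0 g z = phi0 (fst z) + (snd z - r (fst z)) \<bullet> g (fst z)"

definition phi_inf_t :: "(real \<Rightarrow> real^3) \<Rightarrow> (real \<Rightarrow> real^3) \<Rightarrow> (real \<Rightarrow> real) \<Rightarrow> (real \<Rightarrow> real^3)
    \<Rightarrow> (real \<Rightarrow> real^3) \<Rightarrow> real \<times> (real^3) \<Rightarrow> real" where
  "phi_inf_t r r' phi0' g g' z =
     phi0' (fst z) - r' (fst z) \<bullet> g (fst z) + (snd z - r (fst z)) \<bullet> g' (fst z)"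

definition localized :: "real \<Rightarrow> real \<Rightarrow> real \<Rightarrow> real \<Rightarrow> (real \<Rightarrow> real^3) \<Rightarrow> (real \<Rightarrow> real^3)
    \<Rightarrow> (nat \<Rightarrow> real) \<Rightarrow> (nat \<Rightarrow> real) \<Rightarrow> (nat \<Rightarrow> real)
    \<Rightarrow> (nat \<Rightarrow> real \<times> (real^3) \<Rightarrow> real) \<Rightarrow> (nat \<Rightarrow> real \<times> (real^3) \<Rightarrow> (real \<times> (real^3)) \<Rightarrow>\<^sub>L real)
    \<Rightarrow> (nat \<Rightarrow> real \<times> (real^3) \<Rightarrow> (real \<times> (real^3)) \<Rightarrow>\<^sub>L (real \<times> (real^3)) \<Rightarrow>\<^sub>L real)
    \<Rightarrow> (real \<Rightarrow> real) \<Rightarrow> (real \<Rightarrow> real) \<Rightarrow> (real \<Rightarrow> real^3) \<Rightarrow> (real \<Rightarrow> real^3) \<Rightarrow> bool" where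
  "localized c m Tm Tp r r' R a chi phi Dphi D2phi phi0 phi0' g g' \<longleftrightarrow>
     (\<forall>n. R n > 0 \<and> a n > 0 \<and> chi n > 0) \<and>
     R \<longlonglongrightarrow> 0 \<and> a \<longlonglongrightarrow> 0 \<and> chi \<longlonglongrightarrow> 0 \<and>
     (\<exists>C. \<forall>n. (chi n / (m * c)) / a n \<le> C) \<and>
     filterlim (\<lambda>n. R n / a n) at_top sequentially \<and>
     (\<forall>n. C2_on (Omega_hat Tm Tp r (R n)) (phi n) (Dphi n) (D2phi n)) \<and>
     (\<exists>C. \<forall>n. \<forall>z\<in>Omega_hat Tm Tp r (R n).
         \<bar>phi n z\<bar> + nabla0_norm c (dt (Dphi n) z) (gradx (Dphi n) z) \<le> C) \<and>
     (\<forall>t\<in>{Tm..Tp}. (phi0 has_real_derivative phi0' t) (at t within {Tm..Tp})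
                 \<and> (g has_vector_derivative g' t) (at t within {Tm..Tp})) \<and>
     (\<forall>e>0. \<forall>\<^sub>F n in sequentially. \<forall>z\<in>Omega_hat Tm Tp r (R n).
         \<bar>phi n z - phi_inf r phi0 g z\<bar>
         + nabla0_norm c (dt (Dphi n) z - phi_inf_t r r' phi0' g g' z)
                         (gradx (Dphi n) z - g (fst z)) < e) \<and>
     (\<exists>C. \<forall>t\<in>{Tm..Tp}. \<bar>phi0 t\<bar> \<le> C \<and> norm (g t) \<le> C \<and> norm (g' t) \<le> C)"

definition E_bar :: "real \<Rightarrow> real \<Rightarrow> real \<Rightarrow> (real \<Rightarrow> real) \<Rightarrow> real \<Rightarrow> real
    \<Rightarrow> (real \<times> (real^3) \<Rightarrow> real) \<Rightarrow> (real \<times> (real^3) \<Rightarrow> complex)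
    \<Rightarrow> (real \<times> (real^3) \<Rightarrow> (real \<times> (real^3)) \<Rightarrow>\<^sub>L complex) \<Rightarrow> real^3 \<Rightarrow> real \<Rightarrow> real \<Rightarrow> real" where
  "E_bar c m q G1 chi a phi psi Dpsi p R t =
     integral (cball p R) (\<lambda>x. energy_dens c m q G1 chi a phi psi Dpsi (t, x))"

definition rho_bar :: "real \<Rightarrow> real \<Rightarrow> real \<Rightarrow> real
    \<Rightarrow> (real \<times> (real^3) \<Rightarrow> real) \<Rightarrow> (real \<times> (real^3) \<Rightarrow> complex)
    \<Rightarrow> (real \<times> (real^3) \<Rightarrow> (real \<times> (real^3)) \<Rightarrow>\<^sub>L complex) \<Rightarrow> real^3 \<Rightarrow> real \<Rightarrow> real \<Rightarrow> real" where
  "rho_bar c m q chi phi psi Dpsi p R t =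
     integral (cball p R) (\<lambda>x. rho_dens c m q chi phi psi Dpsi (t, x))"

definition loc_dens :: "real \<Rightarrow> real \<Rightarrow> (real \<Rightarrow> real) \<Rightarrow> real \<Rightarrow> real
    \<Rightarrow> (real \<times> (real^3) \<Rightarrow> complex) \<Rightarrow> (real \<times> (real^3) \<Rightarrow> (real \<times> (real^3)) \<Rightarrow>\<^sub>L complex)
    \<Rightarrow> real \<times> (real^3) \<Rightarrow> real" where
  "loc_dens c m G1 chi a psi Dpsi z =
     (chi / (m * c))\<^sup>2 * nabla0_sq c Dpsi z + (chi / (m * c))\<^sup>2 * \<bar>Ga G1 a ((cmod (psi z))\<^sup>2)\<bar>
     + (cmod (psi z))\<^sup>2"

definition concentrating :: "real \<Rightarrow> real \<Rightarrow> real \<Rightarrow> (real \<Rightarrow> real) \<Rightarrow> (real \<Rightarrow> real)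
    \<Rightarrow> real \<Rightarrow> real \<Rightarrow> (real \<Rightarrow> real^3)
    \<Rightarrow> (nat \<Rightarrow> real) \<Rightarrow> (nat \<Rightarrow> real) \<Rightarrow> (nat \<Rightarrow> real)
    \<Rightarrow> (nat \<Rightarrow> real \<times> (real^3) \<Rightarrow> real) \<Rightarrow> (nat \<Rightarrow> real \<times> (real^3) \<Rightarrow> (real \<times> (real^3)) \<Rightarrow>\<^sub>L real)
    \<Rightarrow> (nat \<Rightarrow> real \<times> (real^3) \<Rightarrow> complex) \<Rightarrow> (nat \<Rightarrow> real \<times> (real^3) \<Rightarrow> (real \<times> (real^3)) \<Rightarrow>\<^sub>L complex)
    \<Rightarrow> (nat \<Rightarrow> real \<times> (real^3) \<Rightarrow> (real \<times> (real^3)) \<Rightarrow>\<^sub>L (real \<times> (real^3)) \<Rightarrow>\<^sub>L complex)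
    \<Rightarrow> real \<Rightarrow> real \<Rightarrow> bool" where
  "concentrating c m q G1 G1' Tm Tp r R a chi phi Dphi psi Dpsi D2psi t0 E0 \<longleftrightarrow>
     (\<forall>n. C2_on (Omega_hat Tm Tp r (R n)) (psi n) (Dpsi n) (D2psi n)) \<and>
     (\<forall>n. \<forall>z\<in>Omega_hat Tm Tp r (R n).
         KG_at c m q G1' (chi n) (a n) (phi n) (Dphi n) (psi n) (Dpsi n) (D2psi n) z) \<and>
     (\<exists>C. \<forall>n. \<forall>t\<in>{Tm..Tp}.
         integral (cball (r t) (R n)) (\<lambda>x. loc_dens c m G1 (chi n) (a n) (psi n) (Dpsi n) (t, x)) \<le> C) \<and>
     (\<forall>e>0. \<forall>\<^sub>F n in sequentially. \<forall>t\<in>{Tm..Tp}.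
         sphere_integral (r t) (R n) (\<lambda>x. loc_dens c m G1 (chi n) (a n) (psi n) (Dpsi n) (t, x)) < e) \<and>
     (\<exists>c0>0. \<exists>n0. \<forall>n\<ge>n0. \<forall>t\<in>{Tm..Tp}.
         E_bar c m q G1 (chi n) (a n) (phi n) (psi n) (Dpsi n) (r t) (R n) t \<ge> c0) \<and>
     t0 \<in> {Tm..Tp} \<and>
     (\<lambda>n. E_bar c m q G1 (chi n) (a n) (phi n) (psi n) (Dpsi n) (r t0) (R n) t0) \<longlonglongrightarrow> E0"

end

theory Submission
  imports Defs
begin

text \<open>
  Charge, energy and momentum satisfy local conservation laws
  \<open>\<partial>\<^sub>t\<rho> + \<nabla>\<cdot>J = 0\<close>, \<open>\<partial>\<^sub>tE + c\<^sup>2\<nabla>\<cdot>P = - \<nabla>\<phi>\<cdot>J\<close>, \<open>\<partial>\<^sub>tP + \<nabla>\<cdot>T = - \<rho>\<nabla>\<phi>\<close>, and every density is bounded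
  by a constant times the localization density. Integrated over the moving balls, the fluxes
  through the spheres vanish in the limit, so the charges converge to a constant and
  \<open>P(t) - P(s) \<rightarrow> - \<rho>\<^sub>\<infinity> \<integral>\<nabla>\<phi>\<^sub>\<infinity>\<close>. The first moments of charge and energy about the trajectory are
  \<open>O(R\<^sub>n)\<close>; their balance gives \<open>\<integral>(J - r'\<rho>) \<rightarrow> 0\<close>, which turns the work of \<open>J\<close> into
  \<open>\<rho>\<^sub>\<infinity> \<integral>r'\<cdot>\<nabla>\<phi>\<^sub>\<infinity>\<close>, and \<open>\<integral>(c\<^sup>2P - r'E) \<rightarrow> 0\<close>, which identifies the limit momentum with
  \<open>E\<^sub>\<infinity> r'/c\<^sup>2\<close>. Finally \<open>E\<^sub>\<infinity>\<^sup>2 - c\<^sup>2|P\<^sub>\<infinity>|\<^sup>2\<close> is conserved, hence the mass formula.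

  The divergence theorem on a ball is only needed as an inequality: multiply by a cutoff that
  descends from 1 to 0 in a thin shell, integrate by parts without boundary, and let the shell
  shrink to the sphere.
\<close>

section \<open>Thin spherical shells\<close>

text \<open>Smallness of the relative current and of the relative momentum is available only after
  integration in time: the first moments are O(R), their time derivatives are not controlled. This
  shapes the limit. Inside the work integral the factor multiplying the small primitive must be
  differentiated, so a bound on the time derivative of the limit field is used. The momenta carry no
  convergence hypothesis, and no compactness is invoked for them: the integrated relation shows that
  \<open>c\<^sup>2 * Pb n j Tm * (t - Tm)\<close> converges for every t along the subsequence, which
  fixes the initial momentum and, by differentiating an affine function, the pointwise relation
  between momentum and energy. Hence only one subsequence is extracted, for the charges at the
  initial time; the energies are anchored at t0. The balance identities are claimed only at interior
  points of the tube, because mixed second derivatives are interchanged there; integrated statements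
  reach the closed tube by continuity and by cutoffs that vanish near the lateral boundary.\<close>

lemma prod_UNIV_3: "prod f (UNIV::3 set) = f 1 * f 2 * f (3::3)"
  unfolding UNIV_3 by (simp add: ac_simps)

text \<open>The radial variable integrates out and leaves the thickness of the shell as a factor.
  The relabelling \<open>g\<close> between \<open>real^3\<close> and nested pairs maps boxes to
  boxes of equal volume, so \<open>has_integral_twiddle\<close> transfers the integral, after which
  Fubini applies.\<close>

lemma integral_cbox_real3:
  fixes k :: "real \<times> real \<Rightarrow> real" and A B :: "real^3"
  assumes k: "continuous_on (cbox (A$2, A$3) (B$2, B$3)) k" and le: "A$1 \<le> B$1"
  shows "((\<lambda>y. k (y$2, y$3)) has_integral (B$1 - A$1) * integral (cbox (A$2, A$3) (B$2, B$3)) k) (cbox A B)"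
proof -
  define g :: "real^3 \<Rightarrow> real \<times> real \<times> real" where "g y = (y$1, y$2, y$3)" for y
  define h :: "real \<times> real \<times> real \<Rightarrow> real^3" where "h z = vector [fst z, fst (snd z), snd (snd z)]" for z
  have hg: "h (g y) = y" for y by (simp add: g_def h_def vec_eq_iff forall_3)
  have gh: "g (h z) = z" for z by (simp add: g_def h_def)
  have gbox: "g ` cbox u v = cbox (g u) (g v)" for u v
  proof -
    have "y \<in> cbox u v \<longleftrightarrow> g y \<in> cbox (g u) (g v)" for y
      by (auto simp: g_def cbox_Pair_eq mem_box_cart forall_3)
    then show ?thesis using gh by (metis (no_types, opaque_lifting) image_eqI image_subset_iff subsetI subset_antisym)
  qed
  have hbox: "h ` cbox u v = cbox (h u) (h v)" for u v
  proof -
    have "h ` cbox u v = h ` (g ` cbox (h u) (h v))" by (simp only: gbox gh)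
    then show ?thesis by (simp only: image_image hg image_ident)
  qed
  have cont: "continuous_on (cbox (g A) (g B)) (\<lambda>z. k (snd z))"
    unfolding g_def
    by (intro continuous_on_compose2[OF k] continuous_intros) (auto simp: cbox_Pair_eq)
  have cnt: "measure lborel (g ` cbox u v) = 1 * measure lborel (cbox u v)" for u v
  proof (cases "cbox u v = {}")
    case False
    then have "u$1 \<le> v$1" "u$2 \<le> v$2" "u$3 \<le> v$3"
      using interval_ne_empty_cart by (auto simp: interval_ne_empty_cart)
    then show ?thesis using False
      by (simp add: gbox) (simp add: g_def content_Pair content_cbox_if_cart prod_UNIV_3)
  qed auto
  have "((\<lambda>y. k (snd (g y))) has_integral (1/1) *\<^sub>R integral (cbox (g A) (g B)) (\<lambda>z. k (snd z))) (h ` cbox (g A) (g B))"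
  proof (rule has_integral_twiddle)
    show "continuous (at y) g" for y
      unfolding g_def by (intro continuous_intros)
    show "((\<lambda>z. k (snd z)) has_integral integral (cbox (g A) (g B)) (\<lambda>z. k (snd z))) (cbox (g A) (g B))"
      using cont by (intro integrable_integral integrable_continuous)
    show "\<exists>w z. g ` cbox u v = cbox w z" "\<exists>w z. h ` cbox u' v' = cbox w z" for u v u' v'
      using gbox hbox by blast+
  qed (use hg gh cnt in simp_all)
  moreover have "integral (cbox (g A) (g B)) (\<lambda>z. k (snd z)) = (B$1 - A$1) * integral (cbox (A$2, A$3) (B$2, B$3)) k"
  proof -
    have "integral (cbox (A$1, (A$2,A$3)) (B$1, (B$2,B$3))) (\<lambda>z. k (snd z)) =
       integral (cbox (A$1) (B$1)) (\<lambda>x. integral (cbox (A$2, A$3) (B$2, B$3)) k)"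
      using cont unfolding g_def by (subst integral_prod_continuous) auto
    then show ?thesis using le by (simp add: g_def)
  qed
  ultimately show ?thesis by (simp add: hbox hg) (simp add: g_def)
qed

section \<open>Spherical coordinates and their Jacobian\<close>

definition sph_dir :: "real \<Rightarrow> real \<Rightarrow> real^3" where
  "sph_dir th ph = vector [sin th * cos ph, sin th * sin ph, cos th]"

lemma norm_sph_dir [simp]: "norm (sph_dir th ph) = 1"
proof -
  have "(sin th * cos ph)\<^sup>2 + (sin th * sin ph)\<^sup>2 + (cos th)\<^sup>2 = (sin th)\<^sup>2 * ((cos ph)\<^sup>2 + (sin ph)\<^sup>2) + (cos th)\<^sup>2"
    by algebra
  also have "\<dots> = 1" by simp
  finally show ?thesis
    by (simp add: norm_vec_def L2_set_def sum_3 sph_dir_def)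
qed

text \<open>The polar angle is the arccosine of \<open>y$3 / norm y\<close>; the other two
  components then lie on a circle of radius \<open>K\<close>, which supplies the azimuth. This makes
  the closed coordinate box cover the whole shell.\<close>

lemma sph_dir_surj:
  fixes y :: "real^3"
  shows "\<exists>th\<in>{0..pi}. \<exists>ph\<in>{0..2*pi}. y = norm y *\<^sub>R sph_dir th ph"
proof (cases "y = 0")
  case True
  then show ?thesis by (intro bexI[of _ 0]) auto
next
  case False
  define s where "s = norm y"
  have s: "s > 0" using False by (simp add: s_def)
  have ns: "s\<^sup>2 = (y$1)\<^sup>2 + (y$2)\<^sup>2 + (y$3)\<^sup>2"
    unfolding s_def norm_vec_def L2_set_def sum_3 by (simp add: )
  define th where "th = arccos (y$3 / s)"
  have "\<bar>y$3\<bar> \<le> s" unfolding s_def by (rule component_le_norm_cart)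
  then have b: "-1 \<le> y$3/s" "y$3/s \<le> 1" using s by (auto simp: field_simps)
  have th: "th \<in> {0..pi}" "cos th = y$3/s" using b by (auto simp: th_def arccos_lbound arccos_ubound)
  have sn: "(s * sin th)\<^sup>2 = (y$1)\<^sup>2 + (y$2)\<^sup>2"
  proof -
    have "(s * sin th)\<^sup>2 = s\<^sup>2 - (s * cos th)\<^sup>2"
      by (simp add: power_mult_distrib sin_squared_eq algebra_simps)
    also have "s * cos th = y$3" using th(2) s by simp
    finally show ?thesis using ns by simp
  qed
  have sin0: "s * sin th \<ge> 0" using s th sin_ge_zero[of th] by auto
  define K where "K = s * sin th"
  have "\<exists>ph\<in>{0..2*pi}. y$1 = K * cos ph \<and> y$2 = K * sin ph"
  \<comment> \<open>On the polar axis the azimuth is arbitrary; 0 is taken.\<close>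
  proof (cases "K = 0")
    case True
    then show ?thesis using sn by (intro bexI[of _ 0]) (auto simp: sum_power2_eq_zero_iff K_def[symmetric])
  next
    case False
    have "(y$1 / K)\<^sup>2 + (y$2/K)\<^sup>2 = ((y$1)\<^sup>2 + (y$2)\<^sup>2) / K\<^sup>2"
      by (simp add: power_divide add_divide_distrib)
    also have "\<dots> = 1" using False by (simp add: K_def[symmetric] flip: sn)
    finally obtain ph where "0 \<le> ph" "ph < 2*pi" "y$1 / K = cos ph" "y$2 / K = sin ph"
      using sincos_total_2pi by metis
    then show ?thesis using False by (intro bexI[of _ ph]) (auto simp: field_simps)
  qed
  then obtain ph where "ph \<in> {0..2*pi}" "y$1 = (s * sin th) * cos ph" "y$2 = (s * sin th) * sin ph" by (auto simp: K_def)
  moreover have "y$3 = s * cos th" using th s by simp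
  ultimately have "y = s *\<^sub>R sph_dir th ph"
    by (simp add: vec_eq_iff forall_3 sph_dir_def)
  then show ?thesis using th \<open>ph \<in> _\<close> unfolding s_def by blast
qed

lemma sphere_integral_sph_dir:
  "sphere_integral p R h = integral ({0..pi} \<times> {0..2 * pi}) (\<lambda>w. h (p + R *\<^sub>R sph_dir (fst w) (snd w)) * R\<^sup>2 * sin (fst w))"
  unfolding sphere_integral_def sph_dir_def by (simp add: case_prod_unfold)

lemma continuous_on_sph_dir [continuous_intros]:
  fixes f g :: "'a::t2_space \<Rightarrow> real"
  assumes "continuous_on S f" "continuous_on S g"
  shows "continuous_on S (\<lambda>x. sph_dir (f x) (g x))"
proof -
  have "continuous_on S (\<lambda>x. (\<chi> i. if i = 1 then sin (f x) * cos (g x) else if i = 2 then sin (f x) * sin (g x) else cos (f x))::real^3)"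
  proof (rule continuous_on_vec_lambda)
    fix i :: 3
    show "continuous_on S (\<lambda>x. if i = 1 then sin (f x) * cos (g x) else if i = 2 then sin (f x) * sin (g x) else cos (f x))"
      using exhaust_3[of i] assms
      by (auto intro!: continuous_on_mult continuous_on_sin continuous_on_cos)
  qed
  also have "(\<lambda>x. (\<chi> i. if i = 1 then sin (f x) * cos (g x) else if i = 2 then sin (f x) * sin (g x) else cos (f x))::real^3) = (\<lambda>x. sph_dir (f x) (g x))"
    by (auto simp: fun_eq_iff vec_eq_iff forall_3 sph_dir_def)
  finally show ?thesis .
qed

text \<open>Frechet derivative of the map from (radius, polar angle, azimuth), stored in the
  components 1, 2, 3 of \<open>y\<close>, to a point of space; \<open>v\<close> is the
  increment.\<close>

definition sph_der :: "real^3 \<Rightarrow> real^3 \<Rightarrow> real^3" where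
  "sph_der y v = vector
     [v$1 * (sin (y$2) * cos (y$3)) + y$1 * (cos (y$2) * v$2 * cos (y$3) - sin (y$2) * sin (y$3) * v$3),
      v$1 * (sin (y$2) * sin (y$3)) + y$1 * (cos (y$2) * v$2 * sin (y$3) + sin (y$2) * cos (y$3) * v$3),
      v$1 * cos (y$2) - y$1 * sin (y$2) * v$2]"

lemma has_derivative_cart3:
  fixes f :: "'a::real_normed_vector \<Rightarrow> real^3"
  assumes "\<And>i. ((\<lambda>x. f x $ i) has_derivative (\<lambda>x. f' x $ i)) (at a within S)"
  shows "(f has_derivative f') (at a within S)"
  using assms
  by (subst has_derivative_componentwise_within) (auto simp: Basis_vec_def cart_eq_inner_axis[symmetric] inner_axis)

lemma has_derivative_sph:
  "((\<lambda>y. p + y$1 *\<^sub>R sph_dir (y$2) (y$3)) has_derivative sph_der y) (at y within S)"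
proof (rule has_derivative_cart3)
  fix i :: 3
  have l [derivative_intros]: "((\<lambda>y::real^3. y $ j) has_derivative (\<lambda>v. v $ j)) (at y within S)" for j
    by (rule bounded_linear_imp_has_derivative) (rule bounded_linear_vec_nth)
  show "((\<lambda>y. (p + y$1 *\<^sub>R sph_dir (y$2) (y$3)) $ i) has_derivative (\<lambda>v. sph_der y v $ i)) (at y within S)"
    using exhaust_3[of i]
    by (auto simp: sph_dir_def sph_der_def algebra_simps fun_eq_iff intro!: derivative_eq_intros)
qed

lemma det_sph_der: "det (matrix (sph_der y)) = (y$1)\<^sup>2 * sin (y$2)"
proof -
  define a b u v r where "a = sin (y$2)" and "b = cos (y$2)" and "u = sin (y$3)" and "v = cos (y$3)" and "r = y$1"
  have ab: "a\<^sup>2 + b\<^sup>2 = 1" "u\<^sup>2 + v\<^sup>2 = 1" by (auto simp: a_def b_def u_def v_def)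
  have "det (matrix (sph_der y)) =
      (a * v) * (r * b * u) * 0 + (r * b * v) * (r * a * v) * b + (- r * a * u) * (a * u) * (- r * a)
      - (a * v) * (r * a * v) * (- r * a) - (r * b * v) * (a * u) * 0 - (- r * a * u) * (r * b * u) * b"
    by (simp add: det_3 matrix_def sph_der_def axis_def a_def b_def u_def v_def r_def)
  also have "\<dots> = r\<^sup>2 * a" using ab by algebra
  finally show ?thesis by (simp add: r_def a_def)
qed

text \<open>Only an upper bound is needed, so the image form of the change of variables applies to the
  closed coordinate box, on which spherical coordinates are not injective.\<close>
lemma integral_spherical_shell_le:
  fixes h :: "real^3 \<Rightarrow> real"
  assumes R: "0 \<le> r1" "r1 \<le> R" and cont: "continuous_on (cball p R) h" 
    and nn: "\<And>x. x \<in> cball p R \<Longrightarrow> 0 \<le> h x" and e: "0 \<le> e"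
    and close: "\<And>w s. norm w = 1 \<Longrightarrow> r1 \<le> s \<Longrightarrow> s \<le> R \<Longrightarrow> h (p + s *\<^sub>R w) \<le> h (p + R *\<^sub>R w) + e"
  shows "integral {x. r1 \<le> dist p x \<and> dist p x \<le> R} h \<le> (R - r1) * (sphere_integral p R h + e * (R\<^sup>2 * (2 * pi\<^sup>2)))"
proof -
  define g where "g = (\<lambda>y::real^3. p + y$1 *\<^sub>R sph_dir (y$2) (y$3))"
  define A B :: "real^3" where "A = vector [r1, 0, 0]" and "B = vector [R, pi, 2*pi]"
  \<comment> \<open>Majorant independent of the radius: on the shell \<open>h\<close> exceeds its
    value on the outer sphere by at most \<open>e\<close>, and the Jacobian is at most
    \<open>R\<^sup>2\<close> times the sine. In the error term the sine is replaced by 1, whence the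
    angular area 2 pi^2 in the conclusion.\<close>
  define k where "k = (\<lambda>w. h (p + R *\<^sub>R sph_dir (fst w) (snd w)) * R\<^sup>2 * sin (fst w) + e * R\<^sup>2)"
  have S: "y \<in> cbox A B \<longleftrightarrow> r1 \<le> y$1 \<and> y$1 \<le> R \<and> 0 \<le> y$2 \<and> y$2 \<le> pi \<and> 0 \<le> y$3 \<and> y$3 \<le> 2*pi" for y
    by (auto simp: A_def B_def mem_box_cart forall_3)
  have gim: "g ` cbox A B = {x. r1 \<le> dist p x \<and> dist p x \<le> R}"
  proof (intro equalityI subsetI)
    fix x assume "x \<in> g ` cbox A B"
    then show "x \<in> {x. r1 \<le> dist p x \<and> dist p x \<le> R}" using R by (auto simp: g_def S dist_norm)
  next
    fix x assume x: "x \<in> {x. r1 \<le> dist p x \<and> dist p x \<le> R}"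
    obtain th ph where "th\<in>{0..pi}" "ph\<in>{0..2*pi}" "x - p = norm (x - p) *\<^sub>R sph_dir th ph"
      using sph_dir_surj[of "x - p"] by auto
    then have "x = g (vector [norm (x-p), th, ph])" "vector [norm (x-p), th, ph] \<in> cbox A B"
      using x by (auto simp: g_def S dist_norm norm_minus_commute algebra_simps)
    then show "x \<in> g ` cbox A B" by blast
  qed
  have gc: "g y \<in> cball p R" if "y \<in> cbox A B" for y using that gim by auto
  have contg: "continuous_on (cbox A B) (\<lambda>y. h (g y))"
    by (rule continuous_on_compose2[OF cont]) (use gc in \<open>auto simp: g_def intro!: continuous_intros\<close>)
  have int: "(\<lambda>y. \<bar>det (matrix (sph_der y))\<bar> * h (g y)) integrable_on cbox A B"
    by (intro integrable_continuous continuous_intros contg) (simp add: det_sph_der, intro continuous_intros)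
  have "integral (g ` cbox A B) h \<le> integral (cbox A B) (\<lambda>y. \<bar>det (matrix (sph_der y))\<bar> * h (g y))"
    
  proof (rule integral_on_image_ubound)
    show "0 \<le> h (g y)" if "y \<in> cbox A B" for y using gc nn that by blast
    show "(g has_derivative sph_der y) (at y within cbox A B)" for y
      unfolding g_def by (rule has_derivative_sph)
  qed (rule int)
  also have "\<dots> \<le> integral (cbox A B) (\<lambda>y. k (y$2, y$3))"
  proof (rule integral_le[OF int])
    have ck: "continuous_on (cbox (A$2,A$3) (B$2,B$3)) k"
      unfolding k_def
      by (intro continuous_intros continuous_on_compose2[OF cont]) (use R in \<open>auto simp: dist_norm\<close>)
    show "(\<lambda>y. k (y$2, y$3)) integrable_on cbox A B"
      using integral_cbox_real3[OF ck] R by (auto simp: A_def B_def)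
    fix y assume y: "y \<in> cbox A B"
    then have s: "0 \<le> sin (y$2)" "sin (y$2) \<le> 1" by (auto simp: S intro: sin_ge_zero)
    have y1: "(y$1)\<^sup>2 \<le> R\<^sup>2" using y R by (auto simp: S intro!: power_mono)
    have hh: "h (g y) \<le> h (p + R *\<^sub>R sph_dir (y$2) (y$3)) + e"
      using y by (auto simp: g_def S intro!: close)
    have "(y$1)\<^sup>2 * sin (y$2) * h (g y) \<le> R\<^sup>2 * sin (y$2) * (h (p + R *\<^sub>R sph_dir (y$2) (y$3)) + e)"
      using hh y1 s nn[OF gc[OF y]] by (intro mult_mono) auto
    also have "\<dots> \<le> k (y$2,y$3)"
      using s e mult_left_mono[of "sin (y$2)" 1 "e * R\<^sup>2"] by (simp add: k_def algebra_simps)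
    finally show "\<bar>det (matrix (sph_der y))\<bar> * h (g y) \<le> k (y$2, y$3)"
      using s by (simp add: det_sph_der abs_mult)
  qed
  also have "\<dots> = (R - r1) * integral (cbox (0,0) (pi,2*pi)) k"
  proof -
    have ck: "continuous_on (cbox (A$2,A$3) (B$2,B$3)) k"
      unfolding k_def
      by (intro continuous_intros continuous_on_compose2[OF cont]) (use R in \<open>auto simp: dist_norm\<close>)
    show ?thesis using integral_unique[OF integral_cbox_real3[OF ck]] R by (simp add: A_def B_def)
  qed
  also have "integral (cbox (0,0) (pi,2*pi)) k = sphere_integral p R h + e * (R\<^sup>2 * (2 * pi\<^sup>2))"
  proof -
    have "integral (cbox (0,0) (pi,2*pi)) k =
       integral (cbox (0,0) (pi,2*pi)) (\<lambda>w. h (p + R *\<^sub>R sph_dir (fst w) (snd w)) * R\<^sup>2 * sin (fst w))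
        + integral (cbox (0,0) (pi,2*pi)) (\<lambda>w::real\<times>real. e * R\<^sup>2)"
      unfolding k_def
      by (intro integral_add integrable_continuous continuous_intros continuous_on_compose2[OF cont])
        (use R in \<open>auto simp: dist_norm\<close>)
    then show ?thesis
      by (simp add: sphere_integral_sph_dir cbox_Pair_eq content_Pair power2_eq_square flip: cbox_Pair_eq)
         (simp add: cbox_Pair_eq)
  qed
  finally show ?thesis by (simp add: gim)
qed

section \<open>Cutoff functions and integration by parts\<close>

lemma integrable_on_compact:
  fixes f :: "'a::euclidean_space \<Rightarrow> real"
  assumes "compact S" "continuous_on S f"
  shows "f integrable_on S"
proof -
  have "set_integrable lborel S f"
    using borel_integrable_compact[OF assms] by (simp add: set_integrable_def)
  then show ?thesis by (rule set_borel_integral_eq_integral)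
qed

lemma integral_eq_UNIV:
  fixes f :: "'a::euclidean_space \<Rightarrow> real"
  assumes "\<And>x. x \<notin> S \<Longrightarrow> f x = 0"
  shows "integral S f = integral UNIV f"
proof -
  have "f = (\<lambda>x. if x \<in> S then f x else 0)" using assms by auto
  then show ?thesis using Henstock_Kurzweil_Integration.integral_restrict_UNIV[of S f] by simp
qed

text \<open>In the coordinate relative to the centre the domain no longer moves with time, so a time
  derivative or a continuity argument concerns only the integrand. The function is extended by zero
  because the shift rule is stated for boxes.\<close>

lemma integral_cball_translate:
  fixes f :: "'a::euclidean_space \<Rightarrow> real"
  shows "integral (cball p R) f = integral (cball 0 R) (\<lambda>y. f (p + y))"
proof -
  define F where "F x = (if x \<in> cball p R then f x else 0)" for x
  obtain a where a: "cball (0::'a) R \<subseteq> cbox (-a) a"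
    using bounded_subset_cbox_symmetric bounded_cball by blast
  have sub: "cball p R \<subseteq> cbox (-a + p) (a + p)"
  proof
    fix x assume "x \<in> cball p R"
    then have "x - p \<in> cbox (-a) a" using a by (auto simp: dist_norm norm_minus_commute)
    then show "x \<in> cbox (-a + p) (a + p)" by (auto simp: mem_box algebra_simps)
  qed
  have "integral (cball p R) f = integral UNIV F"
    unfolding F_def by (rule Henstock_Kurzweil_Integration.integral_restrict_UNIV[symmetric])
  also have "\<dots> = integral (cbox (-a + p) (a + p)) F"
    using sub by (intro integral_eq_UNIV[symmetric]) (auto simp: F_def)
  also have "\<dots> = integral (cbox (-a) a) (F \<circ> (+) p)" by (rule integral_shift_cbox_plus[symmetric])
  also have "\<dots> = integral UNIV (F \<circ> (+) p)"
    using a by (intro integral_eq_UNIV) (auto simp: F_def dist_norm)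
  also have "F \<circ> (+) p = (\<lambda>y. if y \<in> cball 0 R then f (p + y) else 0)"
    by (auto simp: F_def dist_norm)
  finally show ?thesis by (simp only: Henstock_Kurzweil_Integration.integral_restrict_UNIV)
qed

lemma integral_const_bound:
  fixes f :: "'a::euclidean_space \<Rightarrow> real"
  assumes "compact S" "continuous_on S f" "\<And>x. x \<in> S \<Longrightarrow> \<bar>f x\<bar> \<le> M"
  shows "\<bar>integral S f\<bar> \<le> M * integral S (\<lambda>_. 1)"
proof -
  have "norm (integral S f) \<le> integral S (\<lambda>_. M * 1)"
    using assms by (intro integral_norm_bound_integral integrable_on_compact continuous_intros) auto
  then show ?thesis by (simp only: integral_mult_right real_norm_def)
qed

text \<open>Uniform continuity of the integrand on the compact product makes its oscillation in t
  uniform in y; dividing by \<open>v + 1\<close> avoids a separate case for a null set.\<close>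

lemma continuous_on_integral_compact:
  fixes k :: "'a::metric_space \<times> 'b::euclidean_space \<Rightarrow> real"
  assumes T: "compact T" and S: "compact S" and k: "continuous_on (T \<times> S) k"
  shows "continuous_on T (\<lambda>t. integral S (\<lambda>y. k (t, y)))"
  unfolding continuous_on_iff
proof (intro ballI allI impI)
  fix t e assume t: "t \<in> T" and e: "(e::real) > 0"
  define v where "v = integral S (\<lambda>_. 1::real)"
  have v: "v \<ge> 0" unfolding v_def by (intro integral_nonneg integrable_on_compact S) auto
  have "uniformly_continuous_on (T \<times> S) k"
    using compact_uniformly_continuous[OF k] compact_Times T S by blast
  moreover have "e / (v + 1) > 0" using e v by auto
  ultimately obtain d where d: "d > 0" "\<And>x x'. x \<in> T \<times> S \<Longrightarrow> x' \<in> T \<times> S \<Longrightarrow> dist x' x < d \<Longrightarrow> dist (k x') (k x) < e / (v + 1)"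
    unfolding uniformly_continuous_on_def by metis
  show "\<exists>d>0. \<forall>t'\<in>T. dist t' t < d \<longrightarrow> dist (integral S (\<lambda>y. k (t', y))) (integral S (\<lambda>y. k (t, y))) < e"
  proof (intro exI[of _ d] conjI ballI impI d)
    fix t' assume t': "t' \<in> T" "dist t' t < d"
    have c: "continuous_on S (\<lambda>y. k (x, y))" if "x \<in> T" for x
      using that by (intro continuous_on_compose2[OF k] continuous_intros) auto
    have "integral S (\<lambda>y. k (t', y)) - integral S (\<lambda>y. k (t, y)) = integral S (\<lambda>y. k (t', y) - k (t, y))"
      using t t' c S by (intro integral_diff[symmetric] integrable_on_compact) auto
    also have "\<bar>\<dots>\<bar> \<le> e / (v + 1) * v" unfolding v_def
    proof (intro integral_const_bound S continuous_intros c t t')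
      fix y assume "y \<in> S"
      then have "dist (k (t', y)) (k (t, y)) < e / (v + 1)"
        using t t' by (intro d) (auto simp: dist_Pair_Pair)
      then show "\<bar>k (t', y) - k (t, y)\<bar> \<le> e / (integral S (\<lambda>_. 1) + 1)" by (simp add: dist_real_def v_def)
    qed
    also have "\<dots> < e" using e v by (simp add: field_simps)
    finally show "dist (integral S (\<lambda>y. k (t', y))) (integral S (\<lambda>y. k (t, y))) < e"
      by (simp add: dist_real_def)
  qed
qed

lemma has_derivative_eq_zero_locally:
  fixes F :: "'a::real_normed_vector \<Rightarrow> 'b::real_normed_vector"
  assumes "(F has_derivative F') (at x)" "open U" "x \<in> U" "\<And>y. y \<in> U \<Longrightarrow> F y = 0"
  shows "F' v = 0"
proof -
  have "(F has_derivative (\<lambda>_. 0)) (at x)"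
    using assms has_derivative_transform_within_open[of "\<lambda>_. 0" "\<lambda>_. 0" x UNIV U F] by auto
  then show ?thesis using has_derivative_unique assms(1) by metis
qed

text \<open>The integral of a translate of \<open>F\<close> is constant; its derivative in the direction \<open>e\<close> is the
  left-hand side.\<close>
lemma integral_derivative_eq_0:
  fixes F :: "'a::euclidean_space \<Rightarrow> real"
  assumes F: "\<And>x. (F has_derivative F' x) (at x)"
    and c: "continuous_on UNIV (\<lambda>x. F' x e)"
    and zero: "\<And>x. norm x > R \<Longrightarrow> F x = 0"
  shows "integral (cball 0 R) (\<lambda>x. F' x e) = 0"
proof -
  \<comment> \<open>The margin beyond \<open>R\<close> leaves room for translates by
    \<open>h *\<^sub>R e\<close> with |h| < 1: the translated support never leaves the box.\<close>
  obtain a where a: "ball (0::'a) (R + norm e + 1) \<subseteq> cbox (-a) a"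
    using bounded_subset_cbox_symmetric bounded_ball by blast
  define Phi where "Phi h = integral (cbox (-a) a) (\<lambda>x. F (x + h *\<^sub>R e))" for h
  have F0: "F' x e = 0" if "norm x > R" for x
    by (rule has_derivative_eq_zero_locally[OF F, of "- cball 0 R"]) (use that zero in auto)
  have const: "Phi h = integral UNIV F" if "h \<in> {-1<..<1}" for h
  proof -
    have "Phi h = integral (cbox (-a) a) (F \<circ> (+) (h *\<^sub>R e))" by (simp add: Phi_def o_def add.commute)
    also have "\<dots> = integral (cbox (-a + h *\<^sub>R e) (a + h *\<^sub>R e)) F" by (rule integral_shift_cbox_plus)
    also have "\<dots> = integral UNIV F"
    proof (rule integral_eq_UNIV, rule ccontr)
      fix x assume x: "x \<notin> cbox (-a + h *\<^sub>R e) (a + h *\<^sub>R e)" "F x \<noteq> 0"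
      then have "norm x \<le> R" using zero by force
      moreover have "norm (h *\<^sub>R e) \<le> 1 * norm e" unfolding norm_scaleR
        using that by (intro mult_right_mono) auto
      ultimately have "norm (x - h *\<^sub>R e) < R + norm e + 1"
        using norm_triangle_ineq4[of x "h *\<^sub>R e"] by linarith
      then have "x - h *\<^sub>R e \<in> cbox (-a) a" using a by auto
      then show False using x by (auto simp: mem_box algebra_simps)
    qed
    finally show ?thesis .
  qed
  have cF: "continuous_on UNIV F"
    by (intro continuous_at_imp_continuous_on ballI has_derivative_continuous[OF F])
  have "(Phi has_field_derivative integral (cbox (-a) a) (\<lambda>x. F' (x + 0 *\<^sub>R e) e)) (at 0 within {-1<..<1})"
    unfolding Phi_def
  proof (rule leibniz_rule_field_derivative[where fx = "\<lambda>h x. F' (x + h *\<^sub>R e) e"])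
    fix h x
    have "((\<lambda>h. F (x + h *\<^sub>R e)) has_derivative (\<lambda>k. F' (x + h *\<^sub>R e) (k *\<^sub>R e))) (at h within {-1<..<1})"
      by (rule has_derivative_compose[OF _ F]) (auto intro!: derivative_eq_intros)
    also have "(\<lambda>k. F' (x + h *\<^sub>R e) (k *\<^sub>R e)) = (*) (F' (x + h *\<^sub>R e) e)"
      using has_derivative_bounded_linear[OF F] by (auto simp: linear_simps fun_eq_iff mult.commute)
    finally show "((\<lambda>h. F (x + h *\<^sub>R e)) has_field_derivative F' (x + h *\<^sub>R e) e) (at h within {-1<..<1})"
      by (simp add: has_field_derivative_def)
  next
    show "(\<lambda>x. F (x + h *\<^sub>R e)) integrable_on cbox (- a) a" for h
      by (intro integrable_continuous continuous_on_compose2[OF cF] continuous_intros) auto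
    show "continuous_on ({- 1<..<1} \<times> cbox (- a) a) (\<lambda>(h, x). F' (x + h *\<^sub>R e) e)"
      unfolding case_prod_unfold by (intro continuous_on_compose2[OF c] continuous_intros) auto
  qed auto
  then have "(Phi has_field_derivative integral (cbox (-a) a) (\<lambda>x. F' x e)) (at 0)"
    by (simp add: at_within_open[of 0 "{-1<..<1}"])
  moreover have "(Phi has_field_derivative 0) (at 0)"
    by (rule has_field_derivative_transform_within_open[of "\<lambda>_. integral UNIV F" _ _ "{-1<..<1}"])
       (auto simp: const)
  ultimately have "integral (cbox (-a) a) (\<lambda>x. F' x e) = 0" by (rule DERIV_unique)
  moreover have "integral (cball 0 R) (\<lambda>x. F' x e) = integral UNIV (\<lambda>x. F' x e)"
    using F0 by (intro integral_eq_UNIV) auto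
  moreover have "integral (cbox (-a) a) (\<lambda>x. F' x e) = integral UNIV (\<lambda>x. F' x e)"
  proof (rule integral_eq_UNIV)
    fix x assume "x \<notin> cbox (-a) a"
    then have "x \<notin> ball 0 (R + norm e + 1)" using a by blast
    then show "F' x e = 0" by (intro F0) (auto simp: not_less, smt (verit) norm_ge_zero)
  qed
  ultimately show ?thesis by simp
qed

text \<open>Since \<open>eta\<close> and its gradient vanish from radius \<open>r2 < R\<close> on,
  the product with \<open>W\<close> extends by zero to a continuously differentiable function on the
  whole space, and no boundary term arises.\<close>

lemma integral_by_parts_cball:
  fixes eta W :: "'a::euclidean_space \<Rightarrow> real" and G :: "'a \<Rightarrow> 'a"
  assumes eta: "\<And>y. (eta has_derivative (\<lambda>v. G y \<bullet> v)) (at y)" and G: "continuous_on UNIV G"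
    and supp: "r2 < R" "\<And>y. r2 \<le> norm y \<Longrightarrow> eta y = 0 \<and> G y = 0"
    and W: "\<And>y. y \<in> cball 0 R \<Longrightarrow> (W has_derivative W' y) (at y within cball 0 R)"
    and W': "continuous_on (cball 0 R) (\<lambda>y. W' y e)"
  shows "integral (cball 0 R) (\<lambda>y. eta y * W' y e) = - integral (cball 0 R) (\<lambda>y. (G y \<bullet> e) * W y)"
proof -
  define F where "F y = (if norm y < R then eta y * W y else 0)" for y
  define F' where "F' y v = (if norm y < R then eta y * W' y v + (G y \<bullet> v) * W y else 0)" for y v
  have ceta: "continuous_on UNIV eta"
    by (intro continuous_at_imp_continuous_on ballI has_derivative_continuous[OF eta])
  have cW: "continuous_on (cball 0 R) W"
    using W has_derivative_continuous_on by blast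
  have derF: "(F has_derivative F' y) (at y)" for y
  proof (cases "norm y < R")
    case True
    have "(W has_derivative W' y) (at y within ball 0 R)"
      using W[of y] True by (auto intro: has_derivative_subset)
    then have "(W has_derivative W' y) (at y)" using True by (simp add: at_within_open[of y "ball 0 R"])
    then have "((\<lambda>y. eta y * W y) has_derivative F' y) (at y)"
      using True by (auto simp: F'_def intro!: derivative_eq_intros eta)
    then show ?thesis
      by (rule has_derivative_transform_within_open[of _ _ _ _ "ball 0 R"]) (use True in \<open>auto simp: F_def\<close>)
  next
    case False
    then have "F' y = (\<lambda>_. 0)" by (auto simp: F'_def)
    moreover have "(F has_derivative (\<lambda>_. 0)) (at y)"
      by (rule has_derivative_transform_within_open[of "\<lambda>_. 0" _ _ _ "- cball 0 r2"])
         (use False supp in \<open>auto simp: F_def\<close>)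
    ultimately show ?thesis by simp
  qed
  have cF': "continuous_on UNIV (\<lambda>y. F' y e)"
  proof -
    \<comment> \<open>The two open sets overlap in the shell between \<open>r2\<close> and
      \<open>R\<close>; on the outer one the derivative is identically zero.\<close>
    have "continuous_on (ball 0 R \<union> - cball 0 r2) (\<lambda>y. F' y e)"
    proof (rule continuous_on_open_Un)
      have "continuous_on (ball 0 R) (\<lambda>y. eta y * W' y e + (G y \<bullet> e) * W y)"
        by (intro continuous_intros continuous_on_subset[OF ceta] continuous_on_subset[OF G]
              continuous_on_subset[OF cW] continuous_on_subset[OF W']) auto
      then show "continuous_on (ball 0 R) (\<lambda>y. F' y e)"
        by (rule continuous_on_eq) (auto simp: F'_def)
      have "continuous_on (- cball 0 r2) (\<lambda>y::'a. 0::real)" by simp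
      then show "continuous_on (- cball 0 r2) (\<lambda>y. F' y e)"
        by (rule continuous_on_eq) (use supp in \<open>auto simp: F'_def\<close>)
    qed auto
    moreover have "ball 0 R \<union> - cball 0 r2 = (UNIV :: 'a set)" using supp by auto
    ultimately show ?thesis by simp
  qed
  have "integral (cball 0 R) (\<lambda>y. F' y e) = 0"
    by (rule integral_derivative_eq_0[OF derF cF']) (auto simp: F_def)
  moreover have "integral (cball 0 R) (\<lambda>y. F' y e) = integral (cball 0 R) (\<lambda>y. eta y * W' y e + (G y \<bullet> e) * W y)"
    by (rule integral_cong) (use supp in \<open>auto simp: F'_def\<close>)
  moreover have "\<dots> = integral (cball 0 R) (\<lambda>y. eta y * W' y e) + integral (cball 0 R) (\<lambda>y. (G y \<bullet> e) * W y)"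
    by (intro integral_add integrable_on_compact compact_cball continuous_intros W' cW
         continuous_on_subset[OF ceta] continuous_on_subset[OF G]) auto
  ultimately show ?thesis by simp
qed

section \<open>A radial cutoff with a controlled gradient\<close>

lemma has_derivative_pos_part_sq:
  "((\<lambda>s::real. (max 0 s)\<^sup>2) has_real_derivative 2 * max 0 x) (at x)"
proof -
  consider "x > 0" | "x < 0" | "x = 0" by linarith
  then show ?thesis
  proof cases
    case 1
    have "((\<lambda>s::real. s\<^sup>2) has_real_derivative 2 * max 0 x) (at x)"
      using 1 by (auto intro!: derivative_eq_intros)
    then show ?thesis
      by (rule has_field_derivative_transform_within_open[of _ _ _ "{0<..}"]) (use 1 in auto)
  next
    case 2
    have "((\<lambda>s::real. 0) has_real_derivative 2 * max 0 x) (at x)"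
      using 2 by (auto intro!: derivative_eq_intros)
    then show ?thesis
      by (rule has_field_derivative_transform_within_open[of _ _ _ "{..<0}"]) (use 2 in auto)
  next
    case 3
    have "(\<lambda>h::real. ((max 0 (0 + h))\<^sup>2 - (max 0 0)\<^sup>2) / h) \<midarrow>0\<rightarrow> 0"
    proof (rule Lim_null_comparison)
      show "\<forall>\<^sub>F h in at 0. norm (((max 0 (0 + h))\<^sup>2 - (max 0 0)\<^sup>2) / h) \<le> \<bar>h\<bar>" for h :: real
        by (rule always_eventually) (auto simp: max_def power2_eq_square)
      show "(\<lambda>h::real. \<bar>h\<bar>) \<midarrow>0\<rightarrow> 0" by (rule tendsto_rabs_zero) (rule tendsto_ident_at)
    qed
    then show ?thesis using 3 by (simp add: DERIV_def)
  qed
qed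

text \<open>The cutoff is a function of the squared norm, which keeps it differentiable at the
  origin. With \<open>d\<close> half of \<open>R\<^sup>2 - r1\<^sup>2\<close>, the argument of
  \<open>k\<close> is 1 at radius \<open>r1\<close> and 0 at radius
  \<open>sqrt (R\<^sup>2 - d)\<close>, strictly inside the ball. The gradient is at most 4 R / d,
  and the bound 8 / (R - r1) follows because R \<le> R + r1.\<close>

lemma smooth_cutoff:
  fixes r1 R :: real
  assumes "0 \<le> r1" "r1 < R"
  obtains eta :: "'a::euclidean_space \<Rightarrow> real" and G :: "'a \<Rightarrow> 'a" and r2 where
    "\<And>y. (eta has_derivative (\<lambda>v. G y \<bullet> v)) (at y)" "continuous_on UNIV G"
    "r2 < R" "\<And>y. r2 \<le> norm y \<Longrightarrow> eta y = 0 \<and> G y = 0"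
    "\<And>y. norm y \<le> r1 \<Longrightarrow> eta y = 1 \<and> G y = 0"
    "\<And>y. 0 \<le> eta y \<and> eta y \<le> 1" "\<And>y. norm (G y) \<le> 8 / (R - r1)"
proof -
  define q where "q s = (max 0 s)\<^sup>2" for s :: real
  \<comment> \<open>Quadratic spline rising from 0 to 1: it equals 2 s^2 up to s = 1/2, then 1 - 2
    (1 - s)^2 up to s = 1; its slope never exceeds 2.\<close>
  define k where "k s = 2 * (q s - 2 * q (s - 1/2) + q (s - 1))" for s :: real
  define k' where "k' s = 4 * (max 0 s - 2 * max 0 (s - 1/2) + max 0 (s - 1))" for s :: real
  define d where "d = (R\<^sup>2 - r1\<^sup>2) / 2"
  define eta where "eta y = k ((R\<^sup>2 - d - (norm y)\<^sup>2) / d)" for y :: 'a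
  define G where "G y = (- 2 * k' ((R\<^sup>2 - d - (norm y)\<^sup>2) / d) / d) *\<^sub>R y" for y :: 'a
  have R: "R > 0" using assms by linarith
  have d: "d > 0" using assms by (simp add: d_def power_strict_mono)
  have dk: "(k has_real_derivative k' s) (at s)" for s
  proof -
    have dq: "(q has_real_derivative 2 * max 0 x) (at x)" for x
      unfolding q_def by (rule has_derivative_pos_part_sq)
    have *: "((\<lambda>s. q (s - c)) has_real_derivative 2 * max 0 (s - c)) (at s)" for c
    proof -
      have "((\<lambda>s. s - c) has_real_derivative 1) (at s)" by (auto intro!: derivative_eq_intros)
      from DERIV_chain2[OF dq this] show ?thesis by simp
    qed
    show ?thesis
      unfolding k_def k'_def using *[of 0] by (auto intro!: derivative_eq_intros *)
  qed
  have k0: "k s = 0 \<and> k' s = 0" if "s \<le> 0" for s using that by (auto simp: k_def k'_def q_def)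
  have k1: "k s = 1 \<and> k' s = 0" if "1 \<le> s" for s
    using that by (auto simp: k_def k'_def q_def power2_eq_square algebra_simps)
  have kb: "0 \<le> k s \<and> k s \<le> 1 \<and> 0 \<le> k' s \<and> k' s \<le> 2" for s
  proof -
    consider "s \<le> 0" | "1 \<le> s" | "0 \<le> s" "s \<le> 1/2" | "1/2 \<le> s" "s \<le> 1" by linarith
    then show ?thesis
    proof cases
      case 3
      then have "s\<^sup>2 \<le> (1/2)\<^sup>2" by (intro power_mono) auto
      then show ?thesis using 3 by (auto simp: k_def k'_def q_def power2_eq_square)
    next
      case 4
      then have "(1 - s)\<^sup>2 \<le> (1/2)\<^sup>2" by (intro power_mono) auto
      moreover have "k s = 1 - 2 * (1 - s)\<^sup>2" using 4
        by (auto simp: k_def q_def power2_eq_square algebra_simps)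
      ultimately show ?thesis using 4 by (auto simp: k'_def power2_eq_square)
    qed (use k0 k1 in auto)
  qed
  have eta: "(eta has_derivative (\<lambda>v. G y \<bullet> v)) (at y)" for y
  proof -
    have "((\<lambda>y. (R\<^sup>2 - d - (norm y)\<^sup>2) / d) has_derivative (\<lambda>v. - (2 * (y \<bullet> v)) / d)) (at y)"
      unfolding power2_norm_eq_inner using d
      by (auto intro!: derivative_eq_intros simp: inner_commute field_simps)
    then have "(eta has_derivative (\<lambda>v. k' ((R\<^sup>2 - d - (norm y)\<^sup>2) / d) * (- (2 * (y \<bullet> v)) / d))) (at y)"
      unfolding eta_def using has_derivative_compose[OF _ dk[unfolded has_field_derivative_def]] by blast
    then show ?thesis by (simp add: G_def mult.assoc mult.left_commute)
  qed
  have s_le: "(R\<^sup>2 - d - (norm y)\<^sup>2) / d \<le> 0 \<longleftrightarrow> sqrt (R\<^sup>2 - d) \<le> norm y" for y :: 'a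
  proof -
    have "sqrt (R\<^sup>2 - d) \<le> norm y \<longleftrightarrow> R\<^sup>2 - d \<le> (norm y)\<^sup>2"
      by (metis real_sqrt_abs abs_norm_cancel real_sqrt_le_iff)
    then show ?thesis using d by (auto simp: divide_le_0_iff)
  qed
  have s_ge: "1 \<le> (R\<^sup>2 - d - (norm y)\<^sup>2) / d \<longleftrightarrow> norm y \<le> r1" for y :: 'a
  proof -
    have "1 \<le> (R\<^sup>2 - d - (norm y)\<^sup>2) / d \<longleftrightarrow> (norm y)\<^sup>2 \<le> r1\<^sup>2"
      using d by (simp add: field_simps) (simp add: d_def field_simps)
    then show ?thesis using assms by (simp add: abs_le_square_iff[symmetric])
  qed
  show ?thesis
  proof (rule that[of eta G "sqrt (R\<^sup>2 - d)"])
    show "continuous_on UNIV G"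
      unfolding G_def k'_def by (intro continuous_intros) (use d in auto)
    have "R\<^sup>2 - d < R\<^sup>2" using d by simp
    then show "sqrt (R\<^sup>2 - d) < R" using R real_less_rsqrt by (smt (verit) real_sqrt_less_iff real_sqrt_abs)
    show "eta y = 0 \<and> G y = 0" if "sqrt (R\<^sup>2 - d) \<le> norm y" for y
      using that s_le[of y] k0 by (auto simp: eta_def G_def)
    show "eta y = 1 \<and> G y = 0" if "norm y \<le> r1" for y
      using that s_ge[of y] k1 by (auto simp: eta_def G_def)
    show "0 \<le> eta y \<and> eta y \<le> 1" for y using kb by (auto simp: eta_def)
    show "norm (G y) \<le> 8 / (R - r1)" for y
    proof (cases "norm y \<le> R")
      case True
      have "norm (G y) = 2 * k' ((R\<^sup>2 - d - (norm y)\<^sup>2) / d) / d * norm y"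
        using kb d by (simp add: G_def)
      also have "\<dots> \<le> 4 / d * R"
        using kb[of "(R\<^sup>2 - d - (norm y)\<^sup>2) / d"] d True R by (intro mult_mono divide_right_mono) auto
      also have "\<dots> \<le> 8 / (R - r1)"
      proof -
        have "(R - r1) * R \<le> (R - r1) * (R + r1)" using assms by (intro mult_left_mono) auto
        then have "(R - r1) * R \<le> 2 * d" by (simp add: d_def power2_eq_square algebra_simps)
        then show ?thesis using d assms by (simp add: field_simps)
      qed
      finally show ?thesis .
    next
      case False
      then have "sqrt (R\<^sup>2 - d) \<le> norm y" using \<open>sqrt (R\<^sup>2 - d) < R\<close> by simp
      then have "G y = 0" using s_le[of y] k0 by (auto simp: G_def)
      then show ?thesis using assms by simp
    qed
  qed (use eta in auto)
qed

section \<open>Balance laws on a moving ball\<close>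

lemma mem_Omega_hat: "(t, x) \<in> Omega_hat Tm Tp r R \<longleftrightarrow> Tm \<le> t \<and> t \<le> Tp \<and> dist (r t) x \<le> R"
  by (auto simp: Omega_hat_def)

lemma C1_on_continuous_on: "C1_on S f f' \<Longrightarrow> continuous_on S f"
  unfolding C1_on_def by (rule has_derivative_continuous_on[of S f "\<lambda>z. blinfun_apply (f' z)"]) auto

lemma continuous_on_tube_shift:
  fixes h :: "real \<times> (real^3) \<Rightarrow> 'b::topological_space"
  assumes r: "continuous_on {Tm..Tp} r" and h: "continuous_on (Omega_hat Tm Tp r R) h"
  shows "continuous_on ({Tm..Tp} \<times> cball 0 R) (\<lambda>z. h (fst z, r (fst z) + snd z))"
  by (rule continuous_on_compose2[OF h])
     (auto simp: mem_Omega_hat dist_norm intro!: continuous_intros continuous_on_compose2[OF r])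

text \<open>Straightened coordinates: the tube is a continuous image of a product, from which its
  compactness follows.\<close>

lemma tube_eq_image:
  "Omega_hat Tm Tp r R = (\<lambda>z. (fst z, r (fst z) + snd z)) ` ({Tm..Tp} \<times> cball 0 R)"
proof (intro equalityI subsetI)
  fix z assume "z \<in> Omega_hat Tm Tp r R"
  then have "z = (fst (fst z, snd z - r (fst z)), r (fst z) + snd (fst z, snd z - r (fst z)))"
    "(fst z, snd z - r (fst z)) \<in> {Tm..Tp} \<times> cball 0 R"
    by (cases z; auto simp: mem_Omega_hat dist_norm norm_minus_commute)+
  then show "z \<in> (\<lambda>z. (fst z, r (fst z) + snd z)) ` ({Tm..Tp} \<times> cball 0 R)"
    by (metis (no_types, lifting) fst_conv image_eqI)
qed (auto simp: mem_Omega_hat dist_norm)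

lemma compact_Omega_hat:
  assumes r: "continuous_on {Tm..Tp} r"
  shows "compact (Omega_hat Tm Tp r R)"
  unfolding tube_eq_image
  by (intro compact_continuous_image compact_Times compact_cball compact_Icc continuous_intros
      continuous_on_compose2[OF r]) auto

lemma continuous_on_tube_integral:
  fixes h :: "real \<times> (real^3) \<Rightarrow> real"
  assumes r: "continuous_on {Tm..Tp} r" and h: "continuous_on (Omega_hat Tm Tp r R) h"
  shows "continuous_on {Tm..Tp} (\<lambda>t. integral (cball (r t) R) (\<lambda>x. h (t, x)))"
  unfolding integral_cball_translate[of "r t" for t]
  using continuous_on_integral_compact[OF compact_Icc compact_cball continuous_on_tube_shift[OF r h]]
  by simp

lemma continuous_on_tube_slice:
  assumes h: "continuous_on (Omega_hat Tm Tp r R) h" and t: "t \<in> {Tm..Tp}"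
  shows "continuous_on (cball (r t) R) (\<lambda>x. h (t, x))"
  by (rule continuous_on_compose2[OF h]) (use t in \<open>auto simp: mem_Omega_hat intro!: continuous_intros\<close>)

lemma continuous_on_tube_slice0:
  assumes h: "continuous_on (Omega_hat Tm Tp r R) h" and t: "t \<in> {Tm..Tp}"
  shows "continuous_on (cball 0 R) (\<lambda>y. h (t, r t + y))"
  by (rule continuous_on_compose2[OF h]) (use t in \<open>auto simp: mem_Omega_hat dist_norm intro!: continuous_intros\<close>)

text \<open>The curve with fixed offset \<open>y\<close> stays in the tube, so the derivative within
  the tube suffices, also at the two end times. The direction \<open>(1, r')\<close> makes this the
  material derivative of \<open>u\<close> along the trajectory.\<close>

lemma C1_on_tube_deriv_t:
  assumes C: "C1_on (Omega_hat Tm Tp r R) u Du"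
    and r: "(r has_vector_derivative r') (at t within {Tm..Tp})"
    and t: "t \<in> {Tm..Tp}" and y: "y \<in> cball 0 R"
  shows "((\<lambda>t. u (t, r t + y)) has_vector_derivative Du (t, r t + y) (1, r')) (at t within {Tm..Tp})"
proof -
  have "((\<lambda>t. (t, r t + y)) has_derivative (\<lambda>h. (h, h *\<^sub>R r'))) (at t within {Tm..Tp})"
    using r by (auto intro!: derivative_eq_intros simp: has_vector_derivative_def)
  moreover have "(u has_derivative Du (t, r t + y)) (at (t, r t + y) within (\<lambda>t. (t, r t + y)) ` {Tm..Tp})"
    by (rule has_derivative_subset[where s = "Omega_hat Tm Tp r R"])
      (use C t y in \<open>auto simp: C1_on_def mem_Omega_hat dist_norm\<close>)
  ultimately have "((\<lambda>t. u (t, r t + y)) has_derivative (\<lambda>h. Du (t, r t + y) (h, h *\<^sub>R r'))) (at t within {Tm..Tp})"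
    by (rule has_derivative_in_compose)
  also have "(\<lambda>h. Du (t, r t + y) (h, h *\<^sub>R r')) = (\<lambda>h. h *\<^sub>R Du (t, r t + y) (1, r'))"
    by (simp flip: blinfun.scaleR_right)
  finally show ?thesis by (simp add: has_vector_derivative_def)
qed

lemma C1_on_tube_deriv_x:
  assumes C: "C1_on (Omega_hat Tm Tp r R) u Du" and t: "t \<in> {Tm..Tp}" and y: "y \<in> cball 0 R"
  shows "((\<lambda>y. u (t, r t + y)) has_derivative (\<lambda>v. Du (t, r t + y) (0, v))) (at y within cball 0 R)"
proof -
  have "((\<lambda>y. (t, r t + y)) has_derivative (\<lambda>v. (0, v))) (at y within cball 0 R)"
    by (auto intro!: derivative_eq_intros)
  moreover have "(u has_derivative Du (t, r t + y)) (at (t, r t + y) within (\<lambda>y. (t, r t + y)) ` cball 0 R)"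
    by (rule has_derivative_subset[where s = "Omega_hat Tm Tp r R"])
      (use C t y in \<open>auto simp: C1_on_def mem_Omega_hat dist_norm\<close>)
  ultimately show ?thesis
    by (rule has_derivative_in_compose)
qed

text \<open>Splits a material derivative into the time derivative and the transport part, whose
  coefficients are the velocity components.\<close>

lemma blinfun_apply_tx:
  fixes L :: "(real \<times> (real^3)) \<Rightarrow>\<^sub>L 'b::real_normed_vector"
  shows "L (1, v) = L (1, 0) + (\<Sum>i\<in>UNIV. v $ i *\<^sub>R L (0, axis i 1))"
proof -
  have v: "v = (\<Sum>i\<in>UNIV. v $ i *\<^sub>R axis i 1)"
    by (simp add: vec_eq_iff axis_def if_distrib sum.delta cong: if_cong)
  have "(1, v) = (1, 0) + (\<Sum>i\<in>UNIV. v $ i *\<^sub>R (0::real, axis i (1::real)))"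
    by (subst v) (simp add: prod_eq_iff fst_sum snd_sum)
  then show ?thesis by (simp only: blinfun.add_right blinfun.sum_right blinfun.scaleR_right)
qed

text \<open>In coordinates relative to the centre the time derivative is the material one, and it
  equals \<open>f\<close> minus the divergence of the relative flux \<open>W\<close>: the transport
  term joins the flux since \<open>r'\<close> does not depend on x. Integration by parts moves the
  divergence onto the cutoff.\<close>

lemma cutoff_balance_deriv:
  fixes u f :: "real \<times> (real^3) \<Rightarrow> real" and V :: "3 \<Rightarrow> real \<times> (real^3) \<Rightarrow> real"
  assumes r: "\<And>t. t \<in> {Tm..Tp} \<Longrightarrow> (r has_vector_derivative r' t) (at t within {Tm..Tp})"
    and r': "continuous_on {Tm..Tp} r'"
    and u: "C1_on (Omega_hat Tm Tp r R) u Du"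
    and V: "\<And>i. C1_on (Omega_hat Tm Tp r R) (V i) (DV i)"
    and f: "continuous_on (Omega_hat Tm Tp r R) f"
    and law: "\<And>t x. Tm < t \<Longrightarrow> t < Tp \<Longrightarrow> dist (r t) x < R \<Longrightarrow>
        dt Du (t, x) + (\<Sum>i\<in>UNIV. dx (DV i) (t, x) i) = f (t, x)"
    and eta: "\<And>y. (eta has_derivative (\<lambda>v. G y \<bullet> v)) (at y)" and G: "continuous_on UNIV G"
    and supp: "r2 < R" "\<And>y. r2 \<le> norm y \<Longrightarrow> eta y = 0 \<and> G y = 0"
    and t: "Tm < t" "t < Tp"
  defines "W \<equiv> \<lambda>z. \<chi> i. V i z - u z * r' (fst z) $ i"
  shows "((\<lambda>t. integral (cball 0 R) (\<lambda>y. eta y * u (t, r t + y))) has_vector_derivative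
      integral (cball 0 R) (\<lambda>y. eta y * f (t, r t + y))
      + integral (cball 0 R) (\<lambda>y. G y \<bullet> W (t, r t + y))) (at t)"
proof -
  let ?S = "Omega_hat Tm Tp r R"
  have cr: "continuous_on {Tm..Tp} r"
    by (intro continuous_on_eq_continuous_within[THEN iffD2] ballI has_vector_derivative_continuous[OF r])
  have ceta: "continuous_on A eta" for A
    by (intro continuous_at_imp_continuous_on ballI has_derivative_continuous[OF eta])
  have cG: "continuous_on A G" for A using G continuous_on_subset by blast
  have t': "t \<in> {Tm..Tp}" using t by auto
  have cu: "continuous_on ?S u" and cDu: "continuous_on ?S Du"
    using C1_on_continuous_on[OF u] u by (auto simp: C1_on_def)
  have cV: "continuous_on ?S (V i)" and cDV: "continuous_on ?S (DV i)" for i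
    using C1_on_continuous_on[OF V] V by (auto simp: C1_on_def)
  obtain a where a: "cball (0::real^3) R \<subseteq> cbox (-a) a"
    using bounded_subset_cbox_symmetric bounded_cball by blast
  \<comment> \<open>The Leibniz rule used below integrates over a box, hence the extension by zero;
    it is continuous because \<open>eta\<close> vanishes between \<open>r2\<close> and
    \<open>R\<close>.\<close>
  have ext: "integral (cball 0 R) (\<lambda>y. eta y * g y) = integral (cbox (-a) a) (\<lambda>y. if norm y \<le> R then eta y * g y else 0)"
    for g :: "real^3 \<Rightarrow> real"
  proof -
    have "integral (cball 0 R) (\<lambda>y. eta y * g y) = integral UNIV (\<lambda>y. if y \<in> cball 0 R then eta y * g y else 0)"
      by (rule Henstock_Kurzweil_Integration.integral_restrict_UNIV[symmetric])
    also have "\<dots> = integral (cbox (-a) a) (\<lambda>y. if y \<in> cball 0 R then eta y * g y else 0)"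
      by (rule integral_eq_UNIV[symmetric]) (use a in auto)
    finally show ?thesis by simp
  qed
  have cext: "continuous_on ({Tm..Tp} \<times> UNIV) (\<lambda>z. if norm (snd z) \<le> R then eta (snd z) * k z else 0)"
    if k: "continuous_on ({Tm..Tp} \<times> cball 0 R) k" for k :: "real \<times> (real^3) \<Rightarrow> real"
  proof -
    have "continuous_on ({Tm..Tp} \<times> cball 0 R \<union> {Tm..Tp} \<times> {y. r2 \<le> norm y})
       (\<lambda>z. if norm (snd z) \<le> R then eta (snd z) * k z else 0)"
    proof (intro continuous_on_closed_Un closed_Times closed_Collect_le continuous_intros)
      show "continuous_on ({Tm..Tp} \<times> cball 0 R) (\<lambda>z. if norm (snd z) \<le> R then eta (snd z) * k z else 0)"
      proof (rule continuous_on_eq)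
        show "continuous_on ({Tm..Tp} \<times> cball 0 R) (\<lambda>z. eta (snd z) * k z)"
          by (intro continuous_intros k continuous_on_compose2[OF ceta[of UNIV]]) auto
      qed auto
      show "continuous_on ({Tm..Tp} \<times> {y. r2 \<le> norm y}) (\<lambda>z. if norm (snd z) \<le> R then eta (snd z) * k z else 0)"
      proof (rule continuous_on_eq)
        show "continuous_on ({Tm..Tp} \<times> {y. r2 \<le> norm y}) (\<lambda>z. 0::real)" by simp
      qed (use supp in auto)
    qed auto
    moreover have "{Tm..Tp} \<times> cball 0 R \<union> {Tm..Tp} \<times> {y. r2 \<le> norm y} = {Tm..Tp} \<times> (UNIV::(real^3) set)"
      using supp by auto
    ultimately show ?thesis by simp
  qed
  let ?d = "\<lambda>z. Du (fst z, r (fst z) + snd z) (1, r' (fst z))"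
  have "((\<lambda>t. integral (cbox (-a) a) (\<lambda>y. if norm y \<le> R then eta y * u (t, r t + y) else 0))
     has_vector_derivative integral (cbox (-a) a) (\<lambda>y. if norm y \<le> R then eta y * ?d (t, y) else 0)) (at t within {Tm..Tp})"
  proof (rule leibniz_rule_vector_derivative[where fx = "\<lambda>t y. if norm y \<le> R then eta y * ?d (t, y) else 0"])
    fix s y assume s: "s \<in> {Tm..Tp}"
    show "((\<lambda>t. if norm y \<le> R then eta y * u (t, r t + y) else 0) has_vector_derivative
        (if norm y \<le> R then eta y * ?d (s, y) else 0)) (at s within {Tm..Tp})"
      using C1_on_tube_deriv_t[OF u r[OF s] s, of y]
      by (auto intro!: has_vector_derivative_mult_right)
  next
    fix s assume s: "s \<in> {Tm..Tp}"
    have "continuous_on UNIV (\<lambda>y. (\<lambda>z. if norm (snd z) \<le> R then eta (snd z) * u (fst z, r (fst z) + snd z) else 0) (s, y))"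
      by (rule continuous_on_compose2[OF cext[OF continuous_on_tube_shift[OF cr cu]]])
         (use s in \<open>auto intro!: continuous_intros\<close>)
    then have "continuous_on UNIV (\<lambda>y. if norm y \<le> R then eta y * u (s, r s + y) else 0)"
      by (simp cong: if_cong)
    from continuous_on_subset[OF this subset_UNIV]
    show "(\<lambda>y. if norm y \<le> R then eta y * u (s, r s + y) else 0) integrable_on cbox (- a) a"
      by (rule integrable_continuous)
  next
    have "continuous_on ({Tm..Tp} \<times> cball 0 R) ?d"
      by (intro continuous_intros continuous_on_tube_shift[OF cr cDu] continuous_on_compose2[OF r']) auto
    note cext[OF this]
    then have "continuous_on ({Tm..Tp} \<times> cbox (- a) a) (\<lambda>z. if norm (snd z) \<le> R then eta (snd z) * ?d z else 0)"
      by (rule continuous_on_subset) auto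
    then show "continuous_on ({Tm..Tp} \<times> cbox (- a) a) (\<lambda>(t, y). if norm y \<le> R then eta y * ?d (t, y) else 0)"
      unfolding case_prod_unfold by (simp cong: if_cong)
  qed (use t in auto)
  then have "((\<lambda>t. integral (cball 0 R) (\<lambda>y. eta y * u (t, r t + y))) has_vector_derivative
      integral (cball 0 R) (\<lambda>y. eta y * Du (t, r t + y) (1, r' t))) (at t within {Tm..Tp})"
    by (simp only: ext fst_conv snd_conv)
  then have 1: "((\<lambda>t. integral (cball 0 R) (\<lambda>y. eta y * u (t, r t + y))) has_vector_derivative
      integral (cball 0 R) (\<lambda>y. eta y * Du (t, r t + y) (1, r' t))) (at t)"
    using t by (simp add: at_within_Icc_at)
  define W' where "W' i y v = DV i (t, r t + y) (0, v) - Du (t, r t + y) (0, v) * r' t $ i" for i y v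
  \<comment> \<open>On the bounding sphere the law is not assumed, but there both sides vanish with
    \<open>eta\<close>.\<close>
  have pt: "eta y * Du (t, r t + y) (1, r' t) = eta y * f (t, r t + y) - (\<Sum>i\<in>UNIV. eta y * W' i y (axis i 1))"
    if y: "y \<in> cball 0 R" for y
  proof (cases "norm y < R")
    case True
    have "Du (t, r t + y) (1, r' t) = f (t, r t + y) - (\<Sum>i\<in>UNIV. W' i y (axis i 1))"
      using law[OF t, of "r t + y"] True blinfun_apply_tx[of "Du (t, r t + y)" "r' t"]
      by (simp add: dist_norm W'_def dt_def dx_def sum_subtractf mult.commute algebra_simps)
    then show ?thesis by (simp only: right_diff_distrib sum_distrib_left)
  next
    case False
    then show ?thesis using supp by auto
  qed
  have cW': "continuous_on (cball 0 R) (\<lambda>y. W' i y e)" for i e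
    unfolding W'_def by (intro continuous_intros continuous_on_tube_slice0[OF cDV t'] continuous_on_tube_slice0[OF cDu t'])
  have cW: "continuous_on (cball 0 R) (\<lambda>y. W (t, r t + y) $ i)" for i
    unfolding W_def by (simp, intro continuous_intros continuous_on_tube_slice0[OF cV t'] continuous_on_tube_slice0[OF cu t'])
  have "integral (cball 0 R) (\<lambda>y. eta y * Du (t, r t + y) (1, r' t)) =
    integral (cball 0 R) (\<lambda>y. eta y * f (t, r t + y) - (\<Sum>i\<in>UNIV. eta y * W' i y (axis i 1)))"
    by (rule integral_cong) (use pt in auto)
  also have "\<dots> = integral (cball 0 R) (\<lambda>y. eta y * f (t, r t + y)) - integral (cball 0 R) (\<lambda>y. \<Sum>i\<in>UNIV. eta y * W' i y (axis i 1))"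
    by (intro integral_diff integrable_on_compact compact_cball continuous_intros ceta cW' continuous_on_tube_slice0[OF f t'])
  also have "integral (cball 0 R) (\<lambda>y. \<Sum>i\<in>UNIV. eta y * W' i y (axis i 1)) =
     (\<Sum>i\<in>UNIV. integral (cball 0 R) (\<lambda>y. eta y * W' i y (axis i 1)))"
    by (intro integral_sum integrable_on_compact compact_cball continuous_intros ceta cW') auto
  also have "\<dots> = (\<Sum>i\<in>UNIV. - integral (cball 0 R) (\<lambda>y. (G y \<bullet> axis i 1) * W (t, r t + y) $ i))"
  proof (intro sum.cong refl integral_by_parts_cball[OF eta G supp])
    fix i :: 3 and y assume "y \<in> cball (0::real^3) R"
    then show "((\<lambda>y. W (t, r t + y) $ i) has_derivative W' i y) (at y within cball 0 R)"
      unfolding W_def W'_def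
      by (auto intro!: derivative_eq_intros C1_on_tube_deriv_x[OF V t'] C1_on_tube_deriv_x[OF u t'])
  qed (use cW' in auto)
  also have "\<dots> = - integral (cball 0 R) (\<lambda>y. \<Sum>i\<in>UNIV. (G y \<bullet> axis i 1) * W (t, r t + y) $ i)"
    by (subst integral_sum)
       (auto simp: sum_negf intro!: integrable_on_compact continuous_intros cG cW)
  also have "(\<lambda>y. \<Sum>i\<in>UNIV. (G y \<bullet> axis i 1) * W (t, r t + y) $ i) = (\<lambda>y. G y \<bullet> W (t, r t + y))"
    by (simp add: inner_axis) (simp add: inner_vec_def)
  finally show ?thesis using 1 by simp
qed

text \<open>Used twice in \<open>balance_law\<close>: with \<open>h\<close> constant for the error
  of the cutoff, and with \<open>h\<close> the dominating density for the flux. Since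
  \<open>k\<close> vanishes inside radius \<open>r1\<close>, only the shell contributes.\<close>

lemma integral_cball_shell_bound:
  fixes k h :: "real^3 \<Rightarrow> real"
  assumes R: "0 \<le> r1" "r1 \<le> R" and h: "continuous_on (cball p R) h" and k: "continuous_on (cball p R) k"
    and nn: "\<And>x. x \<in> cball p R \<Longrightarrow> 0 \<le> h x" and e: "0 \<le> e" and C: "0 \<le> C"
    and close: "\<And>w s. norm w = 1 \<Longrightarrow> r1 \<le> s \<Longrightarrow> s \<le> R \<Longrightarrow> h (p + s *\<^sub>R w) \<le> h (p + R *\<^sub>R w) + e"
    and k0: "\<And>x. dist p x < r1 \<Longrightarrow> k x = 0"
    and kb: "\<And>x. r1 \<le> dist p x \<Longrightarrow> dist p x \<le> R \<Longrightarrow> \<bar>k x\<bar> \<le> C * h x"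
  shows "\<bar>integral (cball p R) k\<bar> \<le> C * ((R - r1) * (sphere_integral p R h + e * (R\<^sup>2 * (2 * pi\<^sup>2))))"
proof -
  let ?A = "{x. r1 \<le> dist p x \<and> dist p x \<le> R}"
  have sub: "?A \<subseteq> cball p R" by auto
  have "compact (cball p R \<inter> {x. r1 \<le> dist p x})"
    by (intro compact_Int_closed compact_cball closed_Collect_le continuous_intros)
  also have "cball p R \<inter> {x. r1 \<le> dist p x} = ?A" by auto
  finally have A: "compact ?A" .
  have "(\<lambda>x. if x \<in> cball p R then k x else 0) = (\<lambda>x. if x \<in> ?A then k x else 0)"
    using k0 by (auto simp: fun_eq_iff not_le)
  then have "integral (cball p R) k = integral ?A k"
    by (simp only: flip: Henstock_Kurzweil_Integration.integral_restrict_UNIV[of "cball p R" k]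
        Henstock_Kurzweil_Integration.integral_restrict_UNIV[of ?A k])
  also have "norm \<dots> \<le> integral ?A (\<lambda>x. C * h x)"
    using kb by (intro integral_norm_bound_integral integrable_on_compact A continuous_intros
        continuous_on_subset[OF h sub] continuous_on_subset[OF k sub]) auto
  also have "\<dots> = C * integral ?A h" by simp
  also have "\<dots> \<le> C * ((R - r1) * (sphere_integral p R h + e * (R\<^sup>2 * (2 * pi\<^sup>2))))"
    by (rule mult_left_mono[OF integral_spherical_shell_le[OF R h nn e close] C])
  finally show ?thesis by simp
qed

text \<open>The gradient of the cutoff is at most 8 divided by the width of the shell, and the shell
  integral of \<open>H\<close> is at most the width times the sphere integral, up to a small error.
  The widths cancel, so the flux term stays near or below 8 B while the errors of the cutoff tend to
  zero with the width. The 8 is the gradient constant of \<open>smooth_cutoff\<close>.\<close>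

lemma balance_law:
  fixes u f H :: "real \<times> (real^3) \<Rightarrow> real" and V :: "3 \<Rightarrow> real \<times> (real^3) \<Rightarrow> real"
  assumes r: "\<And>t. t \<in> {Tm..Tp} \<Longrightarrow> (r has_vector_derivative r' t) (at t within {Tm..Tp})"
    and r': "continuous_on {Tm..Tp} r'" and R: "R > 0"
    and u: "C1_on (Omega_hat Tm Tp r R) u Du"
    and V: "\<And>i. C1_on (Omega_hat Tm Tp r R) (V i) (DV i)"
    and f: "continuous_on (Omega_hat Tm Tp r R) f"
    and H: "continuous_on (Omega_hat Tm Tp r R) H"
    and law: "\<And>t x. Tm < t \<Longrightarrow> t < Tp \<Longrightarrow> dist (r t) x < R \<Longrightarrow>
        dt Du (t, x) + (\<Sum>i\<in>UNIV. dx (DV i) (t, x) i) = f (t, x)"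
    and dom: "\<And>z. z \<in> Omega_hat Tm Tp r R \<Longrightarrow> norm (\<chi> i. V i z - u z * r' (fst z) $ i) \<le> H z"
    and B: "\<And>t. t \<in> {Tm..Tp} \<Longrightarrow> sphere_integral (r t) R (\<lambda>x. H (t, x)) \<le> B"
    and st: "Tm \<le> s" "s \<le> t" "t \<le> Tp"
  shows "\<bar>integral (cball (r t) R) (\<lambda>x. u (t, x)) - integral (cball (r s) R) (\<lambda>x. u (s, x))
     - integral {s..t} (\<lambda>\<tau>. integral (cball (r \<tau>) R) (\<lambda>x. f (\<tau>, x)))\<bar> \<le> 8 * B * (t - s)"
    (is "?lhs \<le> _")
proof (rule field_le_epsilon)
  fix e :: real assume e: "e > 0"
  let ?S = "Omega_hat Tm Tp r R"
  have cr: "continuous_on {Tm..Tp} r"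
    by (intro continuous_on_eq_continuous_within[THEN iffD2] ballI has_vector_derivative_continuous[OF r])
  have cS: "compact ?S" by (rule compact_Omega_hat[OF cr])
  have cu: "continuous_on ?S u" using u by (rule C1_on_continuous_on)
  have cV: "continuous_on ?S (V i)" for i using V by (rule C1_on_continuous_on)
  define W where "W = (\<lambda>z. \<chi> i. V i z - u z * r' (fst z) $ i)"
  have cW: "continuous_on ?S W"
    unfolding W_def
    by (intro continuous_on_vec_lambda continuous_intros cV cu continuous_on_compose2[OF r'])
      (auto simp: Omega_hat_def)
  obtain M where M: "M \<ge> 0" "\<And>z. z \<in> ?S \<Longrightarrow> \<bar>u z\<bar> \<le> M" "\<And>z. z \<in> ?S \<Longrightarrow> \<bar>f z\<bar> \<le> M"
  proof -
    have "bounded (u ` ?S)" "bounded (f ` ?S)"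
      using compact_continuous_image[OF cu cS] compact_continuous_image[OF f cS] compact_imp_bounded by auto
    then obtain M1 M2 where "\<And>z. z \<in> ?S \<Longrightarrow> \<bar>u z\<bar> \<le> M1" "\<And>z. z \<in> ?S \<Longrightarrow> \<bar>f z\<bar> \<le> M2"
      unfolding bounded_iff by auto
    then show ?thesis by (intro that[of "max 0 (max M1 M2)"]) fastforce+
  qed
  define c1 where "c1 = R\<^sup>2 * (2 * pi\<^sup>2)"
  define A1 where "A1 = \<bar>sphere_integral 0 R (\<lambda>_. 1)\<bar>"
  have A1: "sphere_integral p R (\<lambda>_. 1) \<le> A1" for p
  proof -
    have "sphere_integral p R (\<lambda>_. 1) = sphere_integral 0 R (\<lambda>_. 1)" by (simp add: sphere_integral_def)
    then show ?thesis by (simp add: A1_def)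
  qed
  have c1: "c1 \<ge> 0" and A1': "A1 \<ge> 0" by (auto simp: c1_def A1_def)
  define D where "D = 8 * c1 * (t - s)"
  have D: "D \<ge> 0" using c1 st by (simp add: D_def)
  \<comment> \<open>Tolerance for the oscillation of \<open>H\<close> across the shell; its total
    contribution \<open>8 * (e1 * c1) * (t - s)\<close> takes at most half of
    \<open>e\<close>.\<close>
  define e1 where "e1 = e / (2 * (D + 1))"
  have e1: "e1 > 0" "8 * (e1 * c1) * (t - s) \<le> e / 2"
  proof -
    show "e1 > 0" using e D by (simp add: e1_def)
    then have "e1 * D \<le> e1 * (D + 1)" by simp
    also have "\<dots> = e / 2" using D by (simp add: e1_def field_simps)
    finally show "8 * (e1 * c1) * (t - s) \<le> e / 2" by (simp add: D_def mult_ac)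
  qed
  obtain d where d: "d > 0" "\<And>z z'. z \<in> ?S \<Longrightarrow> z' \<in> ?S \<Longrightarrow> dist z' z < d \<Longrightarrow> dist (H z') (H z) < e1"
    using compact_uniformly_continuous[OF H cS] e1(1) unfolding uniformly_continuous_on_def by metis
  \<comment> \<open>Replacing the cutoff by 1 costs at most \<open>M * (w * A1)\<close> at time
    \<open>s\<close>, at time \<open>t\<close>, and per unit of time in the integral of
    \<open>f\<close>; \<open>K\<close> collects these coefficients of \<open>w\<close>.\<close>
  define K where "K = (2 * M + M * (t - s)) * A1"
  have K: "K \<ge> 0" using M st A1' by (simp add: K_def)
  \<comment> \<open>Width of the shell: small enough for a positive inner radius, for an oscillation
    of \<open>H\<close> below \<open>e1\<close>, and for a cutoff error of at most
    \<open>e / 2\<close>.\<close>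
  define w where "w = min (R / 2) (min (d / 2) (e / (2 * (K + 1))))"
  have w: "w > 0" "w < R" "w < d" "w * K \<le> e / 2"
  proof -
    show "w > 0" using R d e K by (simp add: w_def)
    show "w < R" "w < d" using R d by (auto simp: w_def)
    have "w * K \<le> e / (2 * (K + 1)) * K" using K by (intro mult_right_mono) (auto simp: w_def)
    also have "\<dots> = (e / 2) * (K / (K + 1))" by simp
    also have "\<dots> \<le> e / 2 * 1" using K e by (intro mult_left_mono) auto
    finally show "w * K \<le> e / 2" by simp
  qed
  define r1 where "r1 = R - w"
  have r1: "0 \<le> r1" "r1 < R" using w by (auto simp: r1_def)
  obtain eta G r2 where
    eta: "\<And>y. (eta has_derivative (\<lambda>v. G y \<bullet> v)) (at y)" and G: "continuous_on UNIV G" and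
    supp: "r2 < R" "\<And>y. r2 \<le> norm y \<Longrightarrow> eta y = 0 \<and> G y = 0" and
    one: "\<And>y. norm y \<le> r1 \<Longrightarrow> eta y = 1 \<and> G y = 0" and
    eta01: "\<And>y::real^3. 0 \<le> eta y \<and> eta y \<le> 1" and Gb: "\<And>y. norm (G y) \<le> 8 / (R - r1)"
    using smooth_cutoff[OF r1, where 'a = "real^3"] by metis
  have ceta: "continuous_on A eta" for A
    by (intro continuous_at_imp_continuous_on ballI has_derivative_continuous[OF eta])
  have cG: "continuous_on A G" for A using G continuous_on_subset by blast
  define Ue Fe We where "Ue \<tau> = integral (cball 0 R) (\<lambda>y. eta y * u (\<tau>, r \<tau> + y))"
    and "Fe \<tau> = integral (cball 0 R) (\<lambda>y. eta y * f (\<tau>, r \<tau> + y))"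
    and "We \<tau> = integral (cball 0 R) (\<lambda>y. G y \<bullet> W (\<tau>, r \<tau> + y))" for \<tau>
  define U F where "U \<tau> = integral (cball (r \<tau>) R) (\<lambda>x. u (\<tau>, x))"
    and "F \<tau> = integral (cball (r \<tau>) R) (\<lambda>x. f (\<tau>, x))" for \<tau>
  have cut: "\<bar>integral (cball 0 R) (\<lambda>y. eta y * k (\<tau>, r \<tau> + y)) - integral (cball (r \<tau>) R) (\<lambda>x. k (\<tau>, x))\<bar> \<le> M * (w * A1)"
    if k: "continuous_on ?S k" "\<And>z. z \<in> ?S \<Longrightarrow> \<bar>k z\<bar> \<le> M" and \<tau>: "\<tau> \<in> {Tm..Tp}" for k \<tau>
  proof -
    have ck: "continuous_on (cball 0 R) (\<lambda>y. k (\<tau>, r \<tau> + y))" by (rule continuous_on_tube_slice0[OF k(1) \<tau>])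
    have "integral (cball 0 R) (\<lambda>y. eta y * k (\<tau>, r \<tau> + y)) - integral (cball (r \<tau>) R) (\<lambda>x. k (\<tau>, x))
      = integral (cball 0 R) (\<lambda>y. eta y * k (\<tau>, r \<tau> + y) - k (\<tau>, r \<tau> + y))"
      unfolding integral_cball_translate[of "r \<tau>"]
      by (intro integral_diff[symmetric] integrable_on_compact compact_cball continuous_intros ceta ck)
    also have "\<bar>\<dots>\<bar> \<le> M * ((R - r1) * (sphere_integral 0 R (\<lambda>_. 1) + 0 * (R\<^sup>2 * (2 * pi\<^sup>2))))"
    proof (rule integral_cball_shell_bound)
      fix y :: "real^3" assume "r1 \<le> dist 0 y" "dist 0 y \<le> R"
      then have "\<bar>k (\<tau>, r \<tau> + y)\<bar> \<le> M" using \<tau> by (intro k) (auto simp: mem_Omega_hat dist_norm)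
      moreover have "\<bar>eta y * k (\<tau>, r \<tau> + y) - k (\<tau>, r \<tau> + y)\<bar> = (1 - eta y) * \<bar>k (\<tau>, r \<tau> + y)\<bar>"
      proof -
        have "eta y * k (\<tau>, r \<tau> + y) - k (\<tau>, r \<tau> + y) = - ((1 - eta y) * k (\<tau>, r \<tau> + y))"
          by (simp add: algebra_simps)
        then show ?thesis using eta01[of y] by (simp only: abs_minus_cancel abs_mult) simp
      qed
      ultimately show "\<bar>eta y * k (\<tau>, r \<tau> + y) - k (\<tau>, r \<tau> + y)\<bar> \<le> M * 1"
        using eta01[of y] mult_mono[of "1 - eta y" 1 "\<bar>k (\<tau>, r \<tau> + y)\<bar>" M] M by auto
    qed (use r1 M one in \<open>auto intro!: continuous_intros ceta ck\<close>)
    also have "\<dots> \<le> M * (w * A1)"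
      using w A1 M by (intro mult_left_mono) (auto simp: r1_def intro!: mult_left_mono)
    finally show ?thesis .
  qed
  have Web: "\<bar>We \<tau>\<bar> \<le> 8 * (B + e1 * c1)" if \<tau>: "\<tau> \<in> {Tm..Tp}" for \<tau>
  proof -
    have "We \<tau> = integral (cball (r \<tau>) R) (\<lambda>x. G (x - r \<tau>) \<bullet> W (\<tau>, x))"
      by (simp add: We_def integral_cball_translate[of "r \<tau>"])
    also have "\<bar>\<dots>\<bar> \<le> 8 / (R - r1) * ((R - r1) * (sphere_integral (r \<tau>) R (\<lambda>x. H (\<tau>, x)) + e1 * (R\<^sup>2 * (2 * pi\<^sup>2))))"
    proof (rule integral_cball_shell_bound)
      show "continuous_on (cball (r \<tau>) R) (\<lambda>x. G (x - r \<tau>) \<bullet> W (\<tau>, x))"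
        by (intro continuous_intros continuous_on_compose2[OF G] continuous_on_tube_slice[OF cW \<tau>]) auto
      show "0 \<le> H (\<tau>, x)" if "x \<in> cball (r \<tau>) R" for x
        by (rule order_trans[OF norm_ge_zero dom]) (use that \<tau> in \<open>auto simp: mem_Omega_hat\<close>)
      show "H (\<tau>, r \<tau> + \<sigma> *\<^sub>R v) \<le> H (\<tau>, r \<tau> + R *\<^sub>R v) + e1"
        if "norm v = 1" "r1 \<le> \<sigma>" "\<sigma> \<le> R" for v \<sigma>
      proof -
        have "dist (H (\<tau>, r \<tau> + \<sigma> *\<^sub>R v)) (H (\<tau>, r \<tau> + R *\<^sub>R v)) < e1"
        proof (rule d)
          have "dist (\<tau>, r \<tau> + \<sigma> *\<^sub>R v) (\<tau>, r \<tau> + R *\<^sub>R v) = \<bar>\<sigma> - R\<bar>"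
            using that by (simp add: dist_Pair_Pair dist_norm flip: scaleR_left_diff_distrib)
          then show "dist (\<tau>, r \<tau> + \<sigma> *\<^sub>R v) (\<tau>, r \<tau> + R *\<^sub>R v) < d"
            using that w by (simp add: r1_def)
        qed (use that \<tau> r1 in \<open>auto simp: mem_Omega_hat dist_norm\<close>)
        then show ?thesis by (simp add: dist_real_def)
      qed
      show "G (x - r \<tau>) \<bullet> W (\<tau>, x) = 0" if "dist (r \<tau>) x < r1" for x
        using one[of "x - r \<tau>"] that by (simp add: dist_norm norm_minus_commute)
      show "\<bar>G (x - r \<tau>) \<bullet> W (\<tau>, x)\<bar> \<le> 8 / (R - r1) * H (\<tau>, x)"
        if "r1 \<le> dist (r \<tau>) x" "dist (r \<tau>) x \<le> R" for x
      proof -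
        have "\<bar>G (x - r \<tau>) \<bullet> W (\<tau>, x)\<bar> \<le> norm (G (x - r \<tau>)) * norm (W (\<tau>, x))"
          by (rule Cauchy_Schwarz_ineq2)
        also have "\<dots> \<le> 8 / (R - r1) * H (\<tau>, x)"
          using dom[of "(\<tau>, x)"] that \<tau> r1 by (intro mult_mono Gb) (auto simp: W_def mem_Omega_hat)
        finally show ?thesis .
      qed
      show "continuous_on (cball (r \<tau>) R) (\<lambda>x. H (\<tau>, x))" by (rule continuous_on_tube_slice[OF H \<tau>])
    qed (use r1 e1 in auto)
    also have "\<dots> \<le> 8 * (B + e1 * c1)" using r1 B[OF \<tau>] by (simp add: c1_def)
    finally show ?thesis .
  qed
  have sub: "{s..t} \<subseteq> {Tm..Tp}" using st by auto
  have cont: "continuous_on {s..t} (\<lambda>\<tau>. integral (cball 0 R) (\<lambda>y. eta y * k (\<tau>, r \<tau> + y)))"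
    if k: "continuous_on ?S k" for k
  proof -
    have "continuous_on ({Tm..Tp} \<times> cball 0 R) (\<lambda>z. eta (snd z) * k (fst z, r (fst z) + snd z))"
      by (intro continuous_intros continuous_on_tube_shift[OF cr k] continuous_on_compose2[OF ceta[of UNIV]]) auto
    from continuous_on_subset[OF continuous_on_integral_compact[OF compact_Icc compact_cball this] sub]
    show ?thesis by simp
  qed
  have cF: "continuous_on {s..t} F"
    unfolding F_def by (rule continuous_on_subset[OF continuous_on_tube_integral[OF cr f] sub])
  have "((\<lambda>\<tau>. Fe \<tau> + We \<tau>) has_integral (Ue t - Ue s)) {s..t}"
  \<comment> \<open>The law is available only at interior times; at the end points continuity of
    \<open>Ue\<close> is enough.\<close>
  proof (rule fundamental_theorem_of_calculus_interior)
    fix \<tau> assume "\<tau> \<in> {s<..<t}"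
    then show "(Ue has_vector_derivative (Fe \<tau> + We \<tau>)) (at \<tau>)"
      unfolding Ue_def Fe_def We_def W_def
      using st by (intro cutoff_balance_deriv[OF r r' u V f law eta G supp]) auto
  qed (use st cont[OF cu] in \<open>auto simp: Ue_def\<close>)
  moreover have Fe: "Fe integrable_on {s..t}"
    using cont[OF f] unfolding Fe_def by (rule integrable_continuous_interval)
  ultimately have "(We has_integral (Ue t - Ue s - integral {s..t} Fe)) {s..t}"
    using has_integral_diff[OF _ integrable_integral[OF Fe]] by fastforce
  moreover have "0 \<le> 8 * (B + e1 * c1)" using Web[of s] st by (smt (verit) atLeastAtMost_iff)
  ultimately have 1: "\<bar>Ue t - Ue s - integral {s..t} Fe\<bar> \<le> 8 * (B + e1 * c1) * (t - s)"
    using has_integral_bound_real[of "8 * (B + e1 * c1)" "{}" We "Ue t - Ue s - integral {s..t} Fe" s t] Web sub st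
    by (auto simp: subset_iff)
  have 2: "\<bar>Ue \<tau> - U \<tau>\<bar> \<le> M * (w * A1)" "\<bar>Fe \<tau> - F \<tau>\<bar> \<le> M * (w * A1)" if "\<tau> \<in> {Tm..Tp}" for \<tau>
    unfolding Ue_def U_def Fe_def F_def using cut[OF cu M(2) that] cut[OF f M(3) that] by auto
  have 3: "\<bar>integral {s..t} Fe - integral {s..t} F\<bar> \<le> M * (w * A1) * (t - s)"
  proof -
    have "integral {s..t} Fe - integral {s..t} F = integral {s..t} (\<lambda>\<tau>. Fe \<tau> - F \<tau>)"
      by (intro integral_diff[symmetric] Fe integrable_continuous_interval cF)
    also have "\<bar>\<dots>\<bar> \<le> M * (w * A1) * integral {s..t} (\<lambda>_. 1)"
      using 2(2) sub cont[OF f] cF by (intro integral_const_bound continuous_intros) (auto simp: Fe_def)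
    finally show ?thesis using st by simp
  qed
  have "?lhs = \<bar>U t - U s - integral {s..t} F\<bar>" by (simp add: U_def F_def[abs_def])
  also have "\<dots> \<le> 8 * (B + e1 * c1) * (t - s) + (M * (w * A1) + M * (w * A1) + M * (w * A1) * (t - s))"
  proof -
    have "\<bar>Ue s - U s\<bar> \<le> M * (w * A1)" "\<bar>Ue t - U t\<bar> \<le> M * (w * A1)" using 2(1) st by auto
    with 1 3 show ?thesis by linarith
  qed
  also have "\<dots> = 8 * B * (t - s) + 8 * (e1 * c1) * (t - s) + w * K"
    by (simp add: K_def algebra_simps)
  also have "\<dots> \<le> 8 * B * (t - s) + e" using w e1 by auto
  finally show "?lhs \<le> 8 * B * (t - s) + e" .
qed

section \<open>Conservation laws and symmetry of second derivatives\<close>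

text \<open>Derivatives are plain functions here, continuous in each direction, so that product
  rules can be written without bounded linear function objects. In finite dimension this is as
  strong as \<open>C1_on\<close>, by \<open>C1f_Blinfun\<close>.\<close>

definition C1f :: "('a::euclidean_space) set \<Rightarrow> ('a \<Rightarrow> 'b::real_normed_vector) \<Rightarrow> ('a \<Rightarrow> 'a \<Rightarrow> 'b) \<Rightarrow> bool" where
  "C1f S f f' \<longleftrightarrow> (\<forall>z\<in>S. (f has_derivative f' z) (at z within S)) \<and> (\<forall>v. continuous_on S (\<lambda>z. f' z v))"

lemma C1f_continuous_on: "C1f S f f' \<Longrightarrow> continuous_on S f"
  unfolding C1f_def by (rule has_derivative_continuous_on[of S f f']) auto

text \<open>On a finite-dimensional space, continuity in every direction is continuity in the
  operator norm.\<close>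

lemma C1f_Blinfun:
  fixes f :: "'a::euclidean_space \<Rightarrow> 'b::euclidean_space"
  assumes "C1f S f f'"
  shows "C1_on S f (\<lambda>z. Blinfun (f' z))" and "z \<in> S \<Longrightarrow> blinfun_apply (Blinfun (f' z)) = f' z"
proof -
  have 1: "blinfun_apply (Blinfun (f' z)) = f' z" if "z \<in> S" for z
    using assms that has_derivative_bounded_linear unfolding C1f_def
    by (intro bounded_linear_Blinfun_apply) auto
  then show "z \<in> S \<Longrightarrow> blinfun_apply (Blinfun (f' z)) = f' z" by simp
  have "continuous_on S (\<lambda>z. blinfun_apply (Blinfun (f' z)) v)" for v
    using assms unfolding C1f_def by (simp add: 1 cong: continuous_on_cong)
  then show "C1_on S f (\<lambda>z. Blinfun (f' z))"
    using assms unfolding C1_on_def C1f_def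
    by (auto simp: 1 intro: continuous_on_blinfun_componentwise)
qed

lemma C1_on_imp_C1f: "C1_on S f f' \<Longrightarrow> C1f S f (\<lambda>z. blinfun_apply (f' z))"
  unfolding C1_on_def C1f_def by (auto intro!: continuous_intros)

lemma C1_on_imp_C1f_apply:
  assumes "C1_on S f f'" shows "C1f S (\<lambda>z. blinfun_apply (f z) w) (\<lambda>z v. blinfun_apply (blinfun_apply (f' z) v) w)"
  using assms unfolding C1_on_def C1f_def
  by (auto intro!: continuous_intros derivative_eq_intros)

text \<open>The identity is required only at interior points, although the functions are C1 on the
  closed tube: for energy and momentum its derivation interchanges second derivatives.\<close>

definition conservation_law :: "real \<Rightarrow> real \<Rightarrow> (real \<Rightarrow> real^3) \<Rightarrow> real \<Rightarrow> (real \<times> (real^3) \<Rightarrow> real)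
    \<Rightarrow> (3 \<Rightarrow> real \<times> (real^3) \<Rightarrow> real) \<Rightarrow> (real \<times> (real^3) \<Rightarrow> real) \<Rightarrow> bool" where
  "conservation_law Tm Tp r R u V f \<longleftrightarrow> (\<exists>u' V'.
     C1f (Omega_hat Tm Tp r R) u u' \<and> (\<forall>i. C1f (Omega_hat Tm Tp r R) (V i) (V' i)) \<and>
     continuous_on (Omega_hat Tm Tp r R) f \<and>
     (\<forall>t x. Tm < t \<longrightarrow> t < Tp \<longrightarrow> dist (r t) x < R \<longrightarrow>
        u' (t, x) (1, 0) + (\<Sum>i\<in>UNIV. V' i (t, x) (0, axis i 1)) = f (t, x)))"

lemma conservation_law_balance:
  fixes u f H :: "real \<times> (real^3) \<Rightarrow> real" and V :: "3 \<Rightarrow> real \<times> (real^3) \<Rightarrow> real"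
  assumes law: "conservation_law Tm Tp r R u V f"
    and r: "\<And>t. t \<in> {Tm..Tp} \<Longrightarrow> (r has_vector_derivative r' t) (at t within {Tm..Tp})"
    and r': "continuous_on {Tm..Tp} r'" and R: "R > 0"
    and H: "continuous_on (Omega_hat Tm Tp r R) H"
    and dom: "\<And>z. z \<in> Omega_hat Tm Tp r R \<Longrightarrow> norm (\<chi> i. V i z - u z * r' (fst z) $ i) \<le> H z"
    and B: "\<And>t. t \<in> {Tm..Tp} \<Longrightarrow> sphere_integral (r t) R (\<lambda>x. H (t, x)) \<le> B"
    and st: "Tm \<le> s" "s \<le> t" "t \<le> Tp"
  shows "\<bar>integral (cball (r t) R) (\<lambda>x. u (t, x)) - integral (cball (r s) R) (\<lambda>x. u (s, x))
     - integral {s..t} (\<lambda>\<tau>. integral (cball (r \<tau>) R) (\<lambda>x. f (\<tau>, x)))\<bar> \<le> 8 * B * (t - s)"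
proof -
  obtain u' V' where u: "C1f (Omega_hat Tm Tp r R) u u'" and V: "\<And>i. C1f (Omega_hat Tm Tp r R) (V i) (V' i)"
    and f: "continuous_on (Omega_hat Tm Tp r R) f"
    and l: "\<And>t x. Tm < t \<Longrightarrow> t < Tp \<Longrightarrow> dist (r t) x < R \<Longrightarrow>
        u' (t, x) (1, 0) + (\<Sum>i\<in>UNIV. V' i (t, x) (0, axis i 1)) = f (t, x)"
    using law unfolding conservation_law_def by blast
  show ?thesis
  proof (rule balance_law[OF r r' R C1f_Blinfun(1)[OF u] C1f_Blinfun(1)[OF V] f H _ dom B st])
    fix t x assume *: "Tm < t" "t < Tp" "dist (r t) x < R"
    then have "(t, x) \<in> Omega_hat Tm Tp r R" by (simp add: mem_Omega_hat)
    then show "dt (\<lambda>z. Blinfun (u' z)) (t, x) + (\<Sum>i\<in>UNIV. dx (\<lambda>z. Blinfun (V' i z)) (t, x) i) = f (t, x)"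
      using l[OF *] by (simp add: dt_def dx_def C1f_Blinfun(2)[OF u] C1f_Blinfun(2)[OF V])
  qed
qed

text \<open>Product rule with the weight w_j = x_j - r_j(t): its time derivative is -r'_j and its
  i-th space derivative is 1 for i = j and 0 otherwise, so the law acquires the extra source V_j -
  r'_j u.\<close>

lemma conservation_law_moment:
  assumes law: "conservation_law Tm Tp r R u V f"
    and r: "\<And>t. t \<in> {Tm..Tp} \<Longrightarrow> (r has_vector_derivative r' t) (at t within {Tm..Tp})"
    and r': "continuous_on {Tm..Tp} r'"
  defines "w \<equiv> \<lambda>j z. snd z $ j - r (fst z) $ j"
  shows "conservation_law Tm Tp r R (\<lambda>z. w j z * u z) (\<lambda>i z. w j z * V i z)
    (\<lambda>z. w j z * f z - r' (fst z) $ j * u z + V j z)"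
proof -
  let ?S = "Omega_hat Tm Tp r R"
  obtain u' V' where u: "C1f ?S u u'" and V: "\<And>i. C1f ?S (V i) (V' i)"
    and f: "continuous_on ?S f"
    and l: "\<And>t x. Tm < t \<Longrightarrow> t < Tp \<Longrightarrow> dist (r t) x < R \<Longrightarrow>
        u' (t, x) (1, 0) + (\<Sum>i\<in>UNIV. V' i (t, x) (0, axis i 1)) = f (t, x)"
    using law unfolding conservation_law_def by blast
  have cu: "continuous_on ?S u" and cV: "continuous_on ?S (V i)" for i
    using C1f_continuous_on u V by auto
  have cr': "continuous_on ?S (\<lambda>z. r' (fst z))"
    by (rule continuous_on_compose2[OF r']) (auto intro!: continuous_intros simp: Omega_hat_def)
  have w: "C1f ?S (w j) (\<lambda>z v. snd v $ j - fst v * r' (fst z) $ j)"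
    unfolding C1f_def
  proof (intro conjI ballI allI)
    fix z assume z: "z \<in> ?S"
    have "(r has_derivative (\<lambda>h. h *\<^sub>R r' (fst z))) (at (fst z) within fst ` ?S)"
      by (rule has_derivative_subset[where s = "{Tm..Tp}"])
         (use z r[of "fst z"] in \<open>auto simp: has_vector_derivative_def Omega_hat_def\<close>)
    then have "((\<lambda>z. r (fst z)) has_derivative (\<lambda>v. fst v *\<^sub>R r' (fst z))) (at z within ?S)"
      by (rule has_derivative_in_compose[rotated]) (auto intro!: derivative_eq_intros)
    then have "((\<lambda>z. snd z - r (fst z)) has_derivative (\<lambda>v. snd v - fst v *\<^sub>R r' (fst z))) (at z within ?S)"
      by (auto intro!: derivative_eq_intros)
    from bounded_linear.has_derivative[OF bounded_linear_vec_nth[of j] this]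
    show "(w j has_derivative (\<lambda>v. snd v $ j - fst v * r' (fst z) $ j)) (at z within ?S)"
      by (simp add: w_def)
  next
    show "continuous_on ?S (\<lambda>z. snd v $ j - fst v * r' (fst z) $ j)" for v :: "real \<times> (real^3)"
      by (intro continuous_intros cr')
  qed
  have cw: "continuous_on ?S (w j)" by (rule C1f_continuous_on[OF w])
  have prod: "C1f ?S (\<lambda>z. w j z * g z) (\<lambda>z v. w j z * g' z v + (snd v $ j - fst v * r' (fst z) $ j) * g z)"
    if g: "C1f ?S g g'" for g g'
    using w g C1f_continuous_on[OF g] cw unfolding C1f_def
    by (auto intro!: derivative_eq_intros continuous_intros cr')
  define u2 where "u2 z v = w j z * u' z v + (snd v $ j - fst v * r' (fst z) $ j) * u z" for z v
  define V2 where "V2 i z v = w j z * V' i z v + (snd v $ j - fst v * r' (fst z) $ j) * V i z" for i z v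
  have "C1f ?S (\<lambda>z. w j z * u z) u2" "C1f ?S (\<lambda>z. w j z * V i z) (V2 i)" for i
    using prod[OF u] prod[OF V] by (simp_all add: u2_def[abs_def] V2_def[abs_def])
  moreover have "continuous_on ?S (\<lambda>z. w j z * f z - r' (fst z) $ j * u z + V j z)"
    by (intro continuous_intros cr' cu cV f cw)
  moreover have "u2 (t, x) (1, 0) + (\<Sum>i\<in>UNIV. V2 i (t, x) (0, axis i 1)) =
       w j (t, x) * f (t, x) - r' (fst (t, x)) $ j * u (t, x) + V j (t, x)"
    if *: "Tm < t" "t < Tp" "dist (r t) x < R" for t x
  proof -
    have "(\<Sum>i\<in>UNIV. axis i 1 $ j * V i (t, x)) = V j (t, x)"
      by (simp add: axis_def if_distrib[of "\<lambda>s. s * _"] cong: if_cong)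
    then show ?thesis
      by (simp add: u2_def V2_def l[OF *, symmetric] sum.distrib sum_distrib_left distrib_left)
  qed
  ultimately show ?thesis unfolding conservation_law_def by blast
qed

text \<open>Two applications of the mean value theorem, in direction \<open>v\<close> and then in
  direction \<open>w\<close>, write the second difference as h^2 times \<open>B\<close> at a point
  of the parallelogram, which shrinks to \<open>z\<close>, where \<open>B\<close> is
  continuous.\<close>

lemma second_difference_tendsto:
  fixes g A B :: "'a::real_normed_vector \<Rightarrow> real"
  assumes U: "open U" "z \<in> U"
    and A: "\<And>y. y \<in> U \<Longrightarrow> ((\<lambda>s. g (y + s *\<^sub>R v)) has_real_derivative A y) (at 0)"
    and B: "\<And>y. y \<in> U \<Longrightarrow> ((\<lambda>s. A (y + s *\<^sub>R w)) has_real_derivative B y) (at 0)"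
    and cB: "isCont B z"
  shows "((\<lambda>h. (g (z + h *\<^sub>R v + h *\<^sub>R w) - g (z + h *\<^sub>R v) - g (z + h *\<^sub>R w) + g z) / h\<^sup>2) \<longlongrightarrow> B z) (at_right 0)"
proof (rule tendstoI)
  fix e :: real assume e: "e > 0"
  obtain d1 where d1: "d1 > 0" "ball z d1 \<subseteq> U" using U openE by blast
  obtain d2 where d2: "d2 > 0" "\<And>y. dist y z < d2 \<Longrightarrow> dist (B y) (B z) < e"
    using cB e unfolding continuous_at_eps_delta by metis
  define d where "d = min d1 d2 / (norm v + norm w + 1)"
  have pos: "norm v + norm w + 1 > 0" by (smt (verit) norm_ge_zero)
  have d: "d > 0" using d1 d2 pos by (simp add: d_def)
  have near: "dist (z + s *\<^sub>R v + t *\<^sub>R w) z < min d1 d2" if "0 \<le> s" "s < d" "0 \<le> t" "t < d" for s t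
  proof -
    have "dist (z + s *\<^sub>R v + t *\<^sub>R w) z \<le> s * norm v + t * norm w"
      using norm_triangle_ineq[of "s *\<^sub>R v" "t *\<^sub>R w"] that by (simp add: dist_norm add.assoc)
    also have "\<dots> \<le> d * norm v + d * norm w" using that by (intro add_mono mult_right_mono) auto
    also have "\<dots> < d * (norm v + norm w + 1)" using d by (simp add: algebra_simps)
    also have "\<dots> = min d1 d2" using pos by (simp add: d_def)
    finally show ?thesis .
  qed
  have shift: "((\<lambda>s. k (y + s *\<^sub>R a)) has_real_derivative D) (at s0)"
    if "((\<lambda>s. k ((y + s0 *\<^sub>R a) + s *\<^sub>R a)) has_real_derivative D) (at 0)" for k :: "'a \<Rightarrow> real" and y a s0 D
  proof -
    have "((\<lambda>s. k (y + (s + s0) *\<^sub>R a)) has_real_derivative D) (at 0)"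
      using that by (simp add: scaleR_left_distrib add_ac)
    then show ?thesis using DERIV_shift[of "\<lambda>s. k (y + s *\<^sub>R a)" D 0 s0] by simp
  qed
  have main: "\<exists>s t. 0 \<le> s \<and> s < d \<and> 0 \<le> t \<and> t < d \<and>
      g (z + h *\<^sub>R v + h *\<^sub>R w) - g (z + h *\<^sub>R v) - g (z + h *\<^sub>R w) + g z = h\<^sup>2 * B (z + s *\<^sub>R v + t *\<^sub>R w)"
    if h: "0 < h" "h < d" for h
  proof -
    define p where "p s = g (z + h *\<^sub>R w + s *\<^sub>R v) - g (z + s *\<^sub>R v)" for s
    have "\<exists>s>0. s < h \<and> p h - p 0 = (h - 0) * (A (z + h *\<^sub>R w + s *\<^sub>R v) - A (z + s *\<^sub>R v))"
    proof (rule MVT2[OF h(1)])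
      fix s assume s: "0 \<le> s" "s \<le> h"
      have "z + h *\<^sub>R w + s *\<^sub>R v \<in> U" "z + s *\<^sub>R v \<in> U"
        using near[of s h] near[of s 0] s h d d1 by (auto simp: dist_commute add_ac intro!: subsetD[OF d1(2)])
      from DERIV_diff[OF shift[of g, OF A[OF this(1)]] shift[of g, OF A[OF this(2)]]]
      show "(p has_real_derivative A (z + h *\<^sub>R w + s *\<^sub>R v) - A (z + s *\<^sub>R v)) (at s)"
        by (simp only: p_def[abs_def])
    qed
    then obtain s where s: "0 < s" "s < h" "p h - p 0 = h * (A (z + h *\<^sub>R w + s *\<^sub>R v) - A (z + s *\<^sub>R v))" by auto
    have "\<exists>t>0. t < h \<and> A (z + s *\<^sub>R v + h *\<^sub>R w) - A (z + s *\<^sub>R v + 0 *\<^sub>R w) = (h - 0) * B (z + s *\<^sub>R v + t *\<^sub>R w)"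
    proof (rule MVT2[OF h(1)])
      fix t assume t: "0 \<le> t" "t \<le> h"
      have "z + s *\<^sub>R v + t *\<^sub>R w \<in> U"
        using near[of s t] s t h by (auto simp: dist_commute intro!: subsetD[OF d1(2)])
      from shift[of A, OF B[OF this]] show "((\<lambda>t. A (z + s *\<^sub>R v + t *\<^sub>R w)) has_real_derivative B (z + s *\<^sub>R v + t *\<^sub>R w)) (at t)"
        by simp
    qed
    then obtain t where t: "0 < t" "t < h" "A (z + s *\<^sub>R v + h *\<^sub>R w) - A (z + s *\<^sub>R v) = h * B (z + s *\<^sub>R v + t *\<^sub>R w)"
      by auto
    have "g (z + h *\<^sub>R v + h *\<^sub>R w) - g (z + h *\<^sub>R v) - g (z + h *\<^sub>R w) + g z = p h - p 0"
      by (simp add: p_def add_ac)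
    also have "\<dots> = h * (h * B (z + s *\<^sub>R v + t *\<^sub>R w))"
      using s(3) t(3) by (simp add: add_ac)
    finally show ?thesis using s t h by (intro exI[of _ s] exI[of _ t]) (auto simp: power2_eq_square)
  qed
  have "dist ((g (z + h *\<^sub>R v + h *\<^sub>R w) - g (z + h *\<^sub>R v) - g (z + h *\<^sub>R w) + g z) / h\<^sup>2) (B z) < e"
    if h: "0 < h" "h < d" for h
  proof -
    obtain s t where st: "0 \<le> s" "s < d" "0 \<le> t" "t < d"
      "g (z + h *\<^sub>R v + h *\<^sub>R w) - g (z + h *\<^sub>R v) - g (z + h *\<^sub>R w) + g z = h\<^sup>2 * B (z + s *\<^sub>R v + t *\<^sub>R w)"
      using main[OF h] by blast
    then show ?thesis using near[of s t] d2 h by simp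
  qed
  then show "\<forall>\<^sub>F h in at_right 0. dist ((g (z + h *\<^sub>R v + h *\<^sub>R w) - g (z + h *\<^sub>R v) - g (z + h *\<^sub>R w) + g z) / h\<^sup>2) (B z) < e"
    using d unfolding eventually_at_right_field by auto
qed

text \<open>The second difference is symmetric in \<open>v\<close> and \<open>w\<close>, so its two
  limits agree. Components along basis vectors are taken because the mean value theorem is for real
  functions.\<close>

lemma second_derivative_symmetric:
  fixes f :: "'a::real_normed_vector \<Rightarrow> 'b::euclidean_space"
  assumes C2: "C2_on S f f' f''" and U: "open U" "U \<subseteq> S" "z \<in> U"
  shows "blinfun_apply (blinfun_apply (f'' z) v) w = blinfun_apply (blinfun_apply (f'' z) w) v"
proof (rule euclidean_eqI)
  fix b :: 'b assume b: "b \<in> Basis"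
  have der: "(f has_derivative f' y) (at y)" "(f' has_derivative f'' y) (at y)" if "y \<in> U" for y
  proof -
    have "y \<in> S" "at y within S = at y" using that U at_within_open_subset[OF that U(1,2)] by auto
    then show "(f has_derivative f' y) (at y)" "(f' has_derivative f'' y) (at y)"
      using C2 unfolding C2_on_def C1_on_def by metis+
  qed
  have cont: "isCont f'' z"
    using C2 U continuous_on_interior[of S f'' z] interior_maximal[OF U(2,1)] by (auto simp: C2_on_def C1_on_def)
  have lim: "((\<lambda>h. (f (z + h *\<^sub>R v + h *\<^sub>R w) \<bullet> b - f (z + h *\<^sub>R v) \<bullet> b - f (z + h *\<^sub>R w) \<bullet> b + f z \<bullet> b) / h\<^sup>2)
     \<longlongrightarrow> blinfun_apply (blinfun_apply (f'' z) w) v \<bullet> b) (at_right 0)" for v w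
  proof (rule second_difference_tendsto[OF U(1,3), where A = "\<lambda>y. f' y v \<bullet> b"])
    fix y assume y: "y \<in> U"
    have line: "((\<lambda>s. y + s *\<^sub>R u) has_derivative (\<lambda>s. s *\<^sub>R u)) (at 0)" for u
      by (auto intro!: derivative_eq_intros)
    have "((\<lambda>s. f (y + s *\<^sub>R v)) has_derivative (\<lambda>s. f' y (s *\<^sub>R v))) (at 0)"
      using has_derivative_compose[OF line, of f "f' y"] der[OF y] by simp
    then have "((\<lambda>s. f (y + s *\<^sub>R v) \<bullet> b) has_derivative (\<lambda>s. f' y (s *\<^sub>R v) \<bullet> b)) (at 0)"
      by (rule has_derivative_inner_left)
    then show "((\<lambda>s. f (y + s *\<^sub>R v) \<bullet> b) has_real_derivative f' y v \<bullet> b) (at 0)"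
      by (simp add: has_field_derivative_def blinfun.scaleR_right mult_commute_abs)
    have "((\<lambda>s. f' (y + s *\<^sub>R w)) has_derivative (\<lambda>s. f'' y (s *\<^sub>R w))) (at 0)"
      using has_derivative_compose[OF line, of f' "f'' y"] der[OF y] by simp
    then have "((\<lambda>s. f' (y + s *\<^sub>R w) v \<bullet> b) has_derivative (\<lambda>s. f'' y (s *\<^sub>R w) v \<bullet> b)) (at 0)"
      by (auto intro!: derivative_eq_intros)
    then show "((\<lambda>s. f' (y + s *\<^sub>R w) v \<bullet> b) has_real_derivative f'' y w v \<bullet> b) (at 0)"
      by (simp add: has_field_derivative_def blinfun.scaleR_right blinfun.scaleR_left mult_commute_abs)
  next
    show "isCont (\<lambda>y. f'' y w v \<bullet> b) z" by (intro continuous_intros cont)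
  qed
  have eq: "(\<lambda>h. (f (z + h *\<^sub>R v + h *\<^sub>R w) \<bullet> b - f (z + h *\<^sub>R v) \<bullet> b - f (z + h *\<^sub>R w) \<bullet> b + f z \<bullet> b) / h\<^sup>2) =
    (\<lambda>h. (f (z + h *\<^sub>R w + h *\<^sub>R v) \<bullet> b - f (z + h *\<^sub>R w) \<bullet> b - f (z + h *\<^sub>R v) \<bullet> b + f z \<bullet> b) / h\<^sup>2)"
    by (rule ext) (simp add: algebra_simps)
  show "blinfun_apply (blinfun_apply (f'' z) v) w \<bullet> b = blinfun_apply (blinfun_apply (f'' z) w) v \<bullet> b"
    using tendsto_unique[OF trivial_limit_at_right_real lim[of w v] lim[of v w, unfolded eq]] .
qed

text \<open>Continuity of \<open>r\<close> is given only on the closed interval, so the set is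
  obtained as a preimage within the open strip.\<close>

lemma open_tube:
  fixes r :: "real \<Rightarrow> real^3"
  assumes "continuous_on {Tm..Tp} r"
  shows "open {(t, x). Tm < t \<and> t < Tp \<and> dist (r t) x < R}"
proof -
  have "open ({z \<in> {Tm<..<Tp} \<times> UNIV. dist (r (fst z)) (snd z) < R})"
  proof -
    have "continuous_on ({Tm<..<Tp} \<times> UNIV) (\<lambda>z. dist (r (fst z)) (snd z))"
      by (intro continuous_intros continuous_on_compose2[OF assms]) auto
    then have "open ((\<lambda>z. dist (r (fst z)) (snd z)) -` {..<R} \<inter> ({Tm<..<Tp} \<times> UNIV))"
      by (intro continuous_on_open_vimage[THEN iffD1, rule_format] open_Times) auto
    moreover have "(\<lambda>z. dist (r (fst z)) (snd z)) -` {..<R} \<inter> ({Tm<..<Tp} \<times> UNIV) = {z \<in> {Tm<..<Tp} \<times> UNIV. dist (r (fst z)) (snd z) < R}"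
      by auto
    ultimately show ?thesis by simp
  qed
  moreover have "{z \<in> {Tm<..<Tp} \<times> UNIV. dist (r (fst z)) (snd z) < R} = {(t, x). Tm < t \<and> t < Tp \<and> dist (r t) x < R}"
    by auto
  ultimately show ?thesis by simp
qed

section \<open>Conservation laws of the Klein-Gordon equation\<close>

lemma C1f_linear:
  assumes "bounded_linear L" "C1f S f f'"
  shows "C1f S (\<lambda>z. L (f z)) (\<lambda>z v. L (f' z v))"
  using assms(2) unfolding C1f_def
  by (auto intro: bounded_linear.has_derivative[OF assms(1)] bounded_linear.continuous_on[OF assms(1)])

lemma C1f_bilinear:
  assumes "bounded_bilinear B" "C1f S f f'" "C1f S g g'"
  shows "C1f S (\<lambda>z. B (f z) (g z)) (\<lambda>z v. B (f z) (g' z v) + B (f' z v) (g z))"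
  unfolding C1f_def
proof (intro conjI ballI allI)
  show "continuous_on S (\<lambda>z. B (f z) (g' z v) + B (f' z v) (g z))" for v
    by (intro continuous_on_add bounded_bilinear.continuous_on[OF assms(1)]
        C1f_continuous_on[OF assms(2)] C1f_continuous_on[OF assms(3)])
      (use assms(2,3) in \<open>auto simp: C1f_def\<close>)
qed (use assms(2,3) in \<open>auto simp: C1f_def intro: bounded_bilinear.FDERIV[OF assms(1)]\<close>)

lemmas C1f_inner = C1f_bilinear[OF bounded_bilinear_inner]
lemmas C1f_scaleR = C1f_bilinear[OF bounded_bilinear_scaleR]
lemmas C1f_cmult = C1f_linear[OF bounded_linear_mult_right]

lemma C1f_add: "C1f S f f' \<Longrightarrow> C1f S g g' \<Longrightarrow> C1f S (\<lambda>z. f z + g z) (\<lambda>z v. f' z v + g' z v)"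
  unfolding C1f_def by (auto intro!: derivative_intros continuous_intros)

lemma C1f_diff: "C1f S f f' \<Longrightarrow> C1f S g g' \<Longrightarrow> C1f S (\<lambda>z. f z - g z) (\<lambda>z v. f' z v - g' z v)"
  unfolding C1f_def by (auto intro!: derivative_intros continuous_intros)

lemma C1f_sum: "(\<And>i. i \<in> I \<Longrightarrow> C1f S (f i) (f' i)) \<Longrightarrow> C1f S (\<lambda>z. \<Sum>i\<in>I. f i z) (\<lambda>z v. \<Sum>i\<in>I. f' i z v)"
  unfolding C1f_def by (auto intro!: derivative_intros continuous_intros)

section \<open>Regularity of the nonlinearity, including at zero\<close>

lemma loc_holder_continuous_on:
  assumes "loc_holder al f" "0 < al"
  shows "continuous_on UNIV f"
proof (rule continuous_at_imp_continuous_on, intro ballI)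
  fix x
  obtain L where L: "\<And>y z. y \<in> cball x 1 \<Longrightarrow> z \<in> cball x 1 \<Longrightarrow> dist (f y) (f z) \<le> L * dist y z powr al"
    using assms(1) bounded_cball unfolding loc_holder_def by metis
  have "((\<lambda>y. L * dist y x powr al) \<longlongrightarrow> L * dist x x powr al) (at x)"
    using assms(2) by (intro tendsto_intros tendsto_powr') auto
  then have lim: "((\<lambda>y. L * dist y x powr al) \<longlongrightarrow> 0) (at x)" by simp
  have "\<forall>\<^sub>F y in at x. dist y x < 1" unfolding eventually_at by (intro exI[of _ 1]) auto
  then have "\<forall>\<^sub>F y in at x. norm (dist (f y) (f x)) \<le> L * dist y x powr al"
    by eventually_elim (auto intro!: L simp: dist_commute)
  then have "((\<lambda>y. dist (f y) (f x)) \<longlongrightarrow> 0) (at x)" using lim by (rule Lim_null_comparison)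
  then show "isCont f x" unfolding isCont_def tendsto_dist_iff[of f] .
qed

text \<open>Away from 0 this is the chain rule. At 0 the function \<open>G1\<close> itself may fail
  to be differentiable, but the growth bound with exponent 1 + 1/2 makes the composed function
  o(|w|), so its derivative there is 0. The exponent 1/2 is an arbitrary choice in (0, 1).\<close>

lemma G1_cmod_has_derivative:
  assumes adm: "admissible_G1 G1 G1'"
  defines "N \<equiv> \<lambda>w::complex. if w = 0 then 0 else complex_of_real (G1' ((cmod w)\<^sup>2)) * w"
  shows "((\<lambda>w. G1 ((cmod w)\<^sup>2)) has_derivative (\<lambda>v. 2 * (N w \<bullet> v))) (at w)"
    and "continuous_on UNIV N"
proof -
  have half: "loc_holder (1/2) N" "\<exists>C. \<forall>w::complex. cmod w \<le> 1 \<longrightarrow> \<bar>G1 ((cmod w)\<^sup>2)\<bar> \<le> C * (cmod w) powr (1 + 1/2)"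
    using adm unfolding admissible_G1_def N_def
    by (metis (no_types, lifting) half_gt_zero_iff zero_less_one field_sum_of_halves less_add_same_cancel1)+
  show "continuous_on UNIV N" by (rule loc_holder_continuous_on[OF half(1)]) simp
  show "((\<lambda>w. G1 ((cmod w)\<^sup>2)) has_derivative (\<lambda>v. 2 * (N w \<bullet> v))) (at w)"
  proof (cases "w = 0")
    case False
    have "((\<lambda>w::complex. (cmod w)\<^sup>2) has_derivative (\<lambda>v. 2 * (w \<bullet> v))) (at w)"
      unfolding power2_norm_eq_inner by (auto intro!: derivative_eq_intros simp: inner_commute)
    moreover have "(G1 has_derivative (*) (G1' ((cmod w)\<^sup>2))) (at ((cmod w)\<^sup>2))"
      using adm False unfolding admissible_G1_def has_field_derivative_def by simp
    ultimately have "((\<lambda>w. G1 ((cmod w)\<^sup>2)) has_derivative (\<lambda>v. G1' ((cmod w)\<^sup>2) * (2 * (w \<bullet> v)))) (at w)"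
      by (rule has_derivative_compose)
    moreover have "N w = G1' ((cmod w)\<^sup>2) *\<^sub>R w" using False by (simp add: N_def scaleR_conv_of_real)
    ultimately show ?thesis by (simp add: mult_ac)
  next
    case True
    obtain C where C: "\<And>w. cmod w \<le> 1 \<Longrightarrow> \<bar>G1 ((cmod w)\<^sup>2)\<bar> \<le> C * (cmod w) powr (1 + 1/2)" using half by blast
    have n0: "((\<lambda>h::complex. norm h) \<longlongrightarrow> 0) (at 0)"
      by (rule tendsto_norm_zero) (rule tendsto_ident_at)
    have "((\<lambda>h::complex. C * norm h powr (1/2)) \<longlongrightarrow> C * 0 powr (1/2)) (at 0)"
      by (intro tendsto_intros tendsto_powr' n0) auto
    then have lim: "((\<lambda>h::complex. C * norm h powr (1/2)) \<longlongrightarrow> 0) (at 0)" by simp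
    have G0: "G1 0 = 0" using adm by (simp add: admissible_G1_def)
    have "((\<lambda>h. norm (G1 ((cmod (0 + h))\<^sup>2) - G1 ((cmod 0)\<^sup>2) - 0) / norm h) \<longlongrightarrow> 0) (at 0)"
    proof (rule Lim_null_comparison[OF _ lim])
      have "\<forall>\<^sub>F h in at (0::complex). dist h 0 < 1 \<and> h \<noteq> 0" unfolding eventually_at by (intro exI[of _ 1]) auto
      then show "\<forall>\<^sub>F h in at 0. norm (norm (G1 ((cmod (0 + h))\<^sup>2) - G1 ((cmod 0)\<^sup>2) - 0) / norm h) \<le> C * norm h powr (1/2)"
      proof eventually_elim
        case (elim h)
        then have "\<bar>G1 ((cmod h)\<^sup>2)\<bar> \<le> C * (cmod h powr 1 * cmod h powr (1/2))"
          using C[of h] by (simp only: powr_add) auto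
        then show ?case using elim G0 by (simp add: field_simps)
      qed
    qed
    then have "((\<lambda>w. G1 ((cmod w)\<^sup>2)) has_derivative (\<lambda>_. 0)) (at 0)"
      by (simp add: has_derivative_at bounded_linear_zero)
    then show ?thesis using True by (simp add: N_def)
  qed
qed

lemma Ga_has_derivative:
  assumes adm: "admissible_G1 G1 G1'" and a: "a > 0"
  shows "((\<lambda>w. Ga G1 a ((cmod w)\<^sup>2)) has_derivative (\<lambda>v. 2 * (NL G1' a w \<bullet> v))) (at w)"
    and "continuous_on UNIV (NL G1' a)"
proof -
  \<comment> \<open>With b = a^(3/2) one has G_a(|w|^2) = G_1(|b w|^2) / a^5; differentiation brings
    in b twice, and b^2 / a^5 = 1 / a^2 is the factor in \<open>NL\<close>.\<close>
  define b where "b = sqrt (a ^ 3)"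
  have b: "b > 0" "b\<^sup>2 = a ^ 3" using a by (auto simp: b_def)
  define N where "N = (\<lambda>w::complex. if w = 0 then 0 else complex_of_real (G1' ((cmod w)\<^sup>2)) * w)"
  have eq: "NL G1' a w = (b / a ^ 5) *\<^sub>R N (b *\<^sub>R w)" for w
  proof (cases "w = 0")
    case False
    have "N (b *\<^sub>R w) = G1' (b\<^sup>2 * (cmod w)\<^sup>2) *\<^sub>R (b *\<^sub>R w)"
      using False b by (simp add: N_def scaleR_conv_of_real norm_mult power_mult_distrib)
    then have "(b / a ^ 5) *\<^sub>R N (b *\<^sub>R w) = (b\<^sup>2 / a ^ 5 * G1' (b\<^sup>2 * (cmod w)\<^sup>2)) *\<^sub>R w"
      by (simp add: power2_eq_square)
    also have "b\<^sup>2 / a ^ 5 = 1 / a\<^sup>2" using a b by (simp add: power_eq_if)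
    finally show ?thesis using False b by (simp add: NL_def scaleR_conv_of_real)
  qed (simp add: NL_def N_def)
  have "((\<lambda>w. G1 ((cmod (b *\<^sub>R w))\<^sup>2)) has_derivative (\<lambda>v. 2 * (N (b *\<^sub>R w) \<bullet> (b *\<^sub>R v)))) (at w)"
    unfolding N_def by (rule has_derivative_compose[OF _ G1_cmod_has_derivative(1)[OF adm]]) (auto intro!: derivative_eq_intros)
  then have "((\<lambda>w. G1 ((cmod (b *\<^sub>R w))\<^sup>2) * (1 / a ^ 5)) has_derivative (\<lambda>v. 2 * (N (b *\<^sub>R w) \<bullet> (b *\<^sub>R v)) * (1 / a ^ 5))) (at w)"
    by (rule has_derivative_mult_left)
  then show "((\<lambda>w. Ga G1 a ((cmod w)\<^sup>2)) has_derivative (\<lambda>v. 2 * (NL G1' a w \<bullet> v))) (at w)"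
    using b by (simp add: Ga_def eq power_mult_distrib)
  have "continuous_on UNIV N" unfolding N_def by (rule G1_cmod_has_derivative(2)[OF adm])
  then have "continuous_on UNIV (\<lambda>w. (b / a ^ 5) *\<^sub>R N (b *\<^sub>R w))"
    by (intro continuous_on_scaleR continuous_on_const continuous_on_id
        continuous_on_compose2[of UNIV N UNIV "\<lambda>w. b *\<^sub>R w"]) auto
  then show "continuous_on UNIV (NL G1' a)" by (simp add: eq[abs_def])
qed

lemma conservation_lawI:
  assumes "C1f (Omega_hat Tm Tp r R) u u'" "\<And>i. C1f (Omega_hat Tm Tp r R) (V i) (V' i)"
    "continuous_on (Omega_hat Tm Tp r R) f"
    "\<And>z. z \<in> {(t, x). Tm < t \<and> t < Tp \<and> dist (r t) x < R} \<Longrightarrow>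
        u' z (1, 0) + (\<Sum>i\<in>UNIV. V' i z (0, axis i 1)) = f z"
  shows "conservation_law Tm Tp r R u V f"
proof -
  have "u' (t, x) (1, 0) + (\<Sum>i\<in>UNIV. V' i (t, x) (0, axis i 1)) = f (t, x)"
    if "Tm < t" "t < Tp" "dist (r t) x < R" for t x
    by (rule assms(4)) (use that in simp)
  then have "C1f (Omega_hat Tm Tp r R) u u' \<and> (\<forall>i. C1f (Omega_hat Tm Tp r R) (V i) (V' i)) \<and>
     continuous_on (Omega_hat Tm Tp r R) f \<and>
     (\<forall>t x. Tm < t \<longrightarrow> t < Tp \<longrightarrow> dist (r t) x < R \<longrightarrow>
        u' (t, x) (1, 0) + (\<Sum>i\<in>UNIV. V' i (t, x) (0, axis i 1)) = f (t, x))"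
    using assms(1-3) by simp
  then show ?thesis unfolding conservation_law_def by (intro exI)
qed

text \<open>One member of the sequence with its index fixed; the balance laws are identities that
  hold for each solution separately.\<close>

locale KG_tube =
  fixes c m q chi a Tm Tp R :: real and r :: "real \<Rightarrow> real^3" and G1 G1' :: "real \<Rightarrow> real"
    and phi :: "real \<times> (real^3) \<Rightarrow> real"
    and Dphi :: "real \<times> (real^3) \<Rightarrow> (real \<times> (real^3)) \<Rightarrow>\<^sub>L real"
    and D2phi :: "real \<times> (real^3) \<Rightarrow> (real \<times> (real^3)) \<Rightarrow>\<^sub>L (real \<times> (real^3)) \<Rightarrow>\<^sub>L real"
    and psi :: "real \<times> (real^3) \<Rightarrow> complex"
    and Dpsi :: "real \<times> (real^3) \<Rightarrow> (real \<times> (real^3)) \<Rightarrow>\<^sub>L complex"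
    and D2psi :: "real \<times> (real^3) \<Rightarrow> (real \<times> (real^3)) \<Rightarrow>\<^sub>L (real \<times> (real^3)) \<Rightarrow>\<^sub>L complex"
  assumes c: "c > 0" and m: "m > 0" and chi: "chi > 0" and a: "a > 0" and R: "R > 0"
    and adm: "admissible_G1 G1 G1'"
    and cr: "continuous_on {Tm..Tp} r"
    and phi: "C2_on (Omega_hat Tm Tp r R) phi Dphi D2phi"
    and psi: "C2_on (Omega_hat Tm Tp r R) psi Dpsi D2psi"
    and KG: "\<And>z. z \<in> Omega_hat Tm Tp r R \<Longrightarrow> KG_at c m q G1' chi a phi Dphi psi Dpsi D2psi z"
begin

abbreviation "S \<equiv> Omega_hat Tm Tp r R"

text \<open>\<open>J\<close> is the current, \<open>P\<close> the momentum density and \<open>T\<close> the stress tensor; \<open>c\<^sup>2P\<close> is the energy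
  flux. \<open>A\<close> is the covariant time derivative, and a prime denotes the Frechet derivative.\<close>

definition "A z = cov_dt q chi (phi z) (dt Dpsi z) (psi z)"
definition "A' z v = D2psi z v (1, 0) + \<i> * ((q / chi) *\<^sub>R (phi z *\<^sub>R Dpsi z v + Dphi z v *\<^sub>R psi z))"
definition "J i z = chi * q / m * ((\<i> * psi z) \<bullet> dx Dpsi z i)"
definition "P i z = - (chi\<^sup>2 / (m * c\<^sup>2)) * (A z \<bullet> dx Dpsi z i)"
definition "pot z = Ga G1 a ((cmod (psi z))\<^sup>2)"
definition "grad2 z = (\<Sum>i\<in>UNIV. dx Dpsi z i \<bullet> dx Dpsi z i)"
text \<open>The factor \<open>chi\<^sup>2 / (2 * m)\<close> turns this into the Lagrangian density,
  which is the diagonal term in the stress tensor \<open>T\<close>.\<close>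

definition "Lag z = 1 / c\<^sup>2 * (A z \<bullet> A z) - grad2 z - pot z - (m * c / chi)\<^sup>2 * (psi z \<bullet> psi z)"
definition "T j i z = chi\<^sup>2 / m * (dx Dpsi z i \<bullet> dx Dpsi z j) + (if i = j then 1 else 0) * (chi\<^sup>2 / (2 * m)) * Lag z"

abbreviation "rho \<equiv> rho_dens c m q chi phi psi Dpsi"
abbreviation "Ed \<equiv> energy_dens c m q G1 chi a phi psi Dpsi"

lemma rho_eq: "rho z = - (chi * q / (m * c\<^sup>2)) * ((\<i> * psi z) \<bullet> A z)"
  by (simp add: rho_dens_def A_def inner_complex_def)

lemma Ed_eq: "Ed z = chi\<^sup>2 / (2 * m) * (1 / c\<^sup>2 * (A z \<bullet> A z) + grad2 z + pot z + (m * c / chi)\<^sup>2 * (psi z \<bullet> psi z))"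
  by (simp add: energy_dens_def A_def grad2_def pot_def power2_norm_eq_inner)

section \<open>Derivatives of the densities and fluxes\<close>

lemma C1f_psi: "C1f S psi (\<lambda>z. Dpsi z)" and C1f_phi: "C1f S phi (\<lambda>z. Dphi z)"
  using psi phi C1_on_imp_C1f unfolding C2_on_def by blast+

lemma C1f_Dpsi: "C1f S (\<lambda>z. Dpsi z w) (\<lambda>z v. D2psi z v w)"
  using psi C1_on_imp_C1f_apply unfolding C2_on_def by blast

lemma C1f_dx: "C1f S (\<lambda>z. dx Dpsi z i) (\<lambda>z v. D2psi z v (0, axis i 1))"
  unfolding dx_def by (rule C1f_Dpsi)

lemma cont_Dphi: "continuous_on S (\<lambda>z. dx Dphi z i)"
  using phi unfolding C2_on_def C1_on_def dx_def by (auto intro!: continuous_intros)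

lemma C1f_A: "C1f S A A'"
proof -
  have "A = (\<lambda>z. Dpsi z (1, 0) + \<i> * ((q / chi) *\<^sub>R (phi z *\<^sub>R psi z)))"
    by (auto simp: A_def cov_dt_def dt_def scaleR_conv_of_real)
  moreover have "C1f S (\<lambda>z. Dpsi z (1, 0) + \<i> * ((q / chi) *\<^sub>R (phi z *\<^sub>R psi z))) A'"
    unfolding A'_def[abs_def]
    by (intro C1f_add C1f_Dpsi C1f_linear[OF bounded_linear_mult_right]
      C1f_linear[OF bounded_linear_scaleR_right] C1f_scaleR C1f_phi C1f_psi)
  ultimately show ?thesis by simp
qed

lemma C1f_pot: "C1f S pot (\<lambda>z v. 2 * (NL G1' a (psi z) \<bullet> Dpsi z v))"
  unfolding C1f_def
proof (intro conjI ballI allI)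
  fix z assume "z \<in> S"
  then have "(psi has_derivative Dpsi z) (at z within S)" using C1f_psi by (simp add: C1f_def)
  from has_derivative_compose[OF this Ga_has_derivative(1)[OF adm a]]
  show "(pot has_derivative (\<lambda>v. 2 * (NL G1' a (psi z) \<bullet> Dpsi z v))) (at z within S)"
    by (simp add: pot_def[abs_def])
next
  fix v
  have "continuous_on S (\<lambda>z. Dpsi z v)" using C1f_Dpsi C1f_continuous_on by blast
  then show "continuous_on S (\<lambda>z. 2 * (NL G1' a (psi z) \<bullet> Dpsi z v))"
    by (intro continuous_on_mult continuous_on_const continuous_on_inner
        continuous_on_compose2[OF Ga_has_derivative(2)[OF adm a]] C1f_continuous_on[OF C1f_psi]) auto
qed

lemma C1f_grad2: "C1f S grad2 (\<lambda>z v. \<Sum>i\<in>UNIV. dx Dpsi z i \<bullet> D2psi z v (0, axis i 1) + D2psi z v (0, axis i 1) \<bullet> dx Dpsi z i)"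
  unfolding grad2_def[abs_def] by (intro C1f_sum C1f_inner C1f_dx)

definition "Lag' z v = 1 / c\<^sup>2 * (A z \<bullet> A' z v + A' z v \<bullet> A z)
   - (\<Sum>i\<in>UNIV. dx Dpsi z i \<bullet> D2psi z v (0, axis i 1) + D2psi z v (0, axis i 1) \<bullet> dx Dpsi z i)
   - 2 * (NL G1' a (psi z) \<bullet> Dpsi z v) - (m * c / chi)\<^sup>2 * (psi z \<bullet> Dpsi z v + Dpsi z v \<bullet> psi z)"

lemma C1f_Lag: "C1f S Lag Lag'"
  unfolding Lag_def[abs_def] Lag'_def[abs_def]
  by (intro C1f_diff C1f_cmult C1f_inner C1f_A C1f_pot C1f_psi C1f_grad2)

lemma C1f_rho: "C1f S rho (\<lambda>z v. - (chi * q / (m * c\<^sup>2)) * ((\<i> * psi z) \<bullet> A' z v + (\<i> * Dpsi z v) \<bullet> A z))"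
  unfolding rho_eq[abs_def] by (intro C1f_cmult C1f_inner C1f_linear[OF bounded_linear_mult_right] C1f_A C1f_psi)

lemma C1f_J: "C1f S (J i) (\<lambda>z v. chi * q / m * ((\<i> * psi z) \<bullet> D2psi z v (0, axis i 1) + (\<i> * Dpsi z v) \<bullet> dx Dpsi z i))"
  unfolding J_def[abs_def] by (intro C1f_cmult C1f_inner C1f_linear[OF bounded_linear_mult_right] C1f_dx C1f_psi)

lemma C1f_P: "C1f S (P i) (\<lambda>z v. - (chi\<^sup>2 / (m * c\<^sup>2)) * (A z \<bullet> D2psi z v (0, axis i 1) + A' z v \<bullet> dx Dpsi z i))"
  unfolding P_def[abs_def] by (intro C1f_cmult C1f_inner C1f_A C1f_dx)

lemma C1f_Ed: "C1f S Ed (\<lambda>z v. chi\<^sup>2 / (2 * m) * (1 / c\<^sup>2 * (A z \<bullet> A' z v + A' z v \<bullet> A z)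
   + (\<Sum>i\<in>UNIV. dx Dpsi z i \<bullet> D2psi z v (0, axis i 1) + D2psi z v (0, axis i 1) \<bullet> dx Dpsi z i)
   + 2 * (NL G1' a (psi z) \<bullet> Dpsi z v) + (m * c / chi)\<^sup>2 * (psi z \<bullet> Dpsi z v + Dpsi z v \<bullet> psi z)))"
  unfolding Ed_eq[abs_def] by (intro C1f_add C1f_cmult C1f_inner C1f_A C1f_pot C1f_psi C1f_grad2)

lemma C1f_T: "C1f S (T j i) (\<lambda>z v. chi\<^sup>2 / m * (dx Dpsi z i \<bullet> D2psi z v (0, axis j 1) + D2psi z v (0, axis i 1) \<bullet> dx Dpsi z j)
   + (if i = j then 1 else 0) * (chi\<^sup>2 / (2 * m)) * Lag' z v)"
  unfolding T_def[abs_def] by (intro C1f_add C1f_cmult C1f_inner C1f_dx C1f_Lag)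

section \<open>The three balance identities\<close>

lemma D2_sym:
  assumes "z \<in> {(t, x). Tm < t \<and> t < Tp \<and> dist (r t) x < R}"
  shows "D2psi z v w = D2psi z w v"
  by (rule second_derivative_symmetric[OF psi open_tube[OF cr] _ assms]) (auto simp: mem_Omega_hat)

lemma interior_tube: "z \<in> {(t, x). Tm < t \<and> t < Tp \<and> dist (r t) x < R} \<Longrightarrow> z \<in> S"
  by (auto simp: mem_Omega_hat)

text \<open>The expanded second covariant derivative in \<open>KG_at\<close> regroups as the time
  derivative of \<open>A\<close> plus i theta A, theta = q phi / chi, so the equation can be solved
  for \<open>A' z (1, 0)\<close>. The three laws use the equation through this formula.\<close>

lemma KG_cov:
  assumes "z \<in> S"
  shows "A' z (1, 0) = c\<^sup>2 *\<^sub>R (lap D2psi z - NL G1' a (psi z) - (m * c / chi)\<^sup>2 *\<^sub>R psi z) - \<i> * ((q * phi z / chi) *\<^sub>R A z)"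
proof -
  define X where "X = A' z (1, 0) + \<i> * ((q * phi z / chi) *\<^sub>R A z)"
  have "- X / complex_of_real (c\<^sup>2) + lap D2psi z - NL G1' a (psi z) - complex_of_real ((m * c / chi)\<^sup>2) * psi z = 0"
    using KG[OF assms] unfolding KG_at_def Let_def
    by (simp add: X_def A'_def A_def cov_dt_def dtt_def dt_def scaleR_conv_of_real algebra_simps)
  then have "X = complex_of_real (c\<^sup>2) * (lap D2psi z - NL G1' a (psi z) - complex_of_real ((m * c / chi)\<^sup>2) * psi z)"
    using c by (simp add: field_simps)
  then show ?thesis by (simp add: X_def scaleR_conv_of_real algebra_simps)
qed

text \<open>Gauge invariance of the nonlinearity: a real multiple of psi is orthogonal to i psi,
  hence drops out of the charge balance.\<close>

lemma NL_real_multiple: "\<exists>k. NL G1' a w = k *\<^sub>R w"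
  by (rule exI[of _ "G1' (a ^ 3 * (cmod w)\<^sup>2) / a\<^sup>2"]) (simp add: NL_def scaleR_conv_of_real)

lemma Dpsi_t: "Dpsi z (1, 0) = A z - \<i> * ((q * phi z / chi) *\<^sub>R psi z)"
  by (simp add: A_def cov_dt_def dt_def scaleR_conv_of_real)

text \<open>Pairing the equation with i psi: the terms with theta cancel, and the mass term and the
  nonlinearity are orthogonal to i psi. What remains is the Laplacian paired with i psi, which is
  the divergence of the current up to a constant.\<close>

lemma charge_law: "conservation_law Tm Tp r R rho J (\<lambda>_. 0)"
proof (rule conservation_lawI[OF C1f_rho C1f_J])
  fix z assume z: "z \<in> {(t, x). Tm < t \<and> t < Tp \<and> dist (r t) x < R}"
  obtain k where k: "NL G1' a (psi z) = k *\<^sub>R psi z" using NL_real_multiple by blast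
  define th where "th = q * phi z / chi"
  define X where "X = lap D2psi z"
  have 1: "(\<Sum>i\<in>UNIV. chi * q / m * ((\<i> * psi z) \<bullet> D2psi z (0, axis i 1) (0, axis i 1) + (\<i> * Dpsi z (0, axis i 1)) \<bullet> dx Dpsi z i))
     = chi * q / m * ((\<i> * psi z) \<bullet> X)"
  proof -
    have "(\<i> * Dpsi z (0, axis i 1)) \<bullet> dx Dpsi z i = 0" for i by (simp add: dx_def inner_complex_def)
    then show ?thesis by (simp add: X_def lap_def inner_sum_right sum_distrib_left)
  qed
  have 2: "(\<i> * psi z) \<bullet> A' z (1, 0) + (\<i> * Dpsi z (1, 0)) \<bullet> A z = c\<^sup>2 * ((\<i> * psi z) \<bullet> X)"
    unfolding KG_cov[OF interior_tube[OF z]] Dpsi_t k X_def[symmetric] th_def[symmetric]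
    by (simp add: inner_complex_def algebra_simps)
  show "- (chi * q / (m * c\<^sup>2)) * ((\<i> * psi z) \<bullet> A' z (1, 0) + (\<i> * Dpsi z (1, 0)) \<bullet> A z) +
     (\<Sum>i\<in>UNIV. chi * q / m * ((\<i> * psi z) \<bullet> D2psi z (0, axis i 1) (0, axis i 1) + (\<i> * Dpsi z (0, axis i 1)) \<bullet> dx Dpsi z i)) = 0"
    unfolding 1 2 using c by simp
qed simp

lemma energy_law: "conservation_law Tm Tp r R Ed (\<lambda>i z. c\<^sup>2 * P i z) (\<lambda>z. - (\<Sum>i\<in>UNIV. dx Dphi z i * J i z))"
proof (rule conservation_lawI[OF C1f_Ed C1f_cmult[OF C1f_P]])
  show "continuous_on S (\<lambda>z. - (\<Sum>i\<in>UNIV. dx Dphi z i * J i z))"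
    by (intro continuous_intros cont_Dphi C1f_continuous_on[OF C1f_J])
  fix z assume z: "z \<in> {(t, x). Tm < t \<and> t < Tp \<and> dist (r t) x < R}"
  obtain k where k: "NL G1' a (psi z) = k *\<^sub>R psi z" using NL_real_multiple by blast
  define th K where "th = q * phi z / chi" and "K = (m * c / chi)\<^sup>2"
  define X where "X = lap D2psi z"
  define n where "n = chi\<^sup>2 / m"
  have n: "chi\<^sup>2 / (2 * m) = n / 2" "chi\<^sup>2 / (m * c\<^sup>2) = n / c\<^sup>2" by (auto simp: n_def)
  \<comment> \<open>Covariant time derivative and space derivative do not commute: the derivative of
    phi leaves a term with i psi, whose pairing with the gradient is the work term with
    \<open>J\<close>. The term with phi itself is orthogonal to the gradient.\<close>
  have 1: "c\<^sup>2 * (- (n / c\<^sup>2) * (A z \<bullet> D2psi z (0, axis i 1) (0, axis i 1) + A' z (0, axis i 1) \<bullet> dx Dpsi z i))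
     = - n * (A z \<bullet> D2psi z (0, axis i 1) (0, axis i 1)) - n * (D2psi z (1, 0) (0, axis i 1) \<bullet> dx Dpsi z i) - dx Dphi z i * J i z" for i
  proof -
    have "A' z (0, axis i 1) \<bullet> dx Dpsi z i = D2psi z (1, 0) (0, axis i 1) \<bullet> dx Dpsi z i
       + (q / chi * dx Dphi z i) * ((\<i> * psi z) \<bullet> dx Dpsi z i)"
      unfolding A'_def D2_sym[OF z, of "(0, axis i 1)"] dx_def by (simp add: inner_complex_def algebra_simps)
    moreover have "n * (q / chi) = chi * q / m" using chi by (simp add: n_def power2_eq_square)
    then have "n * ((q / chi * dx Dphi z i) * ((\<i> * psi z) \<bullet> dx Dpsi z i)) = dx Dphi z i * J i z"
      unfolding J_def by (metis (no_types, opaque_lifting) mult.assoc mult.left_commute)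
    ultimately show ?thesis using c by (simp add: algebra_simps)
  qed
  have 2: "(\<Sum>i\<in>UNIV. A z \<bullet> D2psi z (0, axis i 1) (0, axis i 1)) = A z \<bullet> X"
    by (simp add: X_def lap_def inner_sum_right)
  \<comment> \<open>The equation paired with \<open>A\<close>: the theta terms in \<open>A'\<close>
    and in \<open>Dpsi\<close> drop out by orthogonality, so mass term and nonlinearity in the
    energy are compensated exactly.\<close>
  have 3: "(A z \<bullet> A' z (1, 0)) / c\<^sup>2 + NL G1' a (psi z) \<bullet> Dpsi z (1, 0) + K * (psi z \<bullet> Dpsi z (1, 0)) = A z \<bullet> X"
  proof -
    have "A z \<bullet> A' z (1, 0) = c\<^sup>2 * (A z \<bullet> (X - NL G1' a (psi z) - K *\<^sub>R psi z))"
      unfolding KG_cov[OF interior_tube[OF z]] k X_def[symmetric] K_def[symmetric] th_def[symmetric]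
      by (simp add: inner_complex_def algebra_simps)
    then have "(A z \<bullet> A' z (1, 0)) / c\<^sup>2 = A z \<bullet> (X - NL G1' a (psi z) - K *\<^sub>R psi z)" using c by simp
    then show ?thesis unfolding Dpsi_t k th_def[symmetric] by (simp add: inner_complex_def algebra_simps)
  qed
  show "chi\<^sup>2 / (2 * m) * (1 / c\<^sup>2 * (A z \<bullet> A' z (1, 0) + A' z (1, 0) \<bullet> A z)
   + (\<Sum>i\<in>UNIV. dx Dpsi z i \<bullet> D2psi z (1, 0) (0, axis i 1) + D2psi z (1, 0) (0, axis i 1) \<bullet> dx Dpsi z i)
   + 2 * (NL G1' a (psi z) \<bullet> Dpsi z (1, 0)) + (m * c / chi)\<^sup>2 * (psi z \<bullet> Dpsi z (1, 0) + Dpsi z (1, 0) \<bullet> psi z))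
   + (\<Sum>i\<in>UNIV. c\<^sup>2 * (- (chi\<^sup>2 / (m * c\<^sup>2)) * (A z \<bullet> D2psi z (0, axis i 1) (0, axis i 1) + A' z (0, axis i 1) \<bullet> dx Dpsi z i)))
   = - (\<Sum>i\<in>UNIV. dx Dphi z i * J i z)"
  proof -
    define D where "D = (\<Sum>i\<in>UNIV. D2psi z (1, 0) (0, axis i 1) \<bullet> dx Dpsi z i)"
    have a: "(\<Sum>i\<in>UNIV. dx Dpsi z i \<bullet> D2psi z (1, 0) (0, axis i 1) + D2psi z (1, 0) (0, axis i 1) \<bullet> dx Dpsi z i) = 2 * D"
      by (simp add: D_def inner_commute sum_distrib_left)
    have b: "(\<Sum>i\<in>UNIV. - n * (A z \<bullet> D2psi z (0, axis i 1) (0, axis i 1)) - n * (D2psi z (1, 0) (0, axis i 1) \<bullet> dx Dpsi z i) - dx Dphi z i * J i z)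
      = - n * (A z \<bullet> X) - n * D - (\<Sum>i\<in>UNIV. dx Dphi z i * J i z)"
      by (simp add: sum_subtractf sum_negf D_def flip: sum_distrib_left 2)
    have d: "1 / c\<^sup>2 * (A z \<bullet> A' z (1, 0) + A' z (1, 0) \<bullet> A z) + 2 * D + 2 * (NL G1' a (psi z) \<bullet> Dpsi z (1, 0)) + K * (psi z \<bullet> Dpsi z (1, 0) + Dpsi z (1, 0) \<bullet> psi z)
       = 2 * (A z \<bullet> X) + 2 * D"
      unfolding 3[symmetric] by (simp add: inner_commute[of _ "A z"] inner_commute[of _ "psi z"])
    show ?thesis
      unfolding n 1 b a K_def[symmetric] d by (simp add: algebra_simps)
  qed
qed

lemma momentum_law: "conservation_law Tm Tp r R (P j) (T j) (\<lambda>z. - rho z * dx Dphi z j)"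
proof (rule conservation_lawI[OF C1f_P C1f_T])
  show "continuous_on S (\<lambda>z. - rho z * dx Dphi z j)"
    by (intro continuous_intros cont_Dphi C1f_continuous_on[OF C1f_rho])
  fix z assume z: "z \<in> {(t, x). Tm < t \<and> t < Tp \<and> dist (r t) x < R}"
  obtain k where k: "NL G1' a (psi z) = k *\<^sub>R psi z" using NL_real_multiple by blast
  define th K where "th = q * phi z / chi" and "K = (m * c / chi)\<^sup>2"
  define X where "X = lap D2psi z"
  define n where "n = chi\<^sup>2 / m"
  define e where "e = (0::real, axis j 1 :: real^3)"
  have n: "chi\<^sup>2 / (2 * m) = n / 2" "chi\<^sup>2 / (m * c\<^sup>2) = n / c\<^sup>2" "chi\<^sup>2 / m = n" by (auto simp: n_def)
  define Y where "Y = (\<Sum>i\<in>UNIV. dx Dpsi z i \<bullet> D2psi z (0, axis i 1) e)"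
  have dxj: "dx Dpsi z j = Dpsi z e" by (simp add: dx_def e_def)
  have 1: "(\<Sum>i\<in>UNIV. n * (dx Dpsi z i \<bullet> D2psi z (0, axis i 1) e + D2psi z (0, axis i 1) (0, axis i 1) \<bullet> Dpsi z e)
     + (if i = j then 1 else 0) * (n / 2) * Lag' z (0, axis i 1)) = n * (Y + X \<bullet> Dpsi z e) + n / 2 * Lag' z e"
  proof -
    have "(\<Sum>i\<in>UNIV. (if i = j then 1 else 0) * (n / 2) * Lag' z (0, axis i 1)) = n / 2 * Lag' z e"
    proof -
      have "(\<Sum>i\<in>UNIV. (if i = j then 1 else 0) * (n / 2) * Lag' z (0, axis i 1)) =
        (\<Sum>i\<in>UNIV. if i = j then n / 2 * Lag' z (0, axis i 1) else 0)" by (rule sum.cong) auto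
      then show ?thesis by (simp only: sum.delta[OF finite] e_def) simp
    qed
    then show ?thesis
      by (simp add: sum.distrib distrib_left Y_def X_def lap_def inner_sum_left flip: sum_distrib_left)
  qed
  have 2: "Lag' z e = 2 * ((A z \<bullet> A' z e) / c\<^sup>2) - 2 * Y - 2 * ((NL G1' a (psi z) + K *\<^sub>R psi z) \<bullet> Dpsi z e)"
  proof -
    have "(\<Sum>i\<in>UNIV. dx Dpsi z i \<bullet> D2psi z e (0, axis i 1) + D2psi z e (0, axis i 1) \<bullet> dx Dpsi z i) = 2 * Y"
      by (simp add: D2_sym[OF z, of e] Y_def inner_commute[of _ "dx _ _ _"] sum_distrib_left)
    then show ?thesis
      unfolding Lag'_def K_def[symmetric]
      by (simp add: inner_commute[of _ "A z"] inner_commute[of _ "psi z"] inner_add_left algebra_simps)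
  qed
  have 3: "A' z e = D2psi z (1, 0) e + \<i> * (th *\<^sub>R Dpsi z e + (q / chi * dx Dphi z j) *\<^sub>R psi z)"
    unfolding A'_def D2_sym[OF z, of e] by (simp add: e_def dx_def th_def scaleR_right_distrib)
  have 4: "A' z (1, 0) = c\<^sup>2 *\<^sub>R (X - NL G1' a (psi z) - K *\<^sub>R psi z) - \<i> * (th *\<^sub>R A z)"
    unfolding KG_cov[OF interior_tube[OF z]] X_def K_def th_def ..
  define Z where "Z = X - NL G1' a (psi z) - K *\<^sub>R psi z"
  \<comment> \<open>The same commutator of covariant time and space derivatives, now paired with
    \<open>A\<close>, produces the charge density. The theta terms cancel, and the equation
    contributes only through \<open>Z\<close>.\<close>
  have 5: "A z \<bullet> A' z e - A z \<bullet> D2psi z (1, 0) e - A' z (1, 0) \<bullet> Dpsi z e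
    = (q / chi * dx Dphi z j) * ((\<i> * psi z) \<bullet> A z) - c\<^sup>2 * (Z \<bullet> Dpsi z e)"
    unfolding 3 4 Z_def[symmetric] by (simp add: inner_complex_def algebra_simps)
  have 6: "n / c\<^sup>2 * ((q / chi * dx Dphi z j) * ((\<i> * psi z) \<bullet> A z)) = - rho z * dx Dphi z j"
    using chi by (simp add: rho_eq n_def power2_eq_square)
  have "- (n / c\<^sup>2) * (A z \<bullet> D2psi z (1, 0) e + A' z (1, 0) \<bullet> Dpsi z e) + (n * (Y + X \<bullet> Dpsi z e) + n / 2 * Lag' z e)
     = n / c\<^sup>2 * (A z \<bullet> A' z e - A z \<bullet> D2psi z (1, 0) e - A' z (1, 0) \<bullet> Dpsi z e) + n * (Z \<bullet> Dpsi z e)"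
    unfolding 2 Z_def by (simp add: inner_diff_left inner_add_left algebra_simps)
  also have "\<dots> = - rho z * dx Dphi z j"
    unfolding 5 6[symmetric] using c by (simp add: right_diff_distrib)
  finally show "- (chi\<^sup>2 / (m * c\<^sup>2)) * (A z \<bullet> D2psi z (1, 0) (0, axis j 1) + A' z (1, 0) \<bullet> dx Dpsi z j)
    + (\<Sum>i\<in>UNIV. chi\<^sup>2 / m * (dx Dpsi z i \<bullet> D2psi z (0, axis i 1) (0, axis j 1) + D2psi z (0, axis i 1) (0, axis i 1) \<bullet> dx Dpsi z j)
      + (if i = j then 1 else 0) * (chi\<^sup>2 / (2 * m)) * Lag' z (0, axis i 1)) = - rho z * dx Dphi z j"
    unfolding n dxj e_def[symmetric] 1 .
qed

end

section \<open>Estimates for the restricted quantities\<close>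

lemma sphere_integral_cmult: "sphere_integral p R (\<lambda>x. k * h x) = k * sphere_integral p R h"
  unfolding sphere_integral_def by (simp add: case_prod_unfold mult.assoc)

text \<open>The Euclidean norm is bounded by the sum of the absolute components, hence the factor
  3.\<close>

lemma norm_flux_le:
  assumes "\<And>i. \<bar>V i\<bar> \<le> k" "\<bar>u\<bar> \<le> k" "norm v \<le> Cr" "0 \<le> k"
  shows "norm (\<chi> i. V i - u * v $ i :: real^3) \<le> 3 * (k * (1 + Cr))"
proof -
  have "\<bar>V i - u * v $ i\<bar> \<le> k * (1 + Cr)" for i
  proof -
    have "\<bar>u * v $ i\<bar> \<le> k * Cr"
      unfolding abs_mult using assms component_le_norm_cart[of v i] by (intro mult_mono) auto
    then show ?thesis using assms(1)[of i] by (simp add: distrib_left)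
  qed
  then have "(\<Sum>i\<in>UNIV. \<bar>(\<chi> i. V i - u * v $ i :: real^3) $ i\<bar>) \<le> (\<Sum>i\<in>(UNIV::3 set). k * (1 + Cr))"
    by (intro sum_mono) simp
  then show ?thesis using norm_le_l1_cart[of "\<chi> i. V i - u * v $ i :: real^3"] by simp
qed

lemma integral_compact_abs_le:
  fixes u h :: "'a::euclidean_space \<Rightarrow> real"
  assumes "compact S" "continuous_on S u" "continuous_on S h" "\<And>x. x \<in> S \<Longrightarrow> \<bar>u x\<bar> \<le> h x"
  shows "\<bar>integral S u\<bar> \<le> integral S h"
  using integral_norm_bound_integral[of u S h] integrable_on_compact assms by auto

text \<open>\<open>Cphi\<close>, \<open>Cr\<close> and \<open>CI\<close> are meant to be chosen
  independently of the index of the sequence; \<open>B\<close> (localization density on the sphere)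
  and \<open>del\<close> (distance of the gradient of phi from \<open>g\<close>) become small,
  together with \<open>R\<close>.\<close>

locale KG_tube_bounds = KG_tube +
  fixes r' g :: "real \<Rightarrow> real^3" and Cphi Cr CI B del :: real
  assumes r: "\<And>t. t \<in> {Tm..Tp} \<Longrightarrow> (r has_vector_derivative r' t) (at t within {Tm..Tp})"
    and cr': "continuous_on {Tm..Tp} r'" and cg: "continuous_on {Tm..Tp} g"
    and nonneg: "0 \<le> Cphi" "0 \<le> Cr" "0 \<le> CI" "0 \<le> B" "0 \<le> del"
    and r'_le: "\<And>t. t \<in> {Tm..Tp} \<Longrightarrow> norm (r' t) \<le> Cr"
    and phi_le: "\<And>z. z \<in> S \<Longrightarrow> \<bar>phi z\<bar> \<le> Cphi"
    and Dphi_le: "\<And>z i. z \<in> S \<Longrightarrow> \<bar>dx Dphi z i\<bar> \<le> Cphi"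
    and Dphi_g: "\<And>z i. z \<in> S \<Longrightarrow> \<bar>dx Dphi z i - g (fst z) $ i\<bar> \<le> del"
    and loc_le: "\<And>t. t \<in> {Tm..Tp} \<Longrightarrow> integral (cball (r t) R) (\<lambda>x. loc_dens c m G1 chi a psi Dpsi (t, x)) \<le> CI"
    and sph_le: "\<And>t. t \<in> {Tm..Tp} \<Longrightarrow> sphere_integral (r t) R (\<lambda>x. loc_dens c m G1 chi a psi Dpsi (t, x)) \<le> B"
begin

abbreviation "loc \<equiv> loc_dens c m G1 chi a psi Dpsi"

text \<open>With a_C = chi / (m c), the covariant time derivative satisfies a_C |A| \<le> al
  sqrt(loc). The summand \<open>c\<close> comes from the time derivative of psi, the other from the
  potential, where a_C / chi = 1 / (m c) cancels the small parameter.\<close>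

definition "al = c + \<bar>q\<bar> * Cphi / (m * c)"
text \<open>Sum of the coefficients in all the density bounds; doubling the last one leaves room for
  the stress tensor, which has an additional m c^2.\<close>

definition "K = \<bar>q\<bar> * al / c + c * \<bar>q\<bar> + m * al + m * c\<^sup>2 * al + 2 * (m * c\<^sup>2 * (al\<^sup>2 / c\<^sup>2 + 3))"

lemma al_pos: "al > 0"
  unfolding al_def using c m nonneg by (intro add_pos_nonneg) auto

lemma K_ge: "\<bar>q\<bar> * al / c \<le> K" "c * \<bar>q\<bar> \<le> K" "m * al \<le> K" "c\<^sup>2 * (m * al) \<le> K"
   "m * c\<^sup>2 * (al\<^sup>2 / c\<^sup>2 + 3) / 2 \<le> K" "m * c\<^sup>2 + m * c\<^sup>2 * (al\<^sup>2 / c\<^sup>2 + 3) / 2 \<le> K" "0 \<le> K"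
proof -
  define x1 x2 x3 x4 x5 where "x1 = \<bar>q\<bar> * al / c" and "x2 = c * \<bar>q\<bar>" and "x3 = m * al" and "x4 = m * c\<^sup>2 * al"
    and "x5 = m * c\<^sup>2 * (al\<^sup>2 / c\<^sup>2 + 3)"
  have *: "0 \<le> x1" "0 \<le> x2" "0 \<le> x3" "0 \<le> x4" "0 \<le> x5"
    using c m al_pos by (auto simp: x1_def x2_def x3_def x4_def x5_def)
  have 5: "m * c\<^sup>2 * 1 \<le> x5" unfolding x5_def using c m by (intro mult_left_mono) auto
  have K: "K = x1 + x2 + x3 + x4 + 2 * x5" by (simp add: K_def x1_def x2_def x3_def x4_def x5_def)
  show "\<bar>q\<bar> * al / c \<le> K" "c * \<bar>q\<bar> \<le> K" "m * al \<le> K" "0 \<le> K"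
    unfolding K x1_def[symmetric] x2_def[symmetric] x3_def[symmetric] using * by linarith+
  have "c\<^sup>2 * (m * al) = x4" by (simp add: x4_def)
  then show "c\<^sup>2 * (m * al) \<le> K" unfolding K using * by linarith
  show "m * c\<^sup>2 * (al\<^sup>2 / c\<^sup>2 + 3) / 2 \<le> K" "m * c\<^sup>2 + m * c\<^sup>2 * (al\<^sup>2 / c\<^sup>2 + 3) / 2 \<le> K"
    unfolding K x5_def[symmetric] using * 5 by linarith+
qed

lemma loc_nonneg: "0 \<le> loc z"
  unfolding loc_dens_def nabla0_sq_def by (intro add_nonneg_nonneg mult_nonneg_nonneg sum_nonneg) auto

lemma cont_loc: "continuous_on S loc"
proof -
  have "continuous_on S (\<lambda>z. (chi / (m * c))\<^sup>2 * ((cmod (Dpsi z (1, 0)))\<^sup>2 / c\<^sup>2 + (\<Sum>i\<in>UNIV. (cmod (dx Dpsi z i))\<^sup>2))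
    + (chi / (m * c))\<^sup>2 * \<bar>pot z\<bar> + (cmod (psi z))\<^sup>2)"
    using c by (intro continuous_on_add continuous_on_mult continuous_on_const continuous_on_divide continuous_on_power
        continuous_on_norm continuous_on_sum continuous_on_rabs C1f_continuous_on[OF C1f_Dpsi]
        C1f_continuous_on[OF C1f_dx] C1f_continuous_on[OF C1f_pot] C1f_continuous_on[OF C1f_psi]) auto
  then show ?thesis by (simp add: loc_dens_def[abs_def] nabla0_sq_def pot_def dt_def)
qed

text \<open>The densities consist of products of two of psi, a_C A and a_C times the gradient, and
  of the potential with weight a_C^2; the coefficients are free of chi because chi = m c a_C. Each
  factor of a product is at most a constant times the square root \<open>s\<close> of
  \<open>loc\<close>.\<close>

lemma density_le:
  assumes z: "z \<in> S"
  shows "\<bar>rho z\<bar> \<le> K * loc z" "\<bar>J i z\<bar> \<le> K * loc z" "\<bar>P i z\<bar> \<le> K * loc z" "\<bar>c\<^sup>2 * P i z\<bar> \<le> K * loc z"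
    "\<bar>Ed z\<bar> \<le> K * loc z" "\<bar>T j i z\<bar> \<le> K * loc z"
proof -
  define ac where "ac = chi / (m * c)"
  have ac: "ac > 0" using chi m c by (simp add: ac_def)
  define s where "s = sqrt (loc z)"
  have ss: "s * s = loc z" and s0: "0 \<le> s" using loc_nonneg by (auto simp: s_def)
  define n0 where "n0 = (cmod (dt Dpsi z))\<^sup>2 / c\<^sup>2"
  define nx where "nx = (\<Sum>i\<in>UNIV. (cmod (dx Dpsi z i))\<^sup>2)"
  have loc: "loc z = ac\<^sup>2 * n0 + ac\<^sup>2 * nx + ac\<^sup>2 * \<bar>pot z\<bar> + (cmod (psi z))\<^sup>2"
    by (simp add: loc_dens_def nabla0_sq_def ac_def n0_def nx_def pot_def distrib_left)
  have nn: "0 \<le> n0" "0 \<le> nx" by (auto simp: n0_def nx_def intro: sum_nonneg)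
  have nn': "0 \<le> ac\<^sup>2 * n0" "0 \<le> ac\<^sup>2 * nx" "0 \<le> ac\<^sup>2 * \<bar>pot z\<bar>" "0 \<le> (cmod (psi z))\<^sup>2" using nn by auto
  have psi_s: "cmod (psi z) \<le> s" unfolding s_def by (rule real_le_rsqrt) (use loc nn' in linarith)
  have dx_s: "ac * cmod (dx Dpsi z i) \<le> s" for i
  proof -
    have "(cmod (dx Dpsi z i))\<^sup>2 \<le> nx" unfolding nx_def by (rule member_le_sum) auto
    then have "ac\<^sup>2 * (cmod (dx Dpsi z i))\<^sup>2 \<le> ac\<^sup>2 * nx" by (rule mult_left_mono) simp
    then have "(ac * cmod (dx Dpsi z i))\<^sup>2 \<le> loc z" unfolding power_mult_distrib loc using nn' by linarith
    then show ?thesis unfolding s_def by (rule real_le_rsqrt)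
  qed
  have dt_s: "ac * cmod (dt Dpsi z) \<le> c * s"
  proof -
    have "(ac * cmod (dt Dpsi z) / c)\<^sup>2 = ac\<^sup>2 * n0" by (simp add: n0_def power_divide power_mult_distrib)
    then have "ac * cmod (dt Dpsi z) / c \<le> s" unfolding s_def by (intro real_le_rsqrt) (use loc nn' in linarith)
    then show ?thesis using c by (simp add: field_simps)
  qed
  have A_s: "ac * cmod (A z) \<le> al * s"
  proof -
    have "cmod (A z) \<le> cmod (dt Dpsi z) + cmod (\<i> * complex_of_real (q * phi z / chi) * psi z)"
      unfolding A_def cov_dt_def by (rule norm_triangle_ineq)
    also have "cmod (\<i> * complex_of_real (q * phi z / chi) * psi z) = \<bar>q\<bar> * \<bar>phi z\<bar> / chi * cmod (psi z)"
      using chi by (simp add: norm_mult norm_divide abs_mult)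
    finally have "ac * cmod (A z) \<le> ac * (cmod (dt Dpsi z) + \<bar>q\<bar> * \<bar>phi z\<bar> / chi * cmod (psi z))"
      using ac by (intro mult_left_mono) auto
    also have "\<dots> = ac * cmod (dt Dpsi z) + (ac / chi) * \<bar>q\<bar> * \<bar>phi z\<bar> * cmod (psi z)"
      by (simp add: algebra_simps)
    also have "ac / chi = 1 / (m * c)" using chi by (simp add: ac_def)
    also have "ac * cmod (dt Dpsi z) + 1 / (m * c) * \<bar>q\<bar> * \<bar>phi z\<bar> * cmod (psi z)
       \<le> c * s + 1 / (m * c) * \<bar>q\<bar> * Cphi * s"
      using phi_le[OF z] psi_s m c nonneg by (intro add_mono[OF dt_s] mult_mono) auto
    also have "\<dots> = al * s" by (simp add: al_def algebra_simps)
    finally show ?thesis .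
  qed
  have up: "k * loc z \<le> K * loc z" if "k \<le> K" for k
    using that loc_nonneg by (rule mult_right_mono)
  have rho: "\<bar>rho z\<bar> = \<bar>q\<bar> / c * \<bar>(\<i> * psi z) \<bullet> (ac *\<^sub>R A z)\<bar>"
    using chi m c by (simp add: rho_eq ac_def abs_mult power2_eq_square mult_ac)
  have "\<bar>(\<i> * psi z) \<bullet> (ac *\<^sub>R A z)\<bar> \<le> norm (\<i> * psi z) * norm (ac *\<^sub>R A z)" by (rule Cauchy_Schwarz_ineq2)
  also have "\<dots> \<le> s * (al * s)" using psi_s A_s s0 ac by (intro mult_mono) (auto simp: norm_mult)
  also have "\<dots> = al * loc z" by (simp add: mult_ac flip: ss)
  finally have "\<bar>rho z\<bar> \<le> \<bar>q\<bar> / c * (al * loc z)" unfolding rho using c by (intro mult_left_mono) auto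
  also have "\<dots> = \<bar>q\<bar> * al / c * loc z" by simp
  also have "\<dots> \<le> K * loc z" using K_ge al_pos c by (intro up) auto
  finally show "\<bar>rho z\<bar> \<le> K * loc z" .
  have J: "\<bar>J i z\<bar> = c * \<bar>q\<bar> * \<bar>(\<i> * psi z) \<bullet> (ac *\<^sub>R dx Dpsi z i)\<bar>"
    using chi m c by (simp add: J_def ac_def abs_mult)
  have "\<bar>(\<i> * psi z) \<bullet> (ac *\<^sub>R dx Dpsi z i)\<bar> \<le> norm (\<i> * psi z) * norm (ac *\<^sub>R dx Dpsi z i)" by (rule Cauchy_Schwarz_ineq2)
  also have "\<dots> \<le> s * s" using psi_s dx_s s0 ac by (intro mult_mono) (auto simp: norm_mult)
  finally have "\<bar>J i z\<bar> \<le> c * \<bar>q\<bar> * loc z" unfolding J ss using c by (intro mult_left_mono) auto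
  also have "\<dots> \<le> K * loc z" using K_ge c by (intro up) auto
  finally show "\<bar>J i z\<bar> \<le> K * loc z" .
  have P: "\<bar>P i z\<bar> = m * \<bar>(ac *\<^sub>R A z) \<bullet> (ac *\<^sub>R dx Dpsi z i)\<bar>"
    using chi m c by (simp add: P_def ac_def abs_mult power2_eq_square mult_ac)
  have "\<bar>(ac *\<^sub>R A z) \<bullet> (ac *\<^sub>R dx Dpsi z i)\<bar> \<le> norm (ac *\<^sub>R A z) * norm (ac *\<^sub>R dx Dpsi z i)" by (rule Cauchy_Schwarz_ineq2)
  also have "\<dots> \<le> al * s * s" using A_s dx_s s0 ac al_pos by (intro mult_mono) auto
  finally have P': "\<bar>P i z\<bar> \<le> m * (al * loc z)" unfolding P mult.assoc ss using m by (intro mult_left_mono) auto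
  also have "\<dots> \<le> K * loc z" unfolding mult.assoc[symmetric] using K_ge al_pos m by (intro up) auto
  finally show "\<bar>P i z\<bar> \<le> K * loc z" .
  have "\<bar>c\<^sup>2 * P i z\<bar> \<le> c\<^sup>2 * (m * (al * loc z))"
    unfolding abs_mult using P' by (simp add: mult_left_mono)
  also have "\<dots> \<le> K * loc z" unfolding mult.assoc[symmetric]
    using K_ge(4) al_pos m by (intro up) (auto simp: mult.assoc)
  finally show "\<bar>c\<^sup>2 * P i z\<bar> \<le> K * loc z" .
  have quad: "ac\<^sup>2 * (1 / c\<^sup>2 * (A z \<bullet> A z)) \<le> al\<^sup>2 / c\<^sup>2 * loc z"
    "ac\<^sup>2 * grad2 z \<le> loc z" "ac\<^sup>2 * \<bar>pot z\<bar> \<le> loc z" "ac\<^sup>2 * ((m * c / chi)\<^sup>2 * (psi z \<bullet> psi z)) \<le> loc z"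
  proof -
    have "(ac * cmod (A z))\<^sup>2 \<le> (al * s)\<^sup>2" using A_s ac by (intro power_mono) auto
    then have "ac\<^sup>2 * (A z \<bullet> A z) \<le> al\<^sup>2 * loc z"
      by (simp add: power_mult_distrib power2_norm_eq_inner) (simp add: power2_eq_square ss)
    then have "ac\<^sup>2 * (A z \<bullet> A z) / c\<^sup>2 \<le> al\<^sup>2 * loc z / c\<^sup>2" by (rule divide_right_mono) simp
    then show "ac\<^sup>2 * (1 / c\<^sup>2 * (A z \<bullet> A z)) \<le> al\<^sup>2 / c\<^sup>2 * loc z" by simp
    have "grad2 z = nx" by (simp add: grad2_def nx_def power2_norm_eq_inner)
    then show "ac\<^sup>2 * grad2 z \<le> loc z" using loc nn' by simp
    show "ac\<^sup>2 * \<bar>pot z\<bar> \<le> loc z" using loc nn' by linarith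
    have "ac\<^sup>2 * (m * c / chi)\<^sup>2 = 1" using chi m c by (simp add: ac_def flip: power_mult_distrib)
    then have "ac\<^sup>2 * ((m * c / chi)\<^sup>2 * (psi z \<bullet> psi z)) = (cmod (psi z))\<^sup>2"
      by (simp add: power2_norm_eq_inner flip: mult.assoc)
    then show "ac\<^sup>2 * ((m * c / chi)\<^sup>2 * (psi z \<bullet> psi z)) \<le> loc z" using loc nn' by linarith
  qed
  have pos: "0 \<le> ac\<^sup>2 * (1 / c\<^sup>2 * (A z \<bullet> A z))" "0 \<le> ac\<^sup>2 * grad2 z" "0 \<le> ac\<^sup>2 * ((m * c / chi)\<^sup>2 * (psi z \<bullet> psi z))"
    by (auto simp: grad2_def intro!: mult_nonneg_nonneg sum_nonneg)
  have pot: "\<bar>ac\<^sup>2 * pot z\<bar> = ac\<^sup>2 * \<bar>pot z\<bar>" by (simp add: abs_mult)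
  have coef: "chi\<^sup>2 / (2 * m) = m * c\<^sup>2 / 2 * ac\<^sup>2"
    using m c by (simp add: ac_def power2_eq_square)
  \<comment> \<open>The sign \<open>e\<close> treats the energy (+1) and the Lagrangian (-1) at
    once; the coefficient \<open>al\<^sup>2 / c\<^sup>2\<close> comes from \<open>A\<close>, each of
    the other three terms counts 1.\<close>
  have sum4: "\<bar>ac\<^sup>2 * (1 / c\<^sup>2 * (A z \<bullet> A z)) + e * (ac\<^sup>2 * grad2 z) + e * (ac\<^sup>2 * pot z) + e * (ac\<^sup>2 * ((m * c / chi)\<^sup>2 * (psi z \<bullet> psi z)))\<bar>
     \<le> (al\<^sup>2 / c\<^sup>2 + 3) * loc z" if "e = 1 \<or> e = -1" for e
  proof -
    have *: "\<bar>x1 + e * x2 + e * x3 + e * x4\<bar> \<le> u + 3 * l"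
      if "0 \<le> x1" "x1 \<le> u" "0 \<le> x2" "x2 \<le> l" "\<bar>x3\<bar> \<le> l" "0 \<le> x4" "x4 \<le> l" for x1 x2 x3 x4 u l :: real
      using that \<open>e = 1 \<or> e = -1\<close> by auto
    have "(al\<^sup>2 / c\<^sup>2 + 3) * loc z = al\<^sup>2 / c\<^sup>2 * loc z + 3 * loc z" by (simp add: distrib_right)
    then show ?thesis using *[OF pos(1) quad(1) pos(2) quad(2) _ pos(3) quad(4)] quad(3) pot by (simp only:)
  qed
  have Ed: "Ed z = m * c\<^sup>2 / 2 * (ac\<^sup>2 * (1 / c\<^sup>2 * (A z \<bullet> A z)) + 1 * (ac\<^sup>2 * grad2 z) + 1 * (ac\<^sup>2 * pot z) + 1 * (ac\<^sup>2 * ((m * c / chi)\<^sup>2 * (psi z \<bullet> psi z))))"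
    unfolding Ed_eq coef by (simp only: distrib_left mult.assoc mult_1)
  have "\<bar>Ed z\<bar> \<le> m * c\<^sup>2 / 2 * ((al\<^sup>2 / c\<^sup>2 + 3) * loc z)"
    unfolding Ed abs_mult[of "m * c\<^sup>2 / 2"] using m sum4[of 1] by (auto intro!: mult_mono)
  also have "\<dots> = m * c\<^sup>2 * (al\<^sup>2 / c\<^sup>2 + 3) / 2 * loc z" by simp
  also have "\<dots> \<le> K * loc z" using K_ge(5) m by (intro up) auto
  finally show "\<bar>Ed z\<bar> \<le> K * loc z" .
  have L: "chi\<^sup>2 / (2 * m) * Lag z = m * c\<^sup>2 / 2 * (ac\<^sup>2 * (1 / c\<^sup>2 * (A z \<bullet> A z)) + (-1) * (ac\<^sup>2 * grad2 z) + (-1) * (ac\<^sup>2 * pot z) + (-1) * (ac\<^sup>2 * ((m * c / chi)\<^sup>2 * (psi z \<bullet> psi z))))"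
    unfolding Lag_def coef by (simp add: algebra_simps)
  have L': "\<bar>chi\<^sup>2 / (2 * m) * Lag z\<bar> \<le> m * c\<^sup>2 / 2 * ((al\<^sup>2 / c\<^sup>2 + 3) * loc z)"
    unfolding L abs_mult[of "m * c\<^sup>2 / 2"] using m sum4[of "-1"] by (auto intro!: mult_mono)
  have D: "\<bar>chi\<^sup>2 / m * (dx Dpsi z i \<bullet> dx Dpsi z j)\<bar> \<le> m * c\<^sup>2 * loc z"
  proof -
    have eq: "chi\<^sup>2 / m * (dx Dpsi z i \<bullet> dx Dpsi z j) = m * c\<^sup>2 * ((ac *\<^sub>R dx Dpsi z i) \<bullet> (ac *\<^sub>R dx Dpsi z j))"
      using m c by (simp add: ac_def power2_eq_square)
    have "\<bar>(ac *\<^sub>R dx Dpsi z i) \<bullet> (ac *\<^sub>R dx Dpsi z j)\<bar> \<le> norm (ac *\<^sub>R dx Dpsi z i) * norm (ac *\<^sub>R dx Dpsi z j)"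
      by (rule Cauchy_Schwarz_ineq2)
    also have "\<dots> \<le> s * s" using dx_s s0 ac by (intro mult_mono) auto
    finally show ?thesis unfolding eq abs_mult[of "m * c\<^sup>2"] ss using m by (auto intro!: mult_mono)
  qed
  have "\<bar>T j i z\<bar> \<le> \<bar>chi\<^sup>2 / m * (dx Dpsi z i \<bullet> dx Dpsi z j)\<bar> + \<bar>chi\<^sup>2 / (2 * m) * Lag z\<bar>"
  proof -
    have "\<bar>x + (if b then 1 else 0) * u * v\<bar> \<le> \<bar>x\<bar> + \<bar>u * v\<bar>" for x u v :: real and b
      by (cases b) (simp_all add: abs_triangle_ineq)
    then show ?thesis unfolding T_def .
  qed
  also have "\<dots> \<le> m * c\<^sup>2 * loc z + m * c\<^sup>2 / 2 * ((al\<^sup>2 / c\<^sup>2 + 3) * loc z)" using D L' by (rule add_mono)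
  also have "\<dots> = (m * c\<^sup>2 + m * c\<^sup>2 * (al\<^sup>2 / c\<^sup>2 + 3) / 2) * loc z" by (simp add: distrib_right)
  also have "\<dots> \<le> K * loc z" using K_ge(6) m by (intro up) auto
  finally show "\<bar>T j i z\<bar> \<le> K * loc z" .
qed

section \<open>Balances of the restricted quantities\<close>

definition "bar u t = integral (cball (r t) R) (\<lambda>x. u (t, x) :: real)"

lemma continuous_on_bar: "continuous_on S u \<Longrightarrow> continuous_on {Tm..Tp} (bar u)"
  unfolding bar_def[abs_def] by (rule continuous_on_tube_integral[OF cr])

lemma bar_le:
  assumes "continuous_on S u" "\<And>z. z \<in> S \<Longrightarrow> \<bar>u z\<bar> \<le> k * loc z" "0 \<le> k" "t \<in> {Tm..Tp}"
  shows "\<bar>bar u t\<bar> \<le> k * CI"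
proof -
  have "\<bar>bar u t\<bar> \<le> integral (cball (r t) R) (\<lambda>x. k * loc (t, x))"
    unfolding bar_def using assms
    by (intro integral_compact_abs_le compact_cball continuous_on_tube_slice[OF assms(1)] continuous_on_mult
        continuous_on_const continuous_on_tube_slice[OF cont_loc]) (auto simp: mem_Omega_hat)
  also have "\<dots> = k * integral (cball (r t) R) (\<lambda>x. loc (t, x))" by simp
  also have "\<dots> \<le> k * CI" using assms loc_le by (intro mult_left_mono) auto
  finally show ?thesis .
qed

lemma bar_diff:
  assumes "continuous_on S u" "continuous_on S v" "t \<in> {Tm..Tp}"
  shows "bar (\<lambda>z. u z - v z) t = bar u t - bar v t"
  unfolding bar_def
  by (intro integral_diff integrable_on_compact compact_cball continuous_on_tube_slice[OF assms(1)]
     continuous_on_tube_slice[OF assms(2)] assms(3))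

lemma bar_mult: "bar (\<lambda>z. h (fst z) * u z) t = h t * bar u t"
  by (simp add: bar_def)

lemma integral_bar_diff_le:
  assumes u: "continuous_on S u" and v: "continuous_on S v"
    and le: "\<And>z. z \<in> S \<Longrightarrow> \<bar>u z - v z\<bar> \<le> k * loc z" and k: "0 \<le> k" and st: "Tm \<le> s" "s \<le> t" "t \<le> Tp"
  shows "\<bar>integral {s..t} (bar u) - integral {s..t} (bar v)\<bar> \<le> k * CI * (Tp - Tm)"
proof -
  have sub: "{s..t} \<subseteq> {Tm..Tp}" using st by auto
  have c: "continuous_on {s..t} (bar u)" "continuous_on {s..t} (bar v)"
    using continuous_on_bar u v sub continuous_on_subset by blast+
  have "integral {s..t} (bar u) - integral {s..t} (bar v) = integral {s..t} (\<lambda>\<tau>. bar u \<tau> - bar v \<tau>)"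
    by (intro integral_diff[symmetric] integrable_continuous_interval c)
  also have "\<bar>\<dots>\<bar> \<le> k * CI * integral {s..t} (\<lambda>_. 1)"
  proof (intro integral_const_bound compact_Icc continuous_on_diff c)
    fix \<tau> assume "\<tau> \<in> {s..t}"
    then have \<tau>: "\<tau> \<in> {Tm..Tp}" using sub by auto
    show "\<bar>bar u \<tau> - bar v \<tau>\<bar> \<le> k * CI"
      unfolding bar_diff[OF u v \<tau>, symmetric]
      by (rule bar_le[OF continuous_on_diff[OF u v] le k \<tau>])
  qed
  also have "\<dots> \<le> k * CI * (Tp - Tm)" using st k nonneg by (auto intro!: mult_left_mono)
  finally show ?thesis .
qed

text \<open>A multiple of \<open>loc\<close> serves as dominating density; 24 is 8 from the cutoff
  times 3 from the components of the flux.\<close>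

lemma balance:
  assumes law: "conservation_law Tm Tp r R u V f"
    and u: "\<And>z. z \<in> S \<Longrightarrow> \<bar>u z\<bar> \<le> k * loc z" and V: "\<And>i z. z \<in> S \<Longrightarrow> \<bar>V i z\<bar> \<le> k * loc z"
    and k: "0 \<le> k" and st: "Tm \<le> s" "s \<le> t" "t \<le> Tp"
  shows "\<bar>bar u t - bar u s - integral {s..t} (bar f)\<bar> \<le> 24 * (k * (1 + Cr)) * B * (Tp - Tm)"
proof -
  have "\<bar>bar u t - bar u s - integral {s..t} (bar f)\<bar> \<le> 8 * (3 * (k * (1 + Cr)) * B) * (t - s)"
    unfolding bar_def[abs_def]
  proof (rule conservation_law_balance[OF law r cr' R])
    show "continuous_on S (\<lambda>z. 3 * (k * (1 + Cr)) * loc z)"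
      by (intro continuous_on_mult continuous_on_const cont_loc)
    show "norm (\<chi> i. V i z - u z * r' (fst z) $ i) \<le> 3 * (k * (1 + Cr)) * loc z" if "z \<in> S" for z
    proof -
      have "norm (\<chi> i. V i z - u z * r' (fst z) $ i) \<le> 3 * (k * loc z * (1 + Cr))"
        using u[OF that] V[OF that] r'_le[of "fst z"] that k loc_nonneg[of z]
        by (intro norm_flux_le) (auto simp: Omega_hat_def)
      then show ?thesis by (simp only: mult_ac)
    qed
    show "sphere_integral (r t) R (\<lambda>x. 3 * (k * (1 + Cr)) * loc (t, x)) \<le> 3 * (k * (1 + Cr)) * B"
      if "t \<in> {Tm..Tp}" for t
      unfolding sphere_integral_cmult using sph_le[OF that] k nonneg by (intro mult_left_mono) auto
  qed (use st in auto)
  also have "\<dots> \<le> 8 * (3 * (k * (1 + Cr)) * B) * (Tp - Tm)"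
    using st k nonneg by (intro mult_left_mono) auto
  finally show ?thesis by simp
qed

text \<open>Common bound for all five estimates: flux through the sphere; replacement of the
  gradient of phi by \<open>g\<close>, in three components; and, with the factor \<open>R\<close>,
  the contributions of the moment balances, namely their flux, the moments at both end times and the
  weighted work.\<close>

definition "err = 24 * (K * (1 + Cr)) * B * (Tp - Tm) + 3 * (del * K) * CI * (Tp - Tm)
   + R * (24 * (K * (1 + Cr)) * B * (Tp - Tm) + 2 * (K * CI) + 3 * (Cphi * K) * CI * (Tp - Tm))"

lemma cont: "continuous_on S rho" "continuous_on S (J i)" "continuous_on S (P i)" "continuous_on S Ed"
  using C1f_continuous_on[OF C1f_rho] C1f_continuous_on[OF C1f_J] C1f_continuous_on[OF C1f_P]
    C1f_continuous_on[OF C1f_Ed] by auto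

lemma cont_fst: "continuous_on {Tm..Tp} h \<Longrightarrow> continuous_on S (\<lambda>z. h (fst z) $ j :: real)" for h :: "real \<Rightarrow> real^3"
  by (rule continuous_on_component[OF continuous_on_compose2[of "{Tm..Tp}" h S fst]])
    (auto simp: Omega_hat_def intro!: continuous_intros)

text \<open>The work in the third estimate still contains the currents; the fourth serves to
  eliminate them in the limit, and the fifth to express the momentum through the energy.\<close>

lemma estimates:
  assumes st: "Tm \<le> s" "s \<le> t" "t \<le> Tp"
  shows "\<bar>bar rho t - bar rho s\<bar> \<le> err"
    "\<bar>bar (P j) t - bar (P j) s + integral {s..t} (\<lambda>\<tau>. g \<tau> $ j * bar rho \<tau>)\<bar> \<le> err"
    "\<bar>bar Ed t - bar Ed s + integral {s..t} (\<lambda>\<tau>. \<Sum>i\<in>UNIV. g \<tau> $ i * bar (J i) \<tau>)\<bar> \<le> err"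
    "\<bar>integral {s..t} (\<lambda>\<tau>. bar (J j) \<tau> - r' \<tau> $ j * bar rho \<tau>)\<bar> \<le> err"
    "\<bar>integral {s..t} (\<lambda>\<tau>. c\<^sup>2 * bar (P j) \<tau> - r' \<tau> $ j * bar Ed \<tau>)\<bar> \<le> err"
proof -
  define D where "D = Tp - Tm"
  define e1 where "e1 = 24 * (K * (1 + Cr)) * B * D"
  define e2 where "e2 = del * K * CI * D"
  define e3 where "e3 = K * CI"
  define e4 where "e4 = 3 * (Cphi * K) * CI * D"
  have err: "err = e1 + 3 * e2 + R * (e1 + 2 * e3 + e4)"
    by (simp add: err_def e1_def e2_def e3_def e4_def D_def)
  have D: "0 \<le> D" using st by (simp add: D_def)
  have K: "0 \<le> K" by (rule K_ge)
  have nn: "0 \<le> e1" "0 \<le> e2" "0 \<le> R * e1" "0 \<le> R * e3" "0 \<le> R * e4"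
    using nonneg D K R by (auto simp: e1_def e2_def e3_def e4_def intro!: mult_nonneg_nonneg add_nonneg_nonneg)
  have errR: "err = e1 + 3 * e2 + R * e1 + 2 * (R * e3) + R * e4"
    unfolding err by (simp add: distrib_left)
  have sub: "{s..t} \<subseteq> {Tm..Tp}" using st by auto
  have zero: "bar (\<lambda>_. 0) = (\<lambda>_. 0)" by (auto simp: bar_def)
  have "\<bar>bar rho t - bar rho s\<bar> \<le> e1"
    using balance[OF charge_law density_le(1,2) K st] by (simp add: zero e1_def D_def)
  then show "\<bar>bar rho t - bar rho s\<bar> \<le> err" using nn unfolding errR by linarith
  let ?f = "\<lambda>z. - rho z * dx Dphi z j" and ?f2 = "\<lambda>z. - (g (fst z) $ j) * rho z"
  have "\<bar>bar (P j) t - bar (P j) s - integral {s..t} (bar ?f)\<bar> \<le> e1"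
    using balance[OF momentum_law[of j] density_le(3,6) K st] by (simp add: e1_def D_def)
  moreover have "\<bar>integral {s..t} (bar ?f) - integral {s..t} (bar ?f2)\<bar> \<le> e2"
    unfolding e2_def D_def
  proof (rule integral_bar_diff_le[OF _ _ _ _ st])
    show "\<bar>?f z - ?f2 z\<bar> \<le> del * K * loc z" if "z \<in> S" for z
    proof -
      have "?f z - ?f2 z = - ((dx Dphi z j - g (fst z) $ j) * rho z)" by (simp add: algebra_simps)
      then have "\<bar>?f z - ?f2 z\<bar> = \<bar>dx Dphi z j - g (fst z) $ j\<bar> * \<bar>rho z\<bar>" by (simp only: abs_minus_cancel abs_mult)
      also have "\<dots> \<le> del * (K * loc z)"
        using Dphi_g[OF that] density_le(1)[OF that] nonneg by (intro mult_mono) auto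
      finally show ?thesis by simp
    qed
  qed (use nonneg K in \<open>auto intro!: continuous_on_mult continuous_on_minus cont cont_Dphi cont_fst cg\<close>)
  moreover have "integral {s..t} (bar ?f2) = - integral {s..t} (\<lambda>\<tau>. g \<tau> $ j * bar rho \<tau>)"
  proof -
    have "bar ?f2 = (\<lambda>\<tau>. - (g \<tau> $ j) * bar rho \<tau>)"
      by (rule ext) (rule bar_mult[of "\<lambda>\<tau>. - (g \<tau> $ j)"])
    then show ?thesis by (simp only:) simp
  qed
  ultimately show "\<bar>bar (P j) t - bar (P j) s + integral {s..t} (\<lambda>\<tau>. g \<tau> $ j * bar rho \<tau>)\<bar> \<le> err"
    using nn unfolding errR by linarith
  let ?f = "\<lambda>z. - (\<Sum>i\<in>UNIV. dx Dphi z i * J i z)" and ?f2 = "\<lambda>z. - (\<Sum>i\<in>UNIV. g (fst z) $ i * J i z)"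
  have cf: "continuous_on S ?f"
    by (intro continuous_on_minus continuous_on_sum continuous_on_mult cont cont_Dphi)
  have cf2: "continuous_on S ?f2"
    by (intro continuous_on_minus continuous_on_sum continuous_on_mult cont cont_fst cg)
  have "\<bar>bar Ed t - bar Ed s - integral {s..t} (bar ?f)\<bar> \<le> e1"
    using balance[OF energy_law density_le(5,4) K st] by (simp add: e1_def D_def)
  moreover have "\<bar>integral {s..t} (bar ?f) - integral {s..t} (bar ?f2)\<bar> \<le> 3 * (del * K) * CI * (Tp - Tm)"
  proof (rule integral_bar_diff_le[OF cf cf2 _ _ st])
    show "\<bar>?f z - ?f2 z\<bar> \<le> 3 * (del * K) * loc z" if "z \<in> S" for z
    proof -
      have "?f z - ?f2 z = (\<Sum>i\<in>UNIV. - ((dx Dphi z i - g (fst z) $ i) * J i z))"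
        by (simp add: algebra_simps sum_subtractf)
      also have "\<bar>\<dots>\<bar> \<le> (\<Sum>i\<in>(UNIV::3 set). del * (K * loc z))"
      proof (rule order_trans[OF sum_abs], rule sum_mono)
        fix i
        show "\<bar>- ((dx Dphi z i - g (fst z) $ i) * J i z)\<bar> \<le> del * (K * loc z)"
          unfolding abs_minus_cancel abs_mult
          using Dphi_g[OF that] density_le(2)[OF that] nonneg by (intro mult_mono) auto
      qed
      finally show ?thesis by simp
    qed
  qed (use nonneg K in auto)
  moreover have "bar ?f2 \<tau> = - (\<Sum>i\<in>UNIV. g \<tau> $ i * bar (J i) \<tau>)" if "\<tau> \<in> {Tm..Tp}" for \<tau>
  proof -
    have "bar ?f2 \<tau> = - (\<Sum>i\<in>UNIV. integral (cball (r \<tau>) R) (\<lambda>x. g \<tau> $ i * J i (\<tau>, x)))"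
      unfolding bar_def fst_conv integral_neg
      by (subst integral_sum)
         (auto intro!: integrable_on_compact continuous_on_mult continuous_on_const continuous_on_tube_slice[OF cont(2)] that)
    then show ?thesis by (simp add: bar_def)
  qed
  then have "integral {s..t} (bar ?f2) = integral {s..t} (\<lambda>\<tau>. - (\<Sum>i\<in>UNIV. g \<tau> $ i * bar (J i) \<tau>))"
    using sub by (intro integral_cong) auto
  then have "integral {s..t} (bar ?f2) = - integral {s..t} (\<lambda>\<tau>. \<Sum>i\<in>UNIV. g \<tau> $ i * bar (J i) \<tau>)" by simp
  moreover have "3 * (del * K) * CI * (Tp - Tm) = 3 * e2" by (simp add: e2_def D_def)
  ultimately show "\<bar>bar Ed t - bar Ed s + integral {s..t} (\<lambda>\<tau>. \<Sum>i\<in>UNIV. g \<tau> $ i * bar (J i) \<tau>)\<bar> \<le> err"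
    using nn unfolding errR by linarith
  define w where "w z = snd z $ j - r (fst z) $ j" for z :: "real \<times> (real^3)"
  have w: "\<bar>w z\<bar> \<le> R" if "z \<in> S" for z
  proof -
    have "\<bar>w z\<bar> \<le> norm (snd z - r (fst z))" unfolding w_def using component_le_norm_cart[of "snd z - r (fst z)" j] by simp
    also have "\<dots> \<le> R" using that by (auto simp: Omega_hat_def dist_norm norm_minus_commute)
    finally show ?thesis .
  qed
  \<comment> \<open>The weight is at most \<open>R\<close> on the ball, so moment densities and
    their fluxes are dominated with the constant \<open>R * K\<close>; flux and end-point terms are
    the earlier ones times \<open>R\<close>.\<close>
  have wu: "\<bar>w z * u\<bar> \<le> R * K * loc z" if "z \<in> S" "\<bar>u\<bar> \<le> K * loc z" for z u
    unfolding abs_mult mult.assoc using w[OF that(1)] that(2) R by (intro mult_mono) auto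
  have cw: "continuous_on S w"
    unfolding w_def by (intro continuous_intros cont_fst cr)
  have RK: "0 \<le> R * K" using R K by simp
  have RKb: "24 * (R * K * (1 + Cr)) * B * (Tp - Tm) = R * e1" "R * K * CI = R * e3"
    by (simp_all add: e1_def e3_def D_def)
  have bw: "\<bar>bar (\<lambda>z. w z * u z) \<tau>\<bar> \<le> R * e3"
    if "continuous_on S u" "\<And>z. z \<in> S \<Longrightarrow> \<bar>u z\<bar> \<le> K * loc z" "\<tau> \<in> {Tm..Tp}" for u \<tau>
    unfolding RKb(2)[symmetric] using that wu by (intro bar_le[OF _ _ RK]) (auto intro!: continuous_on_mult cw)
  have tT: "s \<in> {Tm..Tp}" "t \<in> {Tm..Tp}" using st by auto
  let ?f = "\<lambda>z. w z * 0 - r' (fst z) $ j * rho z + J j z"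
  have "\<bar>bar (\<lambda>z. w z * rho z) t - bar (\<lambda>z. w z * rho z) s - integral {s..t} (bar ?f)\<bar> \<le> R * e1"
    unfolding RKb(1)[symmetric]
    by (rule balance[OF conservation_law_moment[where j = j, OF charge_law r cr', folded w_def] _ _ RK st])
       (use wu density_le in auto)
  moreover have "\<bar>bar (\<lambda>z. w z * rho z) t\<bar> \<le> R * e3" "\<bar>bar (\<lambda>z. w z * rho z) s\<bar> \<le> R * e3"
    using bw[OF cont(1) density_le(1)] tT by auto
  moreover have "continuous_on S (\<lambda>z. r' (fst z) $ j * rho z)"
    by (intro continuous_on_mult cont cont_fst cr')
  note bar_diff[OF cont(2)[of j] this]
  then have "bar ?f \<tau> = bar (J j) \<tau> - r' \<tau> $ j * bar rho \<tau>" if "\<tau> \<in> {Tm..Tp}" for \<tau>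
    using bar_mult[of "\<lambda>\<tau>. r' \<tau> $ j" rho \<tau>] that by simp
  then have "integral {s..t} (bar ?f) = integral {s..t} (\<lambda>\<tau>. bar (J j) \<tau> - r' \<tau> $ j * bar rho \<tau>)"
    using sub by (intro integral_cong) auto
  ultimately show "\<bar>integral {s..t} (\<lambda>\<tau>. bar (J j) \<tau> - r' \<tau> $ j * bar rho \<tau>)\<bar> \<le> err"
    using nn unfolding errR by linarith
  let ?S = "\<lambda>z. - (\<Sum>i\<in>UNIV. dx Dphi z i * J i z)"
  let ?f = "\<lambda>z. w z * ?S z - r' (fst z) $ j * Ed z + c\<^sup>2 * P j z"
  let ?f2 = "\<lambda>z. c\<^sup>2 * P j z - r' (fst z) $ j * Ed z"
  have "\<bar>bar (\<lambda>z. w z * Ed z) t - bar (\<lambda>z. w z * Ed z) s - integral {s..t} (bar ?f)\<bar> \<le> R * e1"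
    unfolding RKb(1)[symmetric]
    by (rule balance[OF conservation_law_moment[where j = j, OF energy_law r cr', folded w_def] _ _ RK st])
       (use wu density_le in auto)
  moreover have "\<bar>bar (\<lambda>z. w z * Ed z) t\<bar> \<le> R * e3" "\<bar>bar (\<lambda>z. w z * Ed z) s\<bar> \<le> R * e3"
    using bw[OF cont(4) density_le(5)] tT by auto
  moreover have cf2: "continuous_on S ?f2"
    by (intro continuous_on_diff continuous_on_mult continuous_on_const cont cont_fst cr')
  \<comment> \<open>The work of the currents is only bounded, not small, but here it is weighted by
    \<open>w\<close> and contributes at order \<open>R\<close>.\<close>
  moreover have "\<bar>integral {s..t} (bar ?f) - integral {s..t} (bar ?f2)\<bar> \<le> R * (3 * (Cphi * K)) * CI * (Tp - Tm)"
  proof (rule integral_bar_diff_le[OF _ cf2 _ _ st])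
    show "continuous_on S ?f"
      by (intro continuous_on_add continuous_on_diff continuous_on_mult continuous_on_const cont cont_fst cr' cw cf)
    show "\<bar>?f z - ?f2 z\<bar> \<le> R * (3 * (Cphi * K)) * loc z" if "z \<in> S" for z
    proof -
      have "\<bar>?S z\<bar> \<le> (\<Sum>i\<in>(UNIV::3 set). Cphi * (K * loc z))"
        unfolding abs_minus_cancel
      proof (rule order_trans[OF sum_abs], rule sum_mono)
        fix i
        show "\<bar>dx Dphi z i * J i z\<bar> \<le> Cphi * (K * loc z)"
          unfolding abs_mult using Dphi_le[OF that] density_le(2)[OF that] nonneg by (intro mult_mono) auto
      qed
      then have "\<bar>?S z\<bar> \<le> 3 * (Cphi * K) * loc z" by simp
      then have "\<bar>w z * ?S z\<bar> \<le> R * (3 * (Cphi * K) * loc z)"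
        unfolding abs_mult[of "w z"] using w[OF that] R by (intro mult_mono) auto
      then show ?thesis by simp
    qed
  qed (use nonneg K R in auto)
  moreover have "continuous_on S (\<lambda>z. c\<^sup>2 * P j z)" "continuous_on S (\<lambda>z. r' (fst z) $ j * Ed z)"
    by (intro continuous_on_mult continuous_on_const cont cont_fst cr')+
  note bar_diff[OF this]
  then have "bar ?f2 \<tau> = c\<^sup>2 * bar (P j) \<tau> - r' \<tau> $ j * bar Ed \<tau>" if "\<tau> \<in> {Tm..Tp}" for \<tau>
    using bar_mult[of "\<lambda>\<tau>. r' \<tau> $ j" Ed \<tau>] bar_mult[of "\<lambda>_. c\<^sup>2" "P j" \<tau>] that by simp
  then have "integral {s..t} (bar ?f2) = integral {s..t} (\<lambda>\<tau>. c\<^sup>2 * bar (P j) \<tau> - r' \<tau> $ j * bar Ed \<tau>)"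
    using sub by (intro integral_cong) auto
  moreover have "R * (3 * (Cphi * K)) * CI * (Tp - Tm) = R * e4" by (simp add: e4_def D_def)
  ultimately show "\<bar>integral {s..t} (\<lambda>\<tau>. c\<^sup>2 * bar (P j) \<tau> - r' \<tau> $ j * bar Ed \<tau>)\<bar> \<le> err"
    using nn unfolding errR by linarith
qed

end

section \<open>Passage to the limit\<close>

lemma uniform_limit_integral_from:
  fixes f :: "nat \<Rightarrow> real \<Rightarrow> real"
  assumes f: "\<And>n. continuous_on {a..b} (f n)" and ul: "uniform_limit {a..b} f l sequentially" and ab: "a \<le> b"
  shows "continuous_on {a..b} l"
    and "uniform_limit {a..b} (\<lambda>n t. integral {a..t} (f n)) (\<lambda>t. integral {a..t} l) sequentially"
proof -
  show l: "continuous_on {a..b} l"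
    using uniform_limit_theorem[OF _ ul] f by simp
  show "uniform_limit {a..b} (\<lambda>n t. integral {a..t} (f n)) (\<lambda>t. integral {a..t} l) sequentially"
  proof (rule uniform_limitI)
    fix e :: real assume e: "e > 0"
    define e' where "e' = e / (b - a + 1)"
    have e': "e' > 0" using e ab by (simp add: e'_def)
    from uniform_limitD[OF ul e']
    show "\<forall>\<^sub>F n in sequentially. \<forall>t\<in>{a..b}. dist (integral {a..t} (f n)) (integral {a..t} l) < e"
    proof eventually_elim
      case (elim n)
      show ?case
      proof
        fix t assume t: "t \<in> {a..b}"
        then have sub: "{a..t} \<subseteq> {a..b}" by auto
        have ii: "f n integrable_on {a..t}" "l integrable_on {a..t}"
          using continuous_on_subset[OF f sub] continuous_on_subset[OF l sub] by (auto intro: integrable_continuous_interval)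
        have "norm (integral {a..t} (\<lambda>s. f n s - l s)) \<le> integral {a..t} (\<lambda>_. e')"
          using elim sub by (intro integral_norm_bound_integral integrable_diff ii) (auto simp: dist_real_def less_imp_le subset_iff)
        then have "dist (integral {a..t} (f n)) (integral {a..t} l) \<le> e' * (t - a)"
          using t ii by (simp add: dist_real_def integral_diff mult.commute)
        also have "\<dots> \<le> e' * (b - a)" using t e' by (intro mult_left_mono) auto
        also have "\<dots> < e' * (b - a + 1)" using e' by simp
        also have "\<dots> = e" using ab by (simp add: e'_def)
        finally show "dist (integral {a..t} (f n)) (integral {a..t} l) < e" .
      qed
    qed
  qed
qed

lemma uniform_limit_mult_bounded:
  fixes f :: "nat \<Rightarrow> real \<Rightarrow> real"
  assumes h: "continuous_on {a..b} h" and ul: "uniform_limit {a..b} f l sequentially"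
  shows "uniform_limit {a..b} (\<lambda>n t. h t * f n t) (\<lambda>t. h t * l t) sequentially"
proof (rule uniform_limitI)
  fix e :: real assume e: "e > 0"
  have "bounded (h ` {a..b})" using compact_continuous_image[OF h] compact_imp_bounded by blast
  then obtain M where M: "M > 0" "\<And>t. t \<in> {a..b} \<Longrightarrow> \<bar>h t\<bar> \<le> M" unfolding bounded_pos by auto
  have "e / M > 0" using e M by simp
  from uniform_limitD[OF ul this]
  show "\<forall>\<^sub>F n in sequentially. \<forall>t\<in>{a..b}. dist (h t * f n t) (h t * l t) < e"
  proof eventually_elim
    case (elim n)
    show ?case
    proof
      fix t assume t: "t \<in> {a..b}"
      have "dist (h t * f n t) (h t * l t) = \<bar>h t\<bar> * dist (f n t) (l t)"
        by (simp add: dist_real_def abs_mult flip: right_diff_distrib)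
      also have "\<dots> \<le> M * dist (f n t) (l t)" using M t by (intro mult_right_mono) auto
      also have "\<dots> < M * (e / M)" using elim t M by (intro mult_strict_left_mono) auto
      finally show "dist (h t * f n t) (h t * l t) < e" using M by simp
    qed
  qed
qed

text \<open>Only the primitive of \<open>h\<close> is small, not \<open>h\<close> itself, so
  integration by parts puts the derivative on \<open>gg\<close>. The remainder \<open>Phi\<close>
  has derivative \<open>gg'\<close> times that primitive and is estimated through this derivative,
  so that \<open>gg'\<close> enters only by its bound.\<close>

lemma integral_mult_small:
  fixes h gg gg' :: "real \<Rightarrow> real"
  assumes g: "\<And>t. t \<in> {a..b} \<Longrightarrow> (gg has_real_derivative gg' t) (at t within {a..b})"
    and C: "\<And>t. t \<in> {a..b} \<Longrightarrow> \<bar>gg t\<bar> \<le> C \<and> \<bar>gg' t\<bar> \<le> C"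
    and h: "continuous_on {a..b} h" and e: "\<And>t. t \<in> {a..b} \<Longrightarrow> \<bar>integral {a..t} h\<bar> \<le> e"
    and t: "t \<in> {a..b}"
  shows "\<bar>integral {a..t} (\<lambda>s. gg s * h s)\<bar> \<le> C * e * (1 + (b - a))"
proof -
  have cg: "continuous_on {a..b} gg" by (rule DERIV_continuous_on[OF g])
  have C0: "0 \<le> C" and e0: "0 \<le> e" using C[OF t] e[OF t] by auto
  define A where "A t = integral {a..t} h" for t
  define Phi where "Phi t = gg t * A t - integral {a..t} (\<lambda>s. gg s * h s)" for t
  have dA: "(A has_real_derivative h s) (at s within {a..b})" if "s \<in> {a..b}" for s
    unfolding A_def using integral_has_real_derivative[OF h that] .
  have dI: "((\<lambda>t. integral {a..t} (\<lambda>s. gg s * h s)) has_real_derivative gg s * h s) (at s within {a..b})"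
    if "s \<in> {a..b}" for s
    by (rule integral_has_real_derivative[OF _ that]) (intro continuous_intros cg h)
  have "(Phi has_real_derivative gg' s * A s) (at s within {a..b})" if "s \<in> {a..b}" for s
    unfolding Phi_def using g[OF that] dA[OF that] dI[OF that] by (auto intro!: derivative_eq_intros)
  moreover have "norm (gg' s * A s) \<le> C * e" if "s \<in> {a..b}" for s
    using C[OF that] e[OF that] C0 by (auto simp: abs_mult A_def intro!: mult_mono)
  ultimately have "norm (Phi t - Phi a) \<le> C * e * norm (t - a)"
    using t by (intro field_differentiable_bound[of "{a..b}" Phi "\<lambda>s. gg' s * A s"]) auto
  also have "\<dots> \<le> C * e * (b - a)" using t C0 e0 by (intro mult_left_mono) auto
  finally have 1: "\<bar>Phi t\<bar> \<le> C * e * (b - a)" by (simp add: Phi_def A_def)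
  have 2: "\<bar>gg t * A t\<bar> \<le> C * e" using C[OF t] e[OF t] C0 by (auto simp: abs_mult A_def intro!: mult_mono)
  have "integral {a..t} (\<lambda>s. gg s * h s) = gg t * A t - Phi t" by (simp add: Phi_def)
  then show ?thesis using 1 2 by (simp add: algebra_simps)
qed

lemma oint_eq:
  assumes f: "continuous_on {a..b} f" and "s \<in> {a..b}" "t \<in> {a..b}"
  shows "oint s t f = integral {a..t} f - integral {a..s} f"
proof -
  have *: "integral {a..u} f + integral {u..v} f = integral {a..v} f" if "a \<le> u" "u \<le> v" "v \<le> b" for u v
    using that by (intro Henstock_Kurzweil_Integration.integral_combine integrable_continuous_interval continuous_on_subset[OF f]) auto
  show ?thesis using *[of s t] *[of t s] assms(2,3) by (auto simp: oint_def)
qed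

lemma uniform_limit_0I:
  fixes f :: "nat \<Rightarrow> 'a \<Rightarrow> real"
  assumes "\<And>e. e > 0 \<Longrightarrow> \<forall>\<^sub>F n in sequentially. \<forall>t\<in>X. \<bar>f n t\<bar> \<le> e"
  shows "uniform_limit X f (\<lambda>_. 0) sequentially"
proof (rule uniform_limitI)
  fix e :: real assume "e > 0"
  then have "e / 2 > 0" by simp
  from assms[OF this] show "\<forall>\<^sub>F n in sequentially. \<forall>t\<in>X. dist (f n t) 0 < e"
    by eventually_elim (use \<open>e > 0\<close> in force)
qed

text \<open>The limit passage concerns only functions of time; the field theory is condensed in the
  five estimates \<open>e1\<close> to \<open>e5\<close>. The lower bound \<open>c0\<close> makes the
  limit energy positive, which selects the root in the mass formula.\<close>

lemma limit_dynamics: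
  fixes rb Eb :: "nat \<Rightarrow> real \<Rightarrow> real" and Pb Jb :: "nat \<Rightarrow> 3 \<Rightarrow> real \<Rightarrow> real"
    and r' g g' :: "real \<Rightarrow> real^3"
  assumes c: "c > 0" and t0: "t0 \<in> {Tm..Tp}" and cr': "continuous_on {Tm..Tp} r'"
    and g: "\<And>t. t \<in> {Tm..Tp} \<Longrightarrow> (g has_vector_derivative g' t) (at t within {Tm..Tp})"
    and gC: "\<And>t. t \<in> {Tm..Tp} \<Longrightarrow> norm (g t) \<le> C \<and> norm (g' t) \<le> C"
    and crb: "\<And>n. continuous_on {Tm..Tp} (rb n)" and cEb: "\<And>n. continuous_on {Tm..Tp} (Eb n)"
    and cPb: "\<And>n j. continuous_on {Tm..Tp} (Pb n j)" and cJb: "\<And>n j. continuous_on {Tm..Tp} (Jb n j)"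
    and M: "\<forall>\<^sub>F n in sequentially. \<bar>rb n Tm\<bar> \<le> M"
    and E0: "(\<lambda>n. Eb n t0) \<longlonglongrightarrow> E0"
    and pos: "c0 > 0" "\<And>n t. n \<ge> n0 \<Longrightarrow> t \<in> {Tm..Tp} \<Longrightarrow> c0 \<le> Eb n t"
    and e1: "\<And>e. e > 0 \<Longrightarrow> \<forall>\<^sub>F n in sequentially. \<forall>t\<in>{Tm..Tp}. \<bar>rb n t - rb n Tm\<bar> \<le> e"
    and e2: "\<And>e j. e > 0 \<Longrightarrow> \<forall>\<^sub>F n in sequentially. \<forall>t\<in>{Tm..Tp}.
        \<bar>Pb n j t - Pb n j Tm + integral {Tm..t} (\<lambda>s. g s $ j * rb n s)\<bar> \<le> e"
    and e3: "\<And>e. e > 0 \<Longrightarrow> \<forall>\<^sub>F n in sequentially. \<forall>t\<in>{Tm..Tp}.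
        \<bar>Eb n t - Eb n Tm + integral {Tm..t} (\<lambda>s. \<Sum>i\<in>UNIV. g s $ i * Jb n i s)\<bar> \<le> e"
    and e4: "\<And>e j. e > 0 \<Longrightarrow> \<forall>\<^sub>F n in sequentially. \<forall>t\<in>{Tm..Tp}.
        \<bar>integral {Tm..t} (\<lambda>s. Jb n j s - r' s $ j * rb n s)\<bar> \<le> e"
    and e5: "\<And>e j. e > 0 \<Longrightarrow> \<forall>\<^sub>F n in sequentially. \<forall>t\<in>{Tm..Tp}.
        \<bar>integral {Tm..t} (\<lambda>s. c\<^sup>2 * Pb n j s - r' s $ j * Eb n s)\<bar> \<le> e"
  shows "\<exists>s rho_inf (E_inf :: real \<Rightarrow> real). strict_mono s \<and>
     uniform_limit {Tm..Tp} (\<lambda>k. rb (s k)) (\<lambda>t. rho_inf) sequentially \<and>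
     (\<forall>t\<in>{Tm..Tp}. (\<lambda>k. Eb (s k) t) \<longlonglongrightarrow> E_inf t) \<and>
     E_inf t0 = E0 \<and>
     (\<forall>t\<in>{Tm..Tp}. E_inf t = E_inf t0 - rho_inf * oint t0 t (\<lambda>t'. r' t' \<bullet> g t')) \<and>
     (\<forall>t\<in>{Tm..Tp}. ((\<lambda>t. (E_inf t / c\<^sup>2) *\<^sub>R r' t) has_vector_derivative (- rho_inf) *\<^sub>R g t)
                      (at t within {Tm..Tp})) \<and>
     ((\<forall>t\<in>{Tm..Tp}. norm (r' t) < c) \<longrightarrow>
        (\<exists>M0. \<forall>t\<in>{Tm..Tp}. E_inf t / c\<^sup>2 = (1 / sqrt (1 - (norm (r' t))\<^sup>2 / c\<^sup>2)) * M0))"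
proof -
  let ?X = "{Tm..Tp}"
  have T: "Tm \<le> Tp" using t0 by auto
  have Tm: "Tm \<in> ?X" using T by auto
  have cg: "continuous_on ?X g"
    by (intro continuous_on_eq_continuous_within[THEN iffD2] ballI has_vector_derivative_continuous[OF g])
  have cgj: "continuous_on ?X (\<lambda>s. g s $ j)" and crj: "continuous_on ?X (\<lambda>s. r' s $ j)" for j
    by (intro continuous_intros cg cr')+
  have crg: "continuous_on ?X (\<lambda>s. r' s \<bullet> g s)" by (intro continuous_intros cg cr')
  have "Bseq (\<lambda>n. rb n Tm)" by (rule BfunI[of _ M]) (use M in simp)
  then have "bounded (range (\<lambda>n. rb n Tm))" by (simp only: Bseq_eq_bounded)
  \<comment> \<open>Bolzano-Weierstrass for the initial charges only; \<open>e1\<close> spreads this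
    limit over the whole interval.\<close>
  then obtain rho \<sigma> where \<sigma>: "strict_mono \<sigma>" and rho: "(\<lambda>k. rb (\<sigma> k) Tm) \<longlonglongrightarrow> rho"
    using bounded_imp_convergent_subsequence[of "\<lambda>n. rb n Tm"] by (auto simp: o_def)
  have sub: "\<forall>\<^sub>F k in sequentially. Q (\<sigma> k)" if "\<forall>\<^sub>F n in sequentially. Q n" for Q
    using eventually_subseq[OF \<sigma> that] .
  have ul_tm: "uniform_limit ?X (\<lambda>k t. h k) (\<lambda>t. l) sequentially" if "h \<longlonglongrightarrow> l" for h :: "nat \<Rightarrow> real" and l
    unfolding uniform_limit_iff using tendstoD[OF that] by (auto elim: eventually_mono)
  have ul_rb: "uniform_limit ?X (\<lambda>k. rb (\<sigma> k)) (\<lambda>t. rho) sequentially"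
  proof -
    have "uniform_limit ?X (\<lambda>k t. rb (\<sigma> k) t - rb (\<sigma> k) Tm) (\<lambda>_. 0) sequentially"
      by (rule uniform_limit_0I) (rule sub[OF e1])
    from uniform_limit_add[OF this ul_tm[OF rho]] show ?thesis by simp
  qed
  define I where "I f t = integral {Tm..t} (f :: real \<Rightarrow> real)" for f t
  have ul_I: "uniform_limit ?X (\<lambda>k. I (f k)) (I l) sequentially"
    if "\<And>k. continuous_on ?X (f k)" "uniform_limit ?X f l sequentially" for f l
    unfolding I_def[abs_def] by (rule uniform_limit_integral_from(2)[OF that T])
  have I_add: "I (\<lambda>s. f s + h s) t = I f t + I h t" and I_diff: "I (\<lambda>s. f s - h s) t = I f t - I h t"
    if "continuous_on ?X f" "continuous_on ?X h" "t \<in> ?X" for f h t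
  proof -
    have "f integrable_on {Tm..t}" "h integrable_on {Tm..t}"
      using that by (auto intro!: integrable_continuous_interval intro: continuous_on_subset)
    then show "I (\<lambda>s. f s + h s) t = I f t + I h t" "I (\<lambda>s. f s - h s) t = I f t - I h t"
      unfolding I_def by (auto intro: integral_add integral_diff)
  qed
  have I_der: "(I f has_real_derivative f t) (at t within ?X)" if "continuous_on ?X f" "t \<in> ?X" for f t
    unfolding I_def[abs_def] by (rule integral_has_real_derivative[OF that])
  define Ig where "Ig j t = rho * I (\<lambda>s. g s $ j) t" for j t
  have ul_P: "uniform_limit ?X (\<lambda>k t. Pb (\<sigma> k) j t - Pb (\<sigma> k) j Tm) (\<lambda>t. - Ig j t) sequentially" for j
  proof -
    have 1: "uniform_limit ?X (\<lambda>k. I (\<lambda>s. g s $ j * rb (\<sigma> k) s)) (I (\<lambda>s. g s $ j * rho)) sequentially"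
      by (intro ul_I uniform_limit_mult_bounded[OF cgj ul_rb] continuous_on_mult cgj crb)
    have 2: "uniform_limit ?X (\<lambda>k t. Pb (\<sigma> k) j t - Pb (\<sigma> k) j Tm + I (\<lambda>s. g s $ j * rb (\<sigma> k) s) t) (\<lambda>_. 0) sequentially"
      unfolding I_def by (rule uniform_limit_0I) (rule sub[OF e2])
    have "I (\<lambda>s. g s $ j * rho) t = Ig j t" for t by (simp add: I_def Ig_def mult.commute)
    then show ?thesis using uniform_limit_minus[OF 2 1] by simp
  qed
  have ul_gJ: "uniform_limit ?X (\<lambda>k. I (\<lambda>s. \<Sum>i\<in>UNIV. g s $ i * Jb (\<sigma> k) i s)) (\<lambda>t. rho * I (\<lambda>s. r' s \<bullet> g s) t) sequentially"
  proof -
    \<comment> \<open>\<open>Jb\<close> is split into \<open>r' * rb\<close>, which converges with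
      the charges, and a rest that is small only as a primitive; \<open>integral_mult_small\<close>
      allows the factor \<open>g\<close> in front of the rest.\<close>
    let ?h = "\<lambda>k i s. g s $ i * (Jb (\<sigma> k) i s - r' s $ i * rb (\<sigma> k) s)"
    have small: "uniform_limit ?X (\<lambda>k. I (?h k i)) (\<lambda>_. 0) sequentially" for i
    proof (rule uniform_limit_0I)
      fix e :: real assume e: "e > 0"
      \<comment> \<open>The bound \<open>C\<close> may be 0, and \<open>e'\<close> divides by it;
        \<open>C'\<close> is positive.\<close>
      define C' where "C' = \<bar>C\<bar> + 1"
      have C': "C' > 0" by (simp add: C'_def)
      define e' where "e' = e / (C' * (1 + (Tp - Tm)))"
      have den: "C' * (1 + (Tp - Tm)) > 0" using C' T by simp
      then have e': "e' > 0" using e by (simp add: e'_def)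
      show "\<forall>\<^sub>F k in sequentially. \<forall>t\<in>?X. \<bar>I (?h k i) t\<bar> \<le> e"
        using sub[OF e4[OF e', of i]]
      proof eventually_elim
        case (elim k)
        show ?case
        proof
          fix t assume t: "t \<in> ?X"
          have "\<bar>I (?h k i) t\<bar> \<le> C' * e' * (1 + (Tp - Tm))"
            unfolding I_def
          proof (rule integral_mult_small[where gg' = "\<lambda>s. g' s $ i", OF _ _ _ _ t])
            fix s assume s: "s \<in> ?X"
            show "((\<lambda>s. g s $ i) has_real_derivative g' s $ i) (at s within ?X)"
              using bounded_linear.has_vector_derivative[OF bounded_linear_vec_nth[of i] g[OF s]]
              by (simp add: has_real_derivative_iff_has_vector_derivative)
            show "\<bar>g s $ i\<bar> \<le> C' \<and> \<bar>g' s $ i\<bar> \<le> C'"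
              using gC[OF s] component_le_norm_cart[of "g s" i] component_le_norm_cart[of "g' s" i] by (auto simp: C'_def)
            show "\<bar>integral {Tm..s} (\<lambda>s. Jb (\<sigma> k) i s - r' s $ i * rb (\<sigma> k) s)\<bar> \<le> e'" using elim s by auto
          qed (intro continuous_on_diff continuous_on_mult cJb crb crj)
          also have "\<dots> = e' * (C' * (1 + (Tp - Tm)))" by simp
          also have "\<dots> = e" unfolding e'_def by (rule nonzero_eq_divide_eq[THEN iffD1]) (use den in auto)
          finally show "\<bar>I (?h k i) t\<bar> \<le> e" .
        qed
      qed
    qed
    have "uniform_limit ?X (\<lambda>k t. \<Sum>i\<in>UNIV. I (?h k i) t) (\<lambda>t. \<Sum>i\<in>(UNIV::3 set). 0) sequentially"
      unfolding sum_3 by (intro uniform_limit_add small)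
    moreover have "uniform_limit ?X (\<lambda>k. I (\<lambda>s. (r' s \<bullet> g s) * rb (\<sigma> k) s)) (I (\<lambda>s. (r' s \<bullet> g s) * rho)) sequentially"
      by (intro ul_I uniform_limit_mult_bounded[OF crg ul_rb] continuous_on_mult crg crb)
    ultimately have ulX: "uniform_limit ?X (\<lambda>k t. (\<Sum>i\<in>UNIV. I (?h k i) t)
        + I (\<lambda>s. (r' s \<bullet> g s) * rb (\<sigma> k) s) t) (\<lambda>t. (\<Sum>i\<in>(UNIV::3 set). 0) + I (\<lambda>s. (r' s \<bullet> g s) * rho) t) sequentially"
      by (rule uniform_limit_add)
    have eqX: "(\<Sum>i\<in>UNIV. I (?h k i) t) + I (\<lambda>s. (r' s \<bullet> g s) * rb (\<sigma> k) s) t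
       = I (\<lambda>s. \<Sum>i\<in>UNIV. g s $ i * Jb (\<sigma> k) i s) t" if t: "t \<in> ?X" for k t
    proof -
      have ci: "continuous_on ?X (?h k i)" for i
        by (intro continuous_on_diff continuous_on_mult cJb crb crj cgj)
      have cc: "continuous_on ?X (\<lambda>s. (r' s \<bullet> g s) * rb (\<sigma> k) s)" by (intro continuous_on_mult crg crb)
      have "(\<Sum>i\<in>UNIV. I (?h k i) t)
         = I (\<lambda>s. \<Sum>i\<in>UNIV. g s $ i * (Jb (\<sigma> k) i s - r' s $ i * rb (\<sigma> k) s)) t"
        unfolding sum_3 by (simp only: I_add[OF continuous_on_add[OF ci ci] ci t] I_add[OF ci ci t])
      then have "(\<Sum>i\<in>UNIV. I (?h k i) t) + I (\<lambda>s. (r' s \<bullet> g s) * rb (\<sigma> k) s) t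
        = I (\<lambda>s. (\<Sum>i\<in>UNIV. g s $ i * (Jb (\<sigma> k) i s - r' s $ i * rb (\<sigma> k) s)) + (r' s \<bullet> g s) * rb (\<sigma> k) s) t"
        by (simp only: I_add[OF continuous_on_sum[OF ci] cc t])
      also have "(\<lambda>s. (\<Sum>i\<in>UNIV. g s $ i * (Jb (\<sigma> k) i s - r' s $ i * rb (\<sigma> k) s)) + (r' s \<bullet> g s) * rb (\<sigma> k) s)
        = (\<lambda>s. \<Sum>i\<in>UNIV. g s $ i * Jb (\<sigma> k) i s)"
        by (auto simp: inner_vec_def sum_3 algebra_simps)
      finally show ?thesis .
    qed
    have eqY: "I (\<lambda>s. (r' s \<bullet> g s) * rho) t = rho * I (\<lambda>s. r' s \<bullet> g s) t" for t
      by (simp add: I_def mult.commute)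
    show ?thesis
      by (rule uniform_limit_cong'[THEN iffD1, OF _ _ ulX]) (simp_all add: eqX eqY)
  qed
  define IE where "IE t = rho * I (\<lambda>s. r' s \<bullet> g s) t" for t
  have ul_E': "uniform_limit ?X (\<lambda>k t. Eb (\<sigma> k) t - Eb (\<sigma> k) Tm) (\<lambda>t. - IE t) sequentially"
  proof -
    have "uniform_limit ?X (\<lambda>k t. Eb (\<sigma> k) t - Eb (\<sigma> k) Tm + I (\<lambda>s. \<Sum>i\<in>UNIV. g s $ i * Jb (\<sigma> k) i s) t) (\<lambda>_. 0) sequentially"
      unfolding I_def by (rule uniform_limit_0I) (rule sub[OF e3])
    from uniform_limit_minus[OF this ul_gJ] show ?thesis by (simp add: IE_def)
  qed
  have ETm: "(\<lambda>k. Eb (\<sigma> k) Tm) \<longlonglongrightarrow> E0 + IE t0"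
  proof -
    have "(\<lambda>k. Eb (\<sigma> k) t0) \<longlonglongrightarrow> E0" using LIMSEQ_subseq_LIMSEQ[OF E0 \<sigma>] by (simp add: o_def)
    from tendsto_diff[OF this tendsto_uniform_limitI[OF ul_E' t0]] show ?thesis by simp
  qed
  define Ei where "Ei t = E0 + IE t0 - IE t" for t
  have ul_E: "uniform_limit ?X (\<lambda>k. Eb (\<sigma> k)) Ei sequentially"
    using uniform_limit_add[OF ul_tm[OF ETm] ul_E'] by (simp add: Ei_def[abs_def])
  have limE: "(\<lambda>k. Eb (\<sigma> k) t) \<longlonglongrightarrow> Ei t" if "t \<in> ?X" for t using tendsto_uniform_limitI[OF ul_E that] .
  have Ei_t0: "Ei t0 = E0" by (simp add: Ei_def)
  have Ei_oint: "Ei t = Ei t0 - rho * oint t0 t (\<lambda>t'. r' t' \<bullet> g t')" if "t \<in> ?X" for t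
    unfolding oint_eq[OF crg t0 that] by (simp add: Ei_def IE_def I_def algebra_simps)
  have dEi: "(Ei has_real_derivative - rho * (r' t \<bullet> g t)) (at t within ?X)" if "t \<in> ?X" for t
    unfolding Ei_def[abs_def] IE_def by (auto intro!: derivative_eq_intros I_der[OF crg that])
  have cEi: "continuous_on ?X Ei" using uniform_limit_integral_from(1)[OF cEb ul_E T] .
  have Ei_pos: "Ei t > 0" if t: "t \<in> ?X" for t
  proof -
    have "c0 \<le> Ei t"
    proof (rule LIMSEQ_le_const[OF limE[OF t]], intro exI[of _ n0] allI impI)
      fix k assume "n0 \<le> k"
      then have "n0 \<le> \<sigma> k" using seq_suble[OF \<sigma>, of k] by linarith
      then show "c0 \<le> Eb (\<sigma> k) t" using pos t by blast
    qed
    then show ?thesis using pos by linarith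
  qed
  have mom: "((\<lambda>t. (Ei t / c\<^sup>2) *\<^sub>R r' t) has_vector_derivative (- rho) *\<^sub>R g t) (at t within ?X)" if t: "t \<in> ?X" for t
  \<comment> \<open>On a one-point interval every derivative holds trivially; the argument for a
    proper interval divides by \<open>Tp - Tm\<close>.\<close>
  proof (cases "Tm = Tp")
    case True
    then have "?X = {t}" using t by auto
    then show ?thesis
      by (simp only: has_vector_derivative_def has_derivative_within_singleton_iff) (rule bounded_linear_scaleR_left)
  next
    case False
    then have D: "Tp - Tm > 0" using T by simp
    have "\<exists>p. \<forall>t\<in>?X. Ei t / c\<^sup>2 * r' t $ j = p - Ig j t" for j
    proof -
      \<comment> \<open>By \<open>e5\<close> this is the limit of
        \<open>c\<^sup>2 * Pb (\<sigma> k) j Tm * (t - Tm)\<close>, hence linear in t - Tm.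
        Differentiating it recovers the pointwise relation between \<open>Ei * r'\<close> and the
        momentum.\<close>
      define Psi where "Psi t = I (\<lambda>s. r' s $ j * Ei s) t + c\<^sup>2 * I (Ig j) t" for t
      have cIg: "continuous_on ?X (Ig j)"
        unfolding Ig_def by (intro continuous_on_mult continuous_on_const DERIV_continuous_on[OF I_der[OF cgj]])
      have lim: "(\<lambda>k. c\<^sup>2 * Pb (\<sigma> k) j Tm * (t - Tm)) \<longlonglongrightarrow> Psi t" if t: "t \<in> ?X" for t
      proof -
        have 1: "(\<lambda>k. I (\<lambda>s. c\<^sup>2 * Pb (\<sigma> k) j s - r' s $ j * Eb (\<sigma> k) s) t) \<longlonglongrightarrow> 0"
          by (rule tendsto_uniform_limitI[OF uniform_limit_0I t]) (unfold I_def, rule sub[OF e5])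
        have 2: "(\<lambda>k. I (\<lambda>s. r' s $ j * Eb (\<sigma> k) s) t) \<longlonglongrightarrow> I (\<lambda>s. r' s $ j * Ei s) t"
          by (rule tendsto_uniform_limitI[OF ul_I t]) (intro continuous_on_mult crj cEb uniform_limit_mult_bounded[OF crj ul_E])+
        have 3: "(\<lambda>k. I (\<lambda>s. Pb (\<sigma> k) j s - Pb (\<sigma> k) j Tm) t) \<longlonglongrightarrow> I (\<lambda>t. - Ig j t) t"
          by (rule tendsto_uniform_limitI[OF ul_I[OF _ ul_P] t]) (intro continuous_on_diff continuous_on_const cPb)
        have eq: "c\<^sup>2 * Pb (\<sigma> k) j Tm * (t - Tm) = I (\<lambda>s. c\<^sup>2 * Pb (\<sigma> k) j s - r' s $ j * Eb (\<sigma> k) s) t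
            + I (\<lambda>s. r' s $ j * Eb (\<sigma> k) s) t - c\<^sup>2 * I (\<lambda>s. Pb (\<sigma> k) j s - Pb (\<sigma> k) j Tm) t" for k
        proof -
          have a: "I (\<lambda>s. c\<^sup>2 * Pb (\<sigma> k) j s - r' s $ j * Eb (\<sigma> k) s) t = c\<^sup>2 * I (Pb (\<sigma> k) j) t - I (\<lambda>s. r' s $ j * Eb (\<sigma> k) s) t"
            by (subst I_diff[OF _ _ t]) (auto simp: I_def intro!: continuous_on_mult crj cEb cPb)
          have b: "I (\<lambda>s. Pb (\<sigma> k) j s - Pb (\<sigma> k) j Tm) t = I (Pb (\<sigma> k) j) t - Pb (\<sigma> k) j Tm * (t - Tm)"
            by (subst I_diff[OF _ _ t]) (use t in \<open>auto simp: I_def cPb\<close>)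
          show ?thesis unfolding a b by (simp add: algebra_simps)
        qed
        have "(\<lambda>k. c\<^sup>2 * Pb (\<sigma> k) j Tm * (t - Tm)) \<longlonglongrightarrow> 0 + I (\<lambda>s. r' s $ j * Ei s) t - c\<^sup>2 * I (\<lambda>t. - Ig j t) t"
          unfolding eq by (intro tendsto_diff tendsto_add tendsto_mult_left 1 2 3)
        then show ?thesis by (simp add: Psi_def I_def)
      qed
      \<comment> \<open>The slope is read off at t = \<open>Tp\<close>; convergence at this one time
        determines the limit at every other.\<close>
      define p where "p = Psi Tp / (Tp - Tm)"
      have Psi: "Psi t = p * (t - Tm)" if t: "t \<in> ?X" for t
      proof -
        have "(\<lambda>k. c\<^sup>2 * Pb (\<sigma> k) j Tm * (Tp - Tm) * ((t - Tm) / (Tp - Tm))) \<longlonglongrightarrow> Psi Tp * ((t - Tm) / (Tp - Tm))"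
          using T by (intro tendsto_mult_right lim) auto
        then have "(\<lambda>k. c\<^sup>2 * Pb (\<sigma> k) j Tm * (t - Tm)) \<longlonglongrightarrow> Psi Tp * ((t - Tm) / (Tp - Tm))"
          using D by (simp add: mult.assoc)
        from LIMSEQ_unique[OF lim[OF t] this] show ?thesis by (simp add: p_def)
      qed
      have "Ei t / c\<^sup>2 * r' t $ j = p / c\<^sup>2 - Ig j t" if t: "t \<in> ?X" for t
      proof -
        have "(Psi has_real_derivative r' t $ j * Ei t + c\<^sup>2 * Ig j t) (at t within ?X)"
          unfolding Psi_def[abs_def]
          by (intro DERIV_add DERIV_cmult I_der[OF _ t] continuous_on_mult crj cEi cIg)
        moreover have "(Psi has_real_derivative p) (at t within ?X)"
        proof -
          have "((\<lambda>t. p * (t - Tm)) has_real_derivative p) (at t within ?X)"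
            by (auto intro!: derivative_eq_intros)
          then show ?thesis
            unfolding has_field_derivative_def by (rule has_derivative_transform[OF t, rotated]) (use Psi in auto)
        qed
        \<comment> \<open>On a proper interval the derivative within it is unique, also at the end
          points.\<close>
        ultimately have "r' t $ j * Ei t + c\<^sup>2 * Ig j t = p"
          using vector_derivative_unique_within_closed_interval[of Tm Tp t Psi] D t
          by (auto simp: has_real_derivative_iff_has_vector_derivative)
        then show ?thesis using c by (simp add: field_simps)
      qed
      then show ?thesis by blast
    qed
    then obtain p where p: "\<And>j t. t \<in> ?X \<Longrightarrow> Ei t / c\<^sup>2 * r' t $ j = p j - Ig j t" by metis
    have comp: "((\<lambda>t. Ei t / c\<^sup>2 * r' t $ j) has_real_derivative - rho * g t $ j) (at t within ?X)" for j
    proof -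
      have "((\<lambda>t. p j - Ig j t) has_real_derivative - rho * g t $ j) (at t within ?X)"
        unfolding Ig_def by (auto intro!: derivative_eq_intros I_der[OF cgj t])
      then show ?thesis unfolding has_field_derivative_def by (rule has_derivative_transform[OF t, rotated]) (use p in auto)
    qed
    show ?thesis
      unfolding has_vector_derivative_def
    proof (rule has_derivative_componentwise_within[THEN iffD2], rule ballI)
      fix b :: "real^3" assume "b \<in> Basis"
      then obtain j where b: "b = axis j 1" by (auto simp: Basis_vec_def)
      show "((\<lambda>x. (Ei x / c\<^sup>2) *\<^sub>R r' x \<bullet> b) has_derivative (\<lambda>x. (x *\<^sub>R - rho *\<^sub>R g t) \<bullet> b)) (at t within ?X)"
      proof -
        have eq: "(\<lambda>x. (x *\<^sub>R - rho *\<^sub>R g t) \<bullet> b) = (\<lambda>x. x * (- rho * g t $ j))"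
          "(\<lambda>x. (Ei x / c\<^sup>2) *\<^sub>R r' x \<bullet> b) = (\<lambda>t. Ei t / c\<^sup>2 * r' t $ j)"
          by (auto simp: b inner_axis fun_eq_iff)
        show ?thesis unfolding eq using comp[of j] by (simp only: has_field_derivative_def mult_commute_abs)
      qed
    qed
  qed
  have mass: "\<exists>M0. \<forall>t\<in>?X. Ei t / c\<^sup>2 = (1 / sqrt (1 - (norm (r' t))\<^sup>2 / c\<^sup>2)) * M0" if sub: "\<forall>t\<in>?X. norm (r' t) < c"
  proof -
    define P where "P t = (Ei t / c\<^sup>2) *\<^sub>R r' t" for t
    \<comment> \<open>Squared rest energy. The derivatives of its two terms cancel because c^2 P = E
      r', so that E times the inner product of r' and g equals c^2 times that of P and g.\<close>
    define Q where "Q t = (Ei t)\<^sup>2 - c\<^sup>2 * (P t \<bullet> P t)" for t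
    have "\<exists>q. \<forall>t\<in>?X. Q t = q"
    proof (rule has_derivative_zero_constant)
      fix t assume t: "t \<in> ?X"
      have dP: "(P has_derivative (\<lambda>h. h *\<^sub>R ((- rho) *\<^sub>R g t))) (at t within ?X)"
        using mom[OF t] by (simp add: P_def[abs_def] has_vector_derivative_def)
      have dE: "(Ei has_derivative (\<lambda>h. h * (- rho * (r' t \<bullet> g t)))) (at t within ?X)"
        using dEi[OF t] by (simp only: has_field_derivative_def mult_commute_abs)
      have "(Q has_derivative (\<lambda>h. 2 * Ei t * (h * (- rho * (r' t \<bullet> g t)))
          - c\<^sup>2 * (P t \<bullet> (h *\<^sub>R ((- rho) *\<^sub>R g t)) + (h *\<^sub>R ((- rho) *\<^sub>R g t)) \<bullet> P t))) (at t within ?X)"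
        unfolding Q_def[abs_def] by (auto intro!: derivative_eq_intros dP dE simp: mult_ac)
      moreover have "2 * Ei t * (h * (- rho * (r' t \<bullet> g t)))
          - c\<^sup>2 * (P t \<bullet> (h *\<^sub>R ((- rho) *\<^sub>R g t)) + (h *\<^sub>R ((- rho) *\<^sub>R g t)) \<bullet> P t) = 0" for h
        using c by (simp add: P_def inner_commute[of "g t"])
      ultimately show "(Q has_derivative (\<lambda>h. 0)) (at t within ?X)" by simp
    qed simp
    then obtain q where q: "\<And>t. t \<in> ?X \<Longrightarrow> Q t = q" by blast
    show ?thesis
    \<comment> \<open>From q = E^2 (1 - |r'|^2 / c^2) and E > 0, the root of q is E divided by
      gamma, the constant rest energy.\<close>
    proof (intro exI[of _ "sqrt q / c\<^sup>2"] ballI)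
      fix t assume t: "t \<in> ?X"
      define s where "s = 1 - (norm (r' t))\<^sup>2 / c\<^sup>2"
      have "(norm (r' t))\<^sup>2 < c\<^sup>2" using sub t by (intro power_strict_mono) auto
      then have s: "s > 0" using c by (simp add: s_def)
      have "norm (r' t) * norm (r' t) = r' t \<bullet> r' t"
        by (simp add: power2_norm_eq_inner flip: power2_eq_square)
      then have "q = (Ei t)\<^sup>2 * s"
        using q[OF t] c by (simp add: Q_def P_def s_def power2_eq_square field_simps)
      then have "sqrt q = Ei t * sqrt s" using Ei_pos[OF t] by (simp add: real_sqrt_mult)
      then show "Ei t / c\<^sup>2 = 1 / sqrt (1 - (norm (r' t))\<^sup>2 / c\<^sup>2) * (sqrt q / c\<^sup>2)"
        using s c by (simp add: s_def[symmetric])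
    qed
  qed
  show ?thesis
    using \<sigma> ul_rb limE Ei_t0 Ei_oint mom mass
    by (intro exI[of _ \<sigma>] exI[of _ rho] exI[of _ Ei]) blast
qed

text \<open>Linear in \<open>e\<close>, with a coefficient built only from constants meant to be
  uniform; \<open>e \<le> 1\<close> absorbs the product of \<open>R\<close> with the flux term, so
  the flux constant 24 is counted twice, giving 48.\<close>

lemma (in KG_tube_bounds) err_le:
  assumes "B = e" "del = e" "R \<le> e" "e \<le> 1" "Tm \<le> Tp"
  shows "err \<le> e * (48 * (K * (1 + Cr)) * (Tp - Tm) + 3 * K * CI * (Tp - Tm) + 2 * (K * CI) + 3 * (Cphi * K) * CI * (Tp - Tm))"
proof -
  define x1 x2 x3 x4 where "x1 = 24 * (K * (1 + Cr)) * (Tp - Tm)" and "x2 = 3 * K * CI * (Tp - Tm)"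
    and "x3 = 2 * (K * CI)" and "x4 = 3 * (Cphi * K) * CI * (Tp - Tm)"
  have nn: "0 \<le> x1" "0 \<le> x2" "0 \<le> x3" "0 \<le> x4" "0 \<le> e"
    using assms nonneg K_ge(7) by (auto simp: x1_def x2_def x3_def x4_def)
  have "err = e * x1 + e * x2 + R * (e * x1 + x3 + x4)"
    unfolding err_def by (simp add: x1_def x2_def x3_def x4_def assms(1,2) algebra_simps)
  also have "\<dots> \<le> e * x1 + e * x2 + e * (1 * x1 + x3 + x4)"
    using nn R assms by (intro add_left_mono mult_mono add_right_mono) auto
  also have "\<dots> = e * (2 * x1 + x2 + x3 + x4)" by (simp add: algebra_simps)
  also have "2 * x1 + x2 + x3 + x4 = 48 * (K * (1 + Cr)) * (Tp - Tm) + 3 * K * CI * (Tp - Tm) + 2 * (K * CI) + 3 * (Cphi * K) * CI * (Tp - Tm)"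
    by (simp add: x1_def x2_def x3_def x4_def)
  finally show ?thesis .
qed

section \<open>Uniformity in the sequence and conclusion\<close>

lemma nabla0_norm_ge: "\<bar>fx $ i\<bar> \<le> nabla0_norm c ft fx"
proof -
  have "norm fx \<le> nabla0_norm c ft fx" unfolding nabla0_norm_def by (rule real_le_rsqrt) simp
  then show ?thesis using component_le_norm_cart[of fx i] by linarith
qed

text \<open>All limits are taken along one subsequence, the one along which the charges converge.
  The mass formula is stated under |r'| < c, where gamma is finite.\<close>

theorem theorem1:
  fixes c m q :: real and G1 G1' :: "real \<Rightarrow> real" and Tm Tp t0 E0 :: real
    and r r' r'' g g' :: "real \<Rightarrow> real^3" and phi0 phi0' :: "real \<Rightarrow> real"
    and R a chi :: "nat \<Rightarrow> real"
    and phi :: "nat \<Rightarrow> real \<times> (real^3) \<Rightarrow> real"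
    and Dphi :: "nat \<Rightarrow> real \<times> (real^3) \<Rightarrow> (real \<times> (real^3)) \<Rightarrow>\<^sub>L real"
    and D2phi :: "nat \<Rightarrow> real \<times> (real^3) \<Rightarrow> (real \<times> (real^3)) \<Rightarrow>\<^sub>L (real \<times> (real^3)) \<Rightarrow>\<^sub>L real"
    and psi :: "nat \<Rightarrow> real \<times> (real^3) \<Rightarrow> complex"
    and Dpsi :: "nat \<Rightarrow> real \<times> (real^3) \<Rightarrow> (real \<times> (real^3)) \<Rightarrow>\<^sub>L complex"
    and D2psi :: "nat \<Rightarrow> real \<times> (real^3) \<Rightarrow> (real \<times> (real^3)) \<Rightarrow>\<^sub>L (real \<times> (real^3)) \<Rightarrow>\<^sub>L complex"
  assumes "c > 0" and "m > 0"
    and "admissible_G1 G1 G1'"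
    and "trajectory Tm Tp r r' r''"
    and "localized c m Tm Tp r r' R a chi phi Dphi D2phi phi0 phi0' g g'"
    and "concentrating c m q G1 G1' Tm Tp r R a chi phi Dphi psi Dpsi D2psi t0 E0"
  shows "\<exists>s rho_inf (E_inf :: real \<Rightarrow> real). strict_mono s \<and>
     uniform_limit {Tm..Tp}
       (\<lambda>k t. rho_bar c m q (chi (s k)) (phi (s k)) (psi (s k)) (Dpsi (s k)) (r t) (R (s k)) t)
       (\<lambda>t. rho_inf) sequentially \<and>
     (\<forall>t\<in>{Tm..Tp}. (\<lambda>k. E_bar c m q G1 (chi (s k)) (a (s k)) (phi (s k)) (psi (s k)) (Dpsi (s k))
                         (r t) (R (s k)) t) \<longlonglongrightarrow> E_inf t) \<and>
     E_inf t0 = E0 \<and>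
     (\<forall>t\<in>{Tm..Tp}. E_inf t = E_inf t0 - rho_inf * oint t0 t (\<lambda>t'. r' t' \<bullet> g t')) \<and>
     (\<forall>t\<in>{Tm..Tp}. ((\<lambda>t. (E_inf t / c\<^sup>2) *\<^sub>R r' t) has_vector_derivative (- rho_inf) *\<^sub>R g t)
                      (at t within {Tm..Tp})) \<and>
     ((\<forall>t\<in>{Tm..Tp}. norm (r' t) < c) \<longrightarrow>
        (\<exists>M0. \<forall>t\<in>{Tm..Tp}. E_inf t / c\<^sup>2 = (1 / sqrt (1 - (norm (r' t))\<^sup>2 / c\<^sup>2)) * M0))"
proof -
  let ?S = "\<lambda>n. Omega_hat Tm Tp r (R n)"
  let ?loc = "\<lambda>n. loc_dens c m G1 (chi n) (a n) (psi n) (Dpsi n)"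
  note traj = \<open>trajectory Tm Tp r r' r''\<close>[unfolded trajectory_def]
  note lcl = \<open>localized c m Tm Tp r r' R a chi phi Dphi D2phi phi0 phi0' g g'\<close>[unfolded localized_def]
  note conc = \<open>concentrating c m q G1 G1' Tm Tp r R a chi phi Dphi psi Dpsi D2psi t0 E0\<close>[unfolded concentrating_def]
  have r: "(r has_vector_derivative r' t) (at t within {Tm..Tp})"
    and dr': "(r' has_vector_derivative r'' t) (at t within {Tm..Tp})" if "t \<in> {Tm..Tp}" for t
    using traj that by auto
  have cr: "continuous_on {Tm..Tp} r"
    by (intro continuous_on_eq_continuous_within[THEN iffD2] ballI has_vector_derivative_continuous[OF r])
  have cr': "continuous_on {Tm..Tp} r'"
    by (intro continuous_on_eq_continuous_within[THEN iffD2] ballI has_vector_derivative_continuous[OF dr'])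
  have g: "(g has_vector_derivative g' t) (at t within {Tm..Tp})" if "t \<in> {Tm..Tp}" for t
    using lcl that by blast
  have cg: "continuous_on {Tm..Tp} g"
    by (intro continuous_on_eq_continuous_within[THEN iffD2] ballI has_vector_derivative_continuous[OF g])
  have pos: "R n > 0" "a n > 0" "chi n > 0" for n using lcl by blast+
  have Rlim: "R \<longlonglongrightarrow> 0" using lcl by blast
  have t0: "t0 \<in> {Tm..Tp}" using conc by blast
  have T: "Tm \<le> Tp" using t0 by auto
  obtain Cr0 where "\<And>t. t \<in> {Tm..Tp} \<Longrightarrow> norm (r' t) \<le> Cr0" using traj by blast
  then obtain Cr where Cr: "0 \<le> Cr" "\<And>t. t \<in> {Tm..Tp} \<Longrightarrow> norm (r' t) \<le> Cr"
    using order_trans[OF _ max.cobounded2[of Cr0 0]] that[of "max 0 Cr0"] by (metis max.cobounded1 max.commute)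
  obtain Cp0 where Cp0: "\<And>n z. z \<in> ?S n \<Longrightarrow>
      \<bar>phi n z\<bar> + nabla0_norm c (dt (Dphi n) z) (gradx (Dphi n) z) \<le> Cp0" using lcl by blast
  define Cphi where "Cphi = max 0 Cp0"
  have Cphi: "0 \<le> Cphi" "\<And>n z. z \<in> ?S n \<Longrightarrow> \<bar>phi n z\<bar> \<le> Cphi"
    "\<And>n z i. z \<in> ?S n \<Longrightarrow> \<bar>dx (Dphi n) z i\<bar> \<le> Cphi"
  proof -
    fix n z i assume z: "z \<in> ?S n"
    have "\<bar>gradx (Dphi n) z $ i\<bar> \<le> nabla0_norm c (dt (Dphi n) z) (gradx (Dphi n) z)" by (rule nabla0_norm_ge)
    moreover from this have "0 \<le> nabla0_norm c (dt (Dphi n) z) (gradx (Dphi n) z)" by linarith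
    ultimately show "\<bar>phi n z\<bar> \<le> Cphi" "\<bar>dx (Dphi n) z i\<bar> \<le> Cphi"
      using Cp0[OF z] by (auto simp: Cphi_def gradx_def)
  qed (simp add: Cphi_def)
  obtain CI0 where CI0: "\<And>n t. t \<in> {Tm..Tp} \<Longrightarrow> integral (cball (r t) (R n)) (\<lambda>x. ?loc n (t, x)) \<le> CI0" using conc by blast
  define CI where "CI = max 0 CI0"
  have CI: "0 \<le> CI" "\<And>n t. t \<in> {Tm..Tp} \<Longrightarrow> integral (cball (r t) (R n)) (\<lambda>x. ?loc n (t, x)) \<le> CI"
    using CI0 by (auto simp: CI_def le_max_iff_disj)
  have tube: "KG_tube c m q (chi n) (a n) Tm Tp (R n) r G1 G1' (phi n) (Dphi n) (D2phi n) (psi n) (Dpsi n) (D2psi n)" for n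
  proof
    show "C2_on (?S n) (phi n) (Dphi n) (D2phi n)" using lcl by blast
    show "C2_on (?S n) (psi n) (Dpsi n) (D2psi n)" using conc by blast
    show "KG_at c m q G1' (chi n) (a n) (phi n) (Dphi n) (psi n) (Dpsi n) (D2psi n) z" if "z \<in> ?S n" for z
      using conc that by blast
  qed (use assms pos cr in auto)
  \<comment> \<open>Both small parameters of the locale are set to the same \<open>e\<close>, which
    is admissible for all large indices.\<close>
  have bounds: "\<forall>\<^sub>F n in sequentially. KG_tube_bounds c m q (chi n) (a n) Tm Tp (R n) r G1 G1' (phi n) (Dphi n) (D2phi n)
      (psi n) (Dpsi n) (D2psi n) r' g Cphi Cr CI e e" if e: "e > 0" for e
  proof -
    have "\<forall>\<^sub>F n in sequentially. \<forall>z\<in>?S n. \<bar>phi n z - phi_inf r phi0 g z\<bar>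
         + nabla0_norm c (dt (Dphi n) z - phi_inf_t r r' phi0' g g' z) (gradx (Dphi n) z - g (fst z)) < e"
      using lcl e by blast
    moreover have "\<forall>\<^sub>F n in sequentially. \<forall>t\<in>{Tm..Tp}. sphere_integral (r t) (R n) (\<lambda>x. ?loc n (t, x)) < e"
      using conc e by blast
    ultimately show ?thesis
    proof eventually_elim
      case (elim n)
      show ?case
      proof (rule KG_tube_bounds.intro[OF tube], unfold_locales)
        fix z i assume z: "z \<in> ?S n"
        have "\<bar>(gradx (Dphi n) z - g (fst z)) $ i\<bar> \<le> nabla0_norm c (dt (Dphi n) z - phi_inf_t r r' phi0' g g' z) (gradx (Dphi n) z - g (fst z))"
          by (rule nabla0_norm_ge)
        then show "\<bar>dx (Dphi n) z i - g (fst z) $ i\<bar> \<le> e"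
          using elim(1)[rule_format, OF z] by (simp add: gradx_def)
      qed (use r cr' cg Cphi Cr CI e elim in \<open>auto simp: less_imp_le\<close>)
    qed
  qed
  define rb where "rb n t = rho_bar c m q (chi n) (phi n) (psi n) (Dpsi n) (r t) (R n) t" for n t
  define Eb where "Eb n t = E_bar c m q G1 (chi n) (a n) (phi n) (psi n) (Dpsi n) (r t) (R n) t" for n t
  define Pb where "Pb n j t = integral (cball (r t) (R n)) (\<lambda>x. - ((chi n)\<^sup>2 / (m * c\<^sup>2)) *
      (cov_dt q (chi n) (phi n (t, x)) (dt (Dpsi n) (t, x)) (psi n (t, x)) \<bullet> dx (Dpsi n) (t, x) j))" for n j t
  define Jb where "Jb n j t = integral (cball (r t) (R n)) (\<lambda>x. chi n * q / m *
      ((\<i> * psi n (t, x)) \<bullet> dx (Dpsi n) (t, x) j))" for n j t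
  have cont: "continuous_on {Tm..Tp} (rb n)" "continuous_on {Tm..Tp} (Eb n)"
    "continuous_on {Tm..Tp} (Pb n j)" "continuous_on {Tm..Tp} (Jb n j)" for n j
  proof -
    interpret KG_tube c m q "chi n" "a n" Tm Tp "R n" r G1 G1' "phi n" "Dphi n" "D2phi n" "psi n" "Dpsi n" "D2psi n"
      by (rule tube)
    show "continuous_on {Tm..Tp} (rb n)" "continuous_on {Tm..Tp} (Eb n)"
      "continuous_on {Tm..Tp} (Pb n j)" "continuous_on {Tm..Tp} (Jb n j)"
      using continuous_on_tube_integral[OF cr C1f_continuous_on[OF C1f_rho]] continuous_on_tube_integral[OF cr C1f_continuous_on[OF C1f_Ed]]
        continuous_on_tube_integral[OF cr C1f_continuous_on[OF C1f_P[of j]]] continuous_on_tube_integral[OF cr C1f_continuous_on[OF C1f_J[of j]]]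
      by (simp_all add: rb_def[abs_def] Eb_def[abs_def] Pb_def[abs_def] Jb_def[abs_def] rho_bar_def E_bar_def P_def A_def J_def)
  qed
  \<comment> \<open>Copies of the locale constants, written without any index; the equation
    \<open>N.K = K\<close> below is what makes the estimates uniform in \<open>n\<close>.\<close>
  define al where "al = c + \<bar>q\<bar> * Cphi / (m * c)"
  define K where "K = \<bar>q\<bar> * al / c + c * \<bar>q\<bar> + m * al + m * c\<^sup>2 * al + 2 * (m * c\<^sup>2 * (al\<^sup>2 / c\<^sup>2 + 3))"
  define Kt where "Kt = 48 * (K * (1 + Cr)) * (Tp - Tm) + 3 * K * CI * (Tp - Tm) + 2 * (K * CI) + 3 * (Cphi * K) * CI * (Tp - Tm)"
  have est: "\<forall>\<^sub>F n in sequentially. \<forall>t\<in>{Tm..Tp}. \<forall>j.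
      \<bar>rb n t - rb n Tm\<bar> \<le> e \<and>
      \<bar>Pb n j t - Pb n j Tm + integral {Tm..t} (\<lambda>s. g s $ j * rb n s)\<bar> \<le> e \<and>
      \<bar>Eb n t - Eb n Tm + integral {Tm..t} (\<lambda>s. \<Sum>i\<in>UNIV. g s $ i * Jb n i s)\<bar> \<le> e \<and>
      \<bar>integral {Tm..t} (\<lambda>s. Jb n j s - r' s $ j * rb n s)\<bar> \<le> e \<and>
      \<bar>integral {Tm..t} (\<lambda>s. c\<^sup>2 * Pb n j s - r' s $ j * Eb n s)\<bar> \<le> e \<and> \<bar>rb n t\<bar> \<le> K * CI"
    (is "\<forall>\<^sub>F n in _. \<forall>t\<in>_. \<forall>j. ?est n t j") if e: "e > 0" for e
  proof -
    \<comment> \<open>\<open>N.err\<close> is at most \<open>e' * Kt\<close>; the summand 1 keeps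
      the denominator positive, and the minimum with 1 meets the condition of
      \<open>err_le\<close>.\<close>
    define e' where "e' = min 1 (e / (\<bar>Kt\<bar> + 1))"
    have e': "e' > 0" "e' \<le> 1" "e' * Kt \<le> e"
    proof -
      show "e' > 0" "e' \<le> 1" using e by (auto simp: e'_def)
      have "e' * Kt \<le> e' * (\<bar>Kt\<bar> + 1)" using \<open>e' > 0\<close> by (intro mult_left_mono) auto
      also have "\<dots> \<le> e / (\<bar>Kt\<bar> + 1) * (\<bar>Kt\<bar> + 1)" by (intro mult_right_mono) (auto simp: e'_def)
      also have "\<dots> = e" by simp
      finally show "e' * Kt \<le> e" .
    qed
    have "\<forall>\<^sub>F n in sequentially. R n < e'" using order_tendstoD(2)[OF Rlim e'(1)] .
    with bounds[OF e'(1)] show ?thesis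
    proof eventually_elim
      case (elim n)
      interpret N: KG_tube_bounds c m q "chi n" "a n" Tm Tp "R n" r G1 G1' "phi n" "Dphi n" "D2phi n" "psi n" "Dpsi n" "D2psi n"
        r' g Cphi Cr CI e' e' by (rule elim(1))
      have K: "N.K = K" by (simp add: N.K_def N.al_def K_def al_def)
      have err: "N.err \<le> e"
        using N.err_le[of e'] elim(2) e' T unfolding K Kt_def[symmetric] by simp
      have eq: "N.bar (rho_dens c m q (chi n) (phi n) (psi n) (Dpsi n)) = rb n"
        "N.bar (energy_dens c m q G1 (chi n) (a n) (phi n) (psi n) (Dpsi n)) = Eb n"
        "N.bar (N.P j) = Pb n j" "N.bar (N.J j) = Jb n j" for j
        by (simp_all add: fun_eq_iff N.bar_def rb_def Eb_def Pb_def Jb_def rho_bar_def E_bar_def N.P_def N.A_def N.J_def)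
      show ?case
      proof (intro ballI allI)
        fix t j assume t: "t \<in> {Tm..Tp}"
        then have st: "Tm \<le> t" "t \<le> Tp" by auto
        have "\<bar>rb n t\<bar> \<le> K * CI"
          using N.bar_le[OF N.cont(1) N.density_le(1) N.K_ge(7) t] unfolding eq K .
        then show "?est n t j"
          using N.estimates(1,3)[OF order_refl st, unfolded eq] N.estimates(2,4,5)[OF order_refl st, of j, unfolded eq] err
          by (intro conjI; linarith)
      qed
    qed
  qed
  obtain Cg0 where Cg: "\<And>t. t \<in> {Tm..Tp} \<Longrightarrow> norm (g t) \<le> Cg0 \<and> norm (g' t) \<le> Cg0" using lcl by blast
  obtain c0 n0 where c0: "c0 > 0" "\<And>n t. n \<ge> n0 \<Longrightarrow> t \<in> {Tm..Tp} \<Longrightarrow> c0 \<le> Eb n t"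
    using conc unfolding Eb_def by blast
  have E0: "(\<lambda>n. Eb n t0) \<longlonglongrightarrow> E0" using conc unfolding Eb_def by blast
  have M: "\<forall>\<^sub>F n in sequentially. \<bar>rb n Tm\<bar> \<le> K * CI"
    using est[OF zero_less_one] by eventually_elim (use T in auto)
  show ?thesis
    unfolding rb_def[symmetric] Eb_def[symmetric]
  proof (rule limit_dynamics[where rb = rb and Eb = Eb and Pb = Pb and Jb = Jb, OF \<open>c > 0\<close> t0 cr' g Cg cont M E0 c0])
  qed (assumption | (rule est[THEN eventually_mono], assumption, blast))+
qed

end
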